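(* Let $n\geq 2$ and let $X$ be an $n$-Hawaiian like space with base point $x^*$. Then $\pi_n^{top}(X,x^* )$ is a topological group. Moreover, $\pi_n^{top}(X,x^* )$ is a prodiscrete metric space; more precisely, it is homeomorphic (via the natural homomorphism $\beta_n$) to the inverse limit $\varprojlim \pi_n(Y_i^{(n)},y_i^* )$ of discrete groups.
   Context: An $n$-Hawaiian like space is defined as follows: for each $j\in\mathbb{N}$ let $(X_j^{(n)},x_j^* )$ be a based compact CW space which is $(n-1)$-connected, locally $(n-1)$-connected and $n$-semilocally simply connected; let $Y_i^{(n)}=\bigvee_{j\leq i}X_j^{(n)}$ with base point $y_i^*$ the wedge point, with collapsing maps $r_k^i:Y_i^{(n)}\to Y_k^{(n)}$ ($k\leq i$) that are the identity on $Y_k^{(n)}$ and send $X_j^{(n)}$ ($k<j\leq i$) to the base point; then $X=\varprojlim Y_i^{(n)}$ with base point $x^*$ the wedge point. $R_i:X\to Y_i^{(n)}$ denotes the limit projection, and $\beta_n:\pi_n(X,x^* )\to\varprojlim\pi_n(Y_i^{(n)},y_i^* )$ is $\beta_n([f])=([R_1\circ f],[R_2\circ f],\dots)$. The topological homotopy group $\pi_n^{top}(X,x^* )$ is the group $\pi_n(X,x^* )$ endowed with the quotient topology induced by the quotient map $q:\Omega^n(X,x^* )\to\pi_n(X,x^* )$, $f\mapsto[f]$, where $\Omega^n(X,x^* )$ (maps $(I^n,\partial I^n)\to(X,x^* )$) carries the compact-open topology. Each $\pi_n(Y_i^{(n)},y_i^* )$ carries the discrete topology and the inverse limit carries the induced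 (inverse limit) topology. *)

theory Defs
  imports "HOL-Analysis.Analysis"
begin

definition euclid :: "nat \<Rightarrow> (nat \<Rightarrow> real) topology" where
  "euclid d = product_topology (\<lambda>_. euclideanreal) {..<d}"

definition cube :: "nat \<Rightarrow> (nat \<Rightarrow> real) topology" where
  "cube d = subtopology (euclid d) {t. \<forall>i<d. 0 \<le> t i \<and> t i \<le> 1}"

definition cube_bdry :: "nat \<Rightarrow> (nat \<Rightarrow> real) set" where
  "cube_bdry d = {t \<in> topspace (cube d). \<exists>i<d. t i = 0 \<or> t i = 1}"

definition disc :: "nat \<Rightarrow> (nat \<Rightarrow> real) topology" where
  "disc d = subtopology (euclid d) {x. (\<Sum>i<d. (x i)\<^sup>2) \<le> 1}"

definition open_disc_set :: "nat \<Rightarrow> (nat \<Rightarrow> real) set" where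
  "open_disc_set d = {x \<in> topspace (euclid d). (\<Sum>i<d. (x i)\<^sup>2) < 1}"

definition disc_bdry :: "nat \<Rightarrow> (nat \<Rightarrow> real) set" where
  "disc_bdry d = {x \<in> topspace (euclid d). (\<Sum>i<d. (x i)\<^sup>2) = 1}"

definition sphere_top :: "nat \<Rightarrow> (nat \<Rightarrow> real) topology" where
  "sphere_top k = subtopology (euclid (Suc k)) (disc_bdry (Suc k))"

definition compact_CW_space :: "'a topology \<Rightarrow> bool" where
  "compact_CW_space T \<longleftrightarrow> compact_space T \<and> Hausdorff_space T \<and>
    (\<exists>(cells :: 'a set set) (dim :: 'a set \<Rightarrow> nat) (\<Phi> :: 'a set \<Rightarrow> (nat \<Rightarrow> real) \<Rightarrow> 'a).
       finite cells \<and> {} \<notin> cells \<and> pairwise disjnt cells \<and> \<Union>cells = topspace T \<and>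
       (\<forall>e\<in>cells. continuous_map (disc (dim e)) T (\<Phi> e) \<and>
          homeomorphic_map (subtopology (disc (dim e)) (open_disc_set (dim e))) (subtopology T e) (\<Phi> e) \<and>
          \<Phi> e ` disc_bdry (dim e) \<subseteq> \<Union>{e'\<in>cells. dim e' < dim e}))"

definition Omega :: "'a topology \<Rightarrow> 'a \<Rightarrow> nat \<Rightarrow> ((nat \<Rightarrow> real) \<Rightarrow> 'a) set" where
  "Omega T x n = {f. f \<in> extensional (topspace (cube n)) \<and> continuous_map (cube n) T f \<and>
                     (\<forall>t\<in>cube_bdry n. f t = x)}"

definition rel_htpc :: "'a topology \<Rightarrow> 'a \<Rightarrow> nat \<Rightarrow> ((nat \<Rightarrow> real) \<Rightarrow> 'a) \<Rightarrow> ((nat \<Rightarrow> real) \<Rightarrow> 'a) \<Rightarrow> bool" where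
  "rel_htpc T x n f g = homotopic_with (\<lambda>h. \<forall>t\<in>cube_bdry n. h t = x) (cube n) T f g"

text \<open>The homotopy class [f] (f need only be given on the cube).\<close>
definition hclass :: "'a topology \<Rightarrow> 'a \<Rightarrow> nat \<Rightarrow> ((nat \<Rightarrow> real) \<Rightarrow> 'a) \<Rightarrow> ((nat \<Rightarrow> real) \<Rightarrow> 'a) set" where
  "hclass T x n f = {g \<in> Omega T x n. rel_htpc T x n f g}"

definition pi_set :: "'a topology \<Rightarrow> 'a \<Rightarrow> nat \<Rightarrow> ((nat \<Rightarrow> real) \<Rightarrow> 'a) set set" where
  "pi_set T x n = hclass T x n ` Omega T x n"

definition concat :: "((nat \<Rightarrow> real) \<Rightarrow> 'a) \<Rightarrow> ((nat \<Rightarrow> real) \<Rightarrow> 'a) \<Rightarrow> (nat \<Rightarrow> real) \<Rightarrow> 'a" where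
  "concat f g t = (if t 0 \<le> 1/2 then f (t(0 := 2 * t 0)) else g (t(0 := 2 * t 0 - 1)))"

definition reverse :: "((nat \<Rightarrow> real) \<Rightarrow> 'a) \<Rightarrow> (nat \<Rightarrow> real) \<Rightarrow> 'a" where
  "reverse f t = f (t(0 := 1 - t 0))"

definition pi_mult :: "'a topology \<Rightarrow> 'a \<Rightarrow> nat \<Rightarrow> ((nat \<Rightarrow> real) \<Rightarrow> 'a) set \<Rightarrow> ((nat \<Rightarrow> real) \<Rightarrow> 'a) set \<Rightarrow> ((nat \<Rightarrow> real) \<Rightarrow> 'a) set" where
  "pi_mult T x n a b = hclass T x n (concat (SOME f. f \<in> a) (SOME g. g \<in> b))"

definition pi_inv :: "'a topology \<Rightarrow> 'a \<Rightarrow> nat \<Rightarrow> ((nat \<Rightarrow> real) \<Rightarrow> 'a) set \<Rightarrow> ((nat \<Rightarrow> real) \<Rightarrow> 'a) set" where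
  "pi_inv T x n a = hclass T x n (reverse (SOME f. f \<in> a))"

definition pi_one :: "'a topology \<Rightarrow> 'a \<Rightarrow> nat \<Rightarrow> ((nat \<Rightarrow> real) \<Rightarrow> 'a) set" where
  "pi_one T x n = hclass T x n (\<lambda>_. x)"

definition induced :: "'b topology \<Rightarrow> 'b \<Rightarrow> nat \<Rightarrow> ('a \<Rightarrow> 'b) \<Rightarrow> ((nat \<Rightarrow> real) \<Rightarrow> 'a) set \<Rightarrow> ((nat \<Rightarrow> real) \<Rightarrow> 'b) set" where
  "induced S y n h a = hclass S y n (h \<circ> (SOME f. f \<in> a))"

definition compact_open :: "'a topology \<Rightarrow> 'b topology \<Rightarrow> ('a \<Rightarrow> 'b) topology" where
  "compact_open S T = subtopology
     (topology_generated_by {{f. f \<in> extensional (topspace S) \<and> continuous_map S T f \<and> f ` K \<subseteq> U} | K U.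
         compactin S K \<and> openin T U})
     {f. f \<in> extensional (topspace S) \<and> continuous_map S T f}"

definition quotient_top :: "'a topology \<Rightarrow> 'b set \<Rightarrow> ('a \<Rightarrow> 'b) \<Rightarrow> 'b topology" where
  "quotient_top T B q = topology (\<lambda>U. U \<subseteq> B \<and> openin T {p \<in> topspace T. q p \<in> U})"

definition pi_top :: "'a topology \<Rightarrow> 'a \<Rightarrow> nat \<Rightarrow> ((nat \<Rightarrow> real) \<Rightarrow> 'a) set topology" where
  "pi_top T x n = quotient_top (subtopology (compact_open (cube n) T) (Omega T x n)) (pi_set T x n) (hclass T x n)"

definition topological_group :: "'g topology \<Rightarrow> ('g \<Rightarrow> 'g \<Rightarrow> 'g) \<Rightarrow> ('g \<Rightarrow> 'g) \<Rightarrow> 'g \<Rightarrow> bool" where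
  "topological_group G m i e \<longleftrightarrow>
     e \<in> topspace G \<and>
     (\<forall>a\<in>topspace G. \<forall>b\<in>topspace G. m a b \<in> topspace G) \<and>
     (\<forall>a\<in>topspace G. i a \<in> topspace G) \<and>
     (\<forall>a\<in>topspace G. \<forall>b\<in>topspace G. \<forall>c\<in>topspace G. m (m a b) c = m a (m b c)) \<and>
     (\<forall>a\<in>topspace G. m e a = a \<and> m a e = a) \<and>
     (\<forall>a\<in>topspace G. m (i a) a = e \<and> m a (i a) = e) \<and>
     continuous_map (prod_topology G G) G (\<lambda>p. m (fst p) (snd p)) \<and>
     continuous_map G G i"

text \<open>k-connected: nonempty and pi_m trivial for all m \<le> k (m = 0: path-connected).\<close>
definition k_connected :: "nat \<Rightarrow> 'a topology \<Rightarrow> bool" where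
  "k_connected k T \<longleftrightarrow> topspace T \<noteq> {} \<and>
     (\<forall>m\<le>k. \<forall>x\<in>topspace T. \<forall>f\<in>Omega T x m. rel_htpc T x m f (\<lambda>_. x))"

definition locally_k_connected :: "nat \<Rightarrow> 'a topology \<Rightarrow> bool" where
  "locally_k_connected k T \<longleftrightarrow>
     (\<forall>x\<in>topspace T. \<forall>U. openin T U \<and> x \<in> U \<longrightarrow>
        (\<exists>V. openin T V \<and> x \<in> V \<and> V \<subseteq> U \<and>
          (\<forall>m\<le>k. \<forall>f. continuous_map (sphere_top m) (subtopology T V) f \<longrightarrow>
              (\<exists>c. homotopic_with (\<lambda>_. True) (sphere_top m) (subtopology T U) f (\<lambda>_. c)))))"

definition n_slsc :: "nat \<Rightarrow> 'a topology \<Rightarrow> bool" where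
  "n_slsc n T \<longleftrightarrow>
     (\<forall>x\<in>topspace T. \<exists>U. openin T U \<and> x \<in> U \<and>
        (\<forall>f\<in>Omega (subtopology T U) x n. rel_htpc T x n f (\<lambda>_. x)))"

text \<open>Points of Y_i are modelled as sequences p with p j \<in> X_j for j \<le> i, p j = x_j* for j > i,
  and at most one coordinate different from the base point; Y_i carries the quotient
  topology from the disjoint sum of X_0..X_i (the wedge sum).\<close>
definition wedge_set :: "(nat \<Rightarrow> 'a topology) \<Rightarrow> (nat \<Rightarrow> 'a) \<Rightarrow> nat \<Rightarrow> (nat \<Rightarrow> 'a) set" where
  "wedge_set Xs xb i = {p. (\<forall>j\<le>i. p j \<in> topspace (Xs j)) \<and> (\<forall>j>i. p j = xb j) \<and>
                           (\<forall>j k. j \<noteq> k \<longrightarrow> p j = xb j \<or> p k = xb k)}"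

definition wedge_incl :: "(nat \<Rightarrow> 'a) \<Rightarrow> nat \<times> 'a \<Rightarrow> nat \<Rightarrow> 'a" where
  "wedge_incl xb q = (\<lambda>k. if k = fst q then snd q else xb k)"

definition wedge :: "(nat \<Rightarrow> 'a topology) \<Rightarrow> (nat \<Rightarrow> 'a) \<Rightarrow> nat \<Rightarrow> (nat \<Rightarrow> 'a) topology" where
  "wedge Xs xb i = quotient_top (sum_topology Xs {..i}) (wedge_set Xs xb i) (wedge_incl xb)"

text \<open>Collapsing map r_k^i : Y_i \<rightarrow> Y_k (the formula does not depend on i).\<close>
definition collapse :: "(nat \<Rightarrow> 'a) \<Rightarrow> nat \<Rightarrow> (nat \<Rightarrow> 'a) \<Rightarrow> nat \<Rightarrow> 'a" where
  "collapse xb k p = (\<lambda>j. if j \<le> k then p j else xb j)"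

definition hawaiian :: "(nat \<Rightarrow> 'a topology) \<Rightarrow> (nat \<Rightarrow> 'a) \<Rightarrow> (nat \<Rightarrow> nat \<Rightarrow> 'a) topology" where
  "hawaiian Xs xb = subtopology (product_topology (wedge Xs xb) UNIV)
      {g. \<forall>k i. k \<le> i \<longrightarrow> collapse xb k (g i) = g k}"

definition hbase :: "(nat \<Rightarrow> 'a) \<Rightarrow> nat \<Rightarrow> nat \<Rightarrow> 'a" where
  "hbase xb = (\<lambda>i. xb)"

definition invlim_pi :: "(nat \<Rightarrow> 'a topology) \<Rightarrow> (nat \<Rightarrow> 'a) \<Rightarrow> nat \<Rightarrow> (nat \<Rightarrow> ((nat \<Rightarrow> real) \<Rightarrow> nat \<Rightarrow> 'a) set) topology" where
  "invlim_pi Xs xb n = subtopology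
      (product_topology (\<lambda>i. discrete_topology (pi_set (wedge Xs xb i) xb n)) UNIV)
      {a. \<forall>k i. k \<le> i \<longrightarrow> induced (wedge Xs xb k) xb n (collapse xb k) (a i) = a k}"

definition beta :: "(nat \<Rightarrow> 'a topology) \<Rightarrow> (nat \<Rightarrow> 'a) \<Rightarrow> nat \<Rightarrow> ((nat \<Rightarrow> real) \<Rightarrow> nat \<Rightarrow> nat \<Rightarrow> 'a) set \<Rightarrow> nat \<Rightarrow> ((nat \<Rightarrow> real) \<Rightarrow> nat \<Rightarrow> 'a) set" where
  "beta Xs xb n a = (\<lambda>i. induced (wedge Xs xb i) xb n (\<lambda>g. g i) a)"

end

theory Submission
  imports Defs
begin

text \<open>
  The Hawaiian like space is the set of points of the product of the \<open>X\<^sub>j\<close> with at most one coordinate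
  off the base point. A finite CW space \<open>A\<close> is well pointed at each of its points: the identity is homotopic,
  relative to the point, to a map that is constant near it. Given a map \<open>(\<alpha>, \<beta>)\<close> of the \<open>n\<close>-cube into
  \<open>A \<or> B\<close>, one can therefore first deform \<open>\<alpha>\<close> so that on each cube of a fine grid \<open>\<alpha>\<close> or \<open>\<beta>\<close> is constant.
  If \<open>A\<close> and \<open>B\<close> are \<open>(n - 1)\<close>-connected, both can be made constant on the \<open>(n - 1)\<close>-skeleton of the grid without
  destroying this, and for \<open>n \<ge> 2\<close> the two families of grid cubes can be moved past each other into the two halves of
  the cube. There a nullhomotopy of \<open>\<alpha>\<close> does not interfere with \<open>\<beta>\<close>. Removing the coordinates one after the
  other, at times \<open>1 - 2\<^sup>-\<^sup>j\<close>, shows that a map into the Hawaiian like space is null homotopic as soon as all its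
  coordinates are; hence \<open>\<beta>\<^sub>n\<close> is injective, and infinite concatenation makes it surjective.

  Well pointedness also makes a finite CW space locally contractible, so maps of the cube that are close on a fine
  grid are homotopic, by induction over the skeleta. Thus \<open>\<beta>\<^sub>n\<close> is continuous. It is open because infinite
  concatenations that agree in the first coordinates are close in the compact-open topology.
\<close>

section \<open>Based maps of cubes\<close>

text \<open>The obstacle is that a homotopy into a wedge must at every moment keep all but one
  coordinate at the base point, so nullhomotopies of the coordinates cannot be run side by side.
  Splitting one summand \<open>A\<close> off at a time meets a second difficulty: the complement
  \<open>B\<close> is an infinite wedge and not a CW space. The point-set work is therefore confined
  to \<open>A\<close>, while of \<open>B\<close> one asks that its homotopy vanishes below dimension
  \<open>n\<close>. That in turn comes from a simpler variant of the same argument, in which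
  \<open>A\<close> is connected in the dimension of the cube as well and \<open>\<alpha>\<close> can
  be erased without moving \<open>\<beta>\<close>. Up to the final sliding, every deformation of the
  cube maps each closed grid cell into itself; this carries cellwise information (constancy on a
  grid cube, vanishing on the boundary, closeness) through all the homotopies. Continuity of the
  multiplication is read off the discrete factors of the inverse limit, since the product of two
  quotient maps need not be a quotient map.\<close>

abbreviation unit_interval :: "real topology" where
  "unit_interval \<equiv> top_of_set {0..1}"

text \<open>Membership in \<open>Omega\<close> without extensionality, so that composites,
  \<open>concat\<close> and \<open>reverse\<close>, which are not cut off outside the cube, qualify
  as they stand.\<close>

definition based_map :: "'a topology \<Rightarrow> 'a \<Rightarrow> nat \<Rightarrow> ((nat \<Rightarrow> real) \<Rightarrow> 'a) \<Rightarrow> bool" where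
  "based_map T x n f \<longleftrightarrow> continuous_map (cube n) T f \<and> (\<forall>t\<in>cube_bdry n. f t = x)"

lemma topspace_cube: "topspace (cube n) = PiE {..<n} (\<lambda>_. {0..1})"
  by (auto simp: cube_def euclid_def PiE_def Pi_def)

lemma cube_eq_product: "cube n = product_topology (\<lambda>_. unit_interval) {..<n}"
proof -
  have "topspace (euclid n) \<inter> {t. \<forall>i<n. 0 \<le> t i \<and> t i \<le> 1} = topspace (euclid n) \<inter> (PiE {..<n} (\<lambda>_. {0..1}))"
    by (auto simp: euclid_def PiE_def Pi_def)
  then have "cube n = subtopology (euclid n) (PiE {..<n} (\<lambda>_. {0..1}))"
    using subtopology_restrict[of "euclid n" "{t. \<forall>i<n. 0 \<le> t i \<and> t i \<le> 1}"]
      subtopology_restrict[of "euclid n" "PiE {..<n} (\<lambda>_. {0..1})"]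
    unfolding cube_def by simp
  then show ?thesis
    by (simp add: euclid_def subtopology_product_topology)
qed

lemma compact_cube: "compact_space (cube n)"
  by (simp add: cube_eq_product compact_space_product_topology compact_space_subtopology)

lemma Hausdorff_cube: "Hausdorff_space (cube n)"
  by (simp add: cube_eq_product Hausdorff_space_product_topology Hausdorff_space_subtopology)

lemma cube_bdry_iff: "t \<in> cube_bdry n \<longleftrightarrow> t \<in> topspace (cube n) \<and> (\<exists>i<n. t i = 0 \<or> t i = 1)"
  by (simp add: cube_bdry_def)

lemma cube_bdry_topspace: "t \<in> cube_bdry n \<Longrightarrow> t \<in> topspace (cube n)"
  by (simp add: cube_bdry_iff)

lemma continuous_map_in_topspace: "continuous_map X Y f \<Longrightarrow> x \<in> topspace X \<Longrightarrow> f x \<in> topspace Y"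
  by (simp add: continuous_map_def Pi_iff)

lemma continuous_map_cubeI:
  assumes "\<And>z. z \<in> topspace Z \<Longrightarrow> f z \<in> topspace (cube n)"
    and "\<And>i. i < n \<Longrightarrow> continuous_map Z euclideanreal (\<lambda>z. f z i)"
  shows "continuous_map Z (cube n) f"
  unfolding cube_eq_product continuous_map_componentwise
  using assms by (auto simp: topspace_cube continuous_map_in_subtopology PiE_def Pi_def)

lemma continuous_map_cube_coordinate: "i < n \<Longrightarrow> continuous_map (cube n) euclideanreal (\<lambda>t. t i)"
  unfolding cube_def euclid_def
  by (intro continuous_map_from_subtopology) (auto intro: continuous_map_product_projection)

lemma continuous_map_cube_coordinate_compose:
  assumes "continuous_map Z (cube n) f" "i < n"
  shows "continuous_map Z euclideanreal (\<lambda>z. f z i)"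
  using continuous_map_compose[OF assms(1) continuous_map_cube_coordinate[OF assms(2)]]
  by (simp add: o_def)

lemma continuous_map_real_fun:
  assumes "continuous_map Z euclideanreal g" "continuous_on UNIV (p :: real \<Rightarrow> real)"
  shows "continuous_map Z euclideanreal (\<lambda>z. p (g z))"
  using continuous_map_compose[OF assms(1), of euclideanreal p] assms(2) by (simp add: o_def)

lemma continuous_map_into_unit_interval:
  assumes "continuous_map Z euclideanreal g" "\<And>z. z \<in> topspace Z \<Longrightarrow> 0 \<le> g z \<and> g z \<le> 1"
  shows "continuous_map Z unit_interval g"
  using assms by (auto simp: continuous_map_in_subtopology)

lemma continuous_map_fst_real:
  "continuous_map (prod_topology unit_interval T) euclideanreal fst"
  using continuous_map_fst continuous_map_into_fulltopology by blast

lemma continuous_map_compose_pair: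
  assumes H: "continuous_map (prod_topology unit_interval X) T H"
    and a: "continuous_map Z euclideanreal a" "\<And>z. z \<in> topspace Z \<Longrightarrow> 0 \<le> a z \<and> a z \<le> 1"
    and b: "continuous_map Z X b"
  shows "continuous_map Z T (\<lambda>z. H (a z, b z))"
proof -
  have "continuous_map Z (prod_topology unit_interval X) (\<lambda>z. (a z, b z))"
    using continuous_map_into_unit_interval[OF a] b by (simp add: continuous_map_pairwise o_def)
  from continuous_map_compose[OF this H] show ?thesis by (simp add: o_def)
qed

text \<open>The cube is convex. The restriction to \<open>{..<n}\<close> makes the convex
  combination extensional, as points of the cube have to be.\<close>

lemma continuous_map_straight_line:
  assumes "continuous_map (cube n) (cube n) \<phi>" "continuous_map (cube n) (cube n) \<psi>"
  shows "continuous_map (prod_topology unit_interval (cube n)) (cube n)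
           (\<lambda>(s,t). \<lambda>i\<in>{..<n}. (1 - s) * \<phi> t i + s * \<psi> t i)"
proof (rule continuous_map_cubeI)
  fix z assume z: "z \<in> topspace (prod_topology unit_interval (cube n))"
  obtain s t where st: "z = (s,t)" by fastforce
  have s: "0 \<le> s" "s \<le> 1" and t: "t \<in> topspace (cube n)" using z st by auto
  have "\<phi> t \<in> topspace (cube n)" "\<psi> t \<in> topspace (cube n)"
    using continuous_map_in_topspace[OF _ t] assms by auto
  then have "0 \<le> (1 - s) * \<phi> t i + s * \<psi> t i" "(1 - s) * \<phi> t i + s * \<psi> t i \<le> 1" if "i < n" for i
    using that s by (auto simp: topspace_cube PiE_def Pi_def intro!: convex_bound_le)
  then show "(case z of (s,t) \<Rightarrow> \<lambda>i\<in>{..<n}. (1 - s) * \<phi> t i + s * \<psi> t i) \<in> topspace (cube n)"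
    by (auto simp: topspace_cube st)
next
  fix i assume i: "i < n"
  have "continuous_map (prod_topology unit_interval (cube n)) euclideanreal (\<lambda>z. (1 - fst z) * \<phi> (snd z) i + fst z * \<psi> (snd z) i)"
    using continuous_map_cube_coordinate_compose[OF continuous_map_compose[OF continuous_map_snd assms(1)] i]
      continuous_map_cube_coordinate_compose[OF continuous_map_compose[OF continuous_map_snd assms(2)] i]
    by (intro continuous_intros continuous_map_fst_real) (auto simp: o_def)
  then show "continuous_map (prod_topology unit_interval (cube n)) euclideanreal
      (\<lambda>z. (case z of (s,t) \<Rightarrow> \<lambda>i\<in>{..<n}. (1 - s) * \<phi> t i + s * \<psi> t i) i)"
    by (rule continuous_map_eq) (use i in auto)
qed

section \<open>Homotopy relative to the boundary of the cube\<close>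

lemma rel_htpc_iff:
  "rel_htpc T x n f g \<longleftrightarrow>
     (\<exists>H. continuous_map (prod_topology unit_interval (cube n)) T H \<and>
          (\<forall>t\<in>topspace (cube n). H (0,t) = f t) \<and> (\<forall>t\<in>topspace (cube n). H (1,t) = g t) \<and>
          (\<forall>s\<in>{0..1}. \<forall>t\<in>cube_bdry n. H (s,t) = x))"
  unfolding rel_htpc_def
  by (subst homotopic_with) (auto simp: cube_bdry_iff)

lemma rel_htpcI:
  assumes "continuous_map (prod_topology unit_interval (cube n)) T H"
    "\<And>t. t \<in> topspace (cube n) \<Longrightarrow> H (0,t) = f t"
    "\<And>t. t \<in> topspace (cube n) \<Longrightarrow> H (1,t) = g t"
    "\<And>s t. \<lbrakk>0 \<le> s; s \<le> 1; t \<in> cube_bdry n\<rbrakk> \<Longrightarrow> H (s,t) = x"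
  shows "rel_htpc T x n f g"
  unfolding rel_htpc_iff using assms by auto

lemma rel_htpcE:
  assumes "rel_htpc T x n f g"
  obtains H where "continuous_map (prod_topology unit_interval (cube n)) T H"
    "\<And>t. t \<in> topspace (cube n) \<Longrightarrow> H (0,t) = f t"
    "\<And>t. t \<in> topspace (cube n) \<Longrightarrow> H (1,t) = g t"
    "\<And>s t. \<lbrakk>0 \<le> s; s \<le> 1; t \<in> cube_bdry n\<rbrakk> \<Longrightarrow> H (s,t) = x"
  using assms unfolding rel_htpc_iff by (auto simp: atLeastAtMost_iff)

lemma rel_htpc_imp_based_map:
  assumes "rel_htpc T x n f g" shows "based_map T x n f" "based_map T x n g"
  using homotopic_with_imp_continuous_maps[OF assms[unfolded rel_htpc_def]]
    homotopic_with_imp_property[OF assms[unfolded rel_htpc_def]]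
  by (auto simp: based_map_def)

lemma based_map_eq:
  assumes "based_map T x n f" "\<And>t. t \<in> topspace (cube n) \<Longrightarrow> f t = g t"
  shows "based_map T x n g"
  using assms by (auto simp: based_map_def cube_bdry_iff intro: continuous_map_eq)

lemma rel_htpc_equal:
  assumes "based_map T x n f" "\<And>t. t \<in> topspace (cube n) \<Longrightarrow> f t = g t"
  shows "rel_htpc T x n f g"
  using assms based_map_eq[OF assms] unfolding rel_htpc_def based_map_def
  by (intro homotopic_with_equal) auto

lemma rel_htpc_refl: "based_map T x n f \<Longrightarrow> rel_htpc T x n f f"
  by (rule rel_htpc_equal) auto

lemma rel_htpc_sym: "rel_htpc T x n f g \<Longrightarrow> rel_htpc T x n g f"
  unfolding rel_htpc_def by (simp add: homotopic_with_sym)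

lemma rel_htpc_trans [trans]: "rel_htpc T x n f g \<Longrightarrow> rel_htpc T x n g h \<Longrightarrow> rel_htpc T x n f h"
  unfolding rel_htpc_def by (rule homotopic_with_trans)

lemma rel_htpc_cong:
  assumes "rel_htpc T x n f g" "\<And>t. t \<in> topspace (cube n) \<Longrightarrow> f t = f' t" "\<And>t. t \<in> topspace (cube n) \<Longrightarrow> g t = g' t"
  shows "rel_htpc T x n f' g'"
  using assms by (auto elim!: rel_htpcE intro!: rel_htpcI)

lemma rel_htpc_compose_left:
  assumes "rel_htpc T x n f g" "continuous_map T T' h" "h x = x'"
  shows "rel_htpc T' x' n (h \<circ> f) (h \<circ> g)"
  using assms(1)
proof (rule rel_htpcE)
  fix H assume H: "continuous_map (prod_topology unit_interval (cube n)) T H"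
    "\<And>t. t \<in> topspace (cube n) \<Longrightarrow> H (0,t) = f t" "\<And>t. t \<in> topspace (cube n) \<Longrightarrow> H (1,t) = g t"
    "\<And>s t. \<lbrakk>0 \<le> s; s \<le> 1; t \<in> cube_bdry n\<rbrakk> \<Longrightarrow> H (s,t) = x"
  show ?thesis
    by (rule rel_htpcI[OF continuous_map_compose[OF H(1) assms(2)]]) (auto simp: H assms(3))
qed

lemma based_map_compose_left:
  assumes "based_map T x n f" "continuous_map T T' h" "h x = x'"
  shows "based_map T' x' n (h \<circ> f)"
  using assms unfolding based_map_def by (auto intro: continuous_map_compose)

lemma based_map_const: "x \<in> topspace T \<Longrightarrow> based_map T x n (\<lambda>_. x)"
  by (simp add: based_map_def)

lemma based_map_in_topspace: "based_map T x n f \<Longrightarrow> t \<in> topspace (cube n) \<Longrightarrow> f t \<in> topspace T"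
  unfolding based_map_def using continuous_map_funspace by fastforce

text \<open>The straight line from \<open>\<phi>\<close> to \<open>\<psi>\<close>, followed by
  \<open>f\<close>. The segments over boundary points need not stay in the boundary, hence the
  explicit requirement that \<open>f\<close> is \<open>x\<close> along them.\<close>

lemma rel_htpc_reparam:
  assumes f: "based_map T x n f"
    and cont: "continuous_map (cube n) (cube n) \<phi>" "continuous_map (cube n) (cube n) \<psi>"
    and bd: "\<And>s t. \<lbrakk>0 \<le> s; s \<le> 1; t \<in> cube_bdry n\<rbrakk> \<Longrightarrow> f (\<lambda>i\<in>{..<n}. (1 - s) * \<phi> t i + s * \<psi> t i) = x"
  shows "rel_htpc T x n (f \<circ> \<phi>) (f \<circ> \<psi>)"
proof (rule rel_htpcI[OF continuous_map_compose[OF continuous_map_straight_line[OF cont]]])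
  show "continuous_map (cube n) T f" using f by (simp add: based_map_def)
  have ext: "h t \<in> extensional {..<n}" if "continuous_map (cube n) (cube n) h" "t \<in> topspace (cube n)" for h t
    using continuous_map_funspace[OF that(1)] that(2) by (auto simp: topspace_cube PiE_def)
  fix t assume t: "t \<in> topspace (cube n)"
  have "restrict (\<phi> t) {..<n} = \<phi> t" "restrict (\<psi> t) {..<n} = \<psi> t"
    using ext[OF cont(1) t] ext[OF cont(2) t] by (auto intro: extensional_restrict)
  then show "(f \<circ> (\<lambda>(s, t). \<lambda>i\<in>{..<n}. (1 - s) * \<phi> t i + s * \<psi> t i)) (0, t) = (f \<circ> \<phi>) t"
    "(f \<circ> (\<lambda>(s, t). \<lambda>i\<in>{..<n}. (1 - s) * \<phi> t i + s * \<psi> t i)) (1, t) = (f \<circ> \<psi>) t"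
    by auto
qed (use bd in auto)

lemma cube_update:
  assumes "t \<in> topspace (cube n)" "0 \<le> r" "r \<le> 1" "i < n"
  shows "t(i := r) \<in> topspace (cube n)"
  using assms by (auto simp: topspace_cube PiE_def Pi_def extensional_def)

lemma cube_coordD: "t \<in> topspace (cube n) \<Longrightarrow> i < n \<Longrightarrow> 0 \<le> t i \<and> t i \<le> 1"
  by (auto simp: topspace_cube PiE_def Pi_def)

lemma continuous_map_cube_update:
  assumes "continuous_map Z (cube n) b" "continuous_map Z euclideanreal r"
    "\<And>z. z \<in> topspace Z \<Longrightarrow> 0 \<le> r z \<and> r z \<le> 1" "i < n"
  shows "continuous_map Z (cube n) (\<lambda>z. (b z)(i := r z))"
proof (rule continuous_map_cubeI)
  show "(b z)(i := r z) \<in> topspace (cube n)" if "z \<in> topspace Z" for z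
    by (intro cube_update continuous_map_in_topspace[OF assms(1) that]) (use assms that in auto)
  show "continuous_map Z euclideanreal (\<lambda>z. ((b z)(i := r z)) j)" if "j < n" for j
    using continuous_map_cube_coordinate_compose[OF assms(1) that] assms(2) by (cases "j = i") auto
qed

lemma cube_face:
  assumes "t \<in> topspace (cube n)" "i < n" "r = 0 \<or> r = 1"
  shows "t(i := r) \<in> cube_bdry n"
  using cube_update[OF assms(1) _ _ assms(2), of r] assms(2,3) by (auto simp: cube_bdry_iff)

lemma based_map_bdry: "based_map T x n f \<Longrightarrow> t \<in> cube_bdry n \<Longrightarrow> f t = x"
  by (simp add: based_map_def)

lemma cube_bdry_update:
  assumes "t \<in> cube_bdry n" "0 \<le> r" "r \<le> 1" "i < n" "t i = 0 \<Longrightarrow> r = 0 \<or> r = 1" "t i = 1 \<Longrightarrow> r = 0 \<or> r = 1"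
  shows "t(i := r) \<in> cube_bdry n"
proof -
  obtain j where "j < n" "t j = 0 \<or> t j = 1" using assms(1) by (auto simp: cube_bdry_iff)
  then have "(t(i := r)) j = 0 \<or> (t(i := r)) j = 1" using assms by (cases "j = i") auto
  then show ?thesis using \<open>j < n\<close> cube_update assms by (auto simp: cube_bdry_iff simp del: fun_upd_apply)
qed

text \<open>The source of the group laws. Equal endpoint values in \<open>{0,1}\<close> keep the two
  faces orthogonal to direction \<open>i\<close> inside the boundary throughout; the other faces are
  preserved because only coordinate \<open>i\<close> moves.\<close>

lemma rel_htpc_reparam_coordinate:
  assumes f: "based_map T x n f" and i: "i < n"
    and p: "continuous_on UNIV p" "\<And>r. \<lbrakk>0 \<le> r; r \<le> 1\<rbrakk> \<Longrightarrow> 0 \<le> p r \<and> p r \<le> (1::real)"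
    and q: "continuous_on UNIV q" "\<And>r. \<lbrakk>0 \<le> r; r \<le> 1\<rbrakk> \<Longrightarrow> 0 \<le> q r \<and> q r \<le> (1::real)"
    and e: "p 0 = q 0" "p 1 = q 1" "p 0 \<in> {0,1}" "p 1 \<in> {0,1}"
  shows "rel_htpc T x n (\<lambda>t. f (t(i := p (t i)))) (\<lambda>t. f (t(i := q (t i))))"
proof -
  have c: "continuous_map (cube n) (cube n) (\<lambda>t. t(i := h (t i)))"
    if "continuous_on UNIV h" "\<And>r. \<lbrakk>0 \<le> r; r \<le> 1\<rbrakk> \<Longrightarrow> 0 \<le> h r \<and> h r \<le> (1::real)" for h
  proof (rule continuous_map_cube_update[OF _ _ _ i])
    show "continuous_map (cube n) euclideanreal (\<lambda>t. h (t i))"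
      by (intro continuous_map_real_fun[OF continuous_map_cube_coordinate[OF i] that(1)])
    show "0 \<le> h (t i) \<and> h (t i) \<le> 1" if "t \<in> topspace (cube n)" for t
      using cube_coordD[OF that i] \<open>\<And>r. \<lbrakk>0 \<le> r; r \<le> 1\<rbrakk> \<Longrightarrow> 0 \<le> h r \<and> h r \<le> 1\<close> by blast
  qed simp
  have "f (\<lambda>j\<in>{..<n}. (1 - s) * (t(i := p (t i))) j + s * (t(i := q (t i))) j) = x"
    if s: "0 \<le> s" "s \<le> 1" and t: "t \<in> cube_bdry n" for s t
  proof -
    have tt: "t \<in> topspace (cube n)" using t by (simp add: cube_bdry_iff)
    have eq: "(\<lambda>j\<in>{..<n}. (1 - s) * (t(i := p (t i))) j + s * (t(i := q (t i))) j)
            = t(i := (1 - s) * p (t i) + s * q (t i))"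
      using tt i by (auto simp: topspace_cube PiE_def extensional_def fun_eq_iff algebra_simps)
    have "t(i := (1 - s) * p (t i) + s * q (t i)) \<in> cube_bdry n"
    proof (rule cube_bdry_update[OF t _ _ i])
      have b: "0 \<le> p (t i)" "p (t i) \<le> 1" "0 \<le> q (t i)" "q (t i) \<le> 1"
        using p(2) q(2) cube_coordD[OF tt i] by auto
      show "0 \<le> (1 - s) * p (t i) + s * q (t i)" using b s by auto
      show "(1 - s) * p (t i) + s * q (t i) \<le> 1" using b s by (intro convex_bound_le) auto
    qed (use e in \<open>auto simp: algebra_simps\<close>)
    then show ?thesis using f eq by (simp add: based_map_def)
  qed
  with rel_htpc_reparam[OF f c[of p, OF p] c[of q, OF q]]
  have "rel_htpc T x n (f \<circ> (\<lambda>t. t(i := p (t i)))) (f \<circ> (\<lambda>t. t(i := q (t i))))" by blast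
  then show ?thesis by (simp add: o_def)
qed

section \<open>Concatenation, reversal and the group laws up to homotopy\<close>

lemma concat_clamp:
  assumes "t \<in> topspace (cube n)" "0 < n"
  shows "concat f g t = (if t 0 \<le> 1/2 then f (t(0 := min 1 (2 * t 0))) else g (t(0 := max 0 (2 * t 0 - 1))))"
proof (cases "t 0 \<le> 1/2")
  case True then show ?thesis by (simp add: concat_def min_absorb2)
next
  case False then show ?thesis by (simp add: concat_def max_absorb2)
qed

lemma rel_htpc_concat:
  assumes "rel_htpc T x n f f'" "rel_htpc T x n g g'" and n: "0 < n"
  shows "rel_htpc T x n (concat f g) (concat f' g')"
proof -
  obtain F where F: "continuous_map (prod_topology unit_interval (cube n)) T F"
    "\<And>t. t \<in> topspace (cube n) \<Longrightarrow> F (0,t) = f t" "\<And>t. t \<in> topspace (cube n) \<Longrightarrow> F (1,t) = f' t"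
    "\<And>s t. \<lbrakk>0 \<le> s; s \<le> 1; t \<in> cube_bdry n\<rbrakk> \<Longrightarrow> F (s,t) = x" by (rule rel_htpcE[OF assms(1)]) (rule that)
  obtain G where G: "continuous_map (prod_topology unit_interval (cube n)) T G"
    "\<And>t. t \<in> topspace (cube n) \<Longrightarrow> G (0,t) = g t" "\<And>t. t \<in> topspace (cube n) \<Longrightarrow> G (1,t) = g' t"
    "\<And>s t. \<lbrakk>0 \<le> s; s \<le> 1; t \<in> cube_bdry n\<rbrakk> \<Longrightarrow> G (s,t) = x" by (rule rel_htpcE[OF assms(2)]) (rule that)
  let ?Z = "prod_topology unit_interval (cube n)"
  have c0: "continuous_map ?Z euclideanreal (\<lambda>z. snd z 0)"
    using continuous_map_cube_coordinate_compose[OF continuous_map_snd[of unit_interval] n] by simp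
  have upd: "t(0 := min 1 (2 * t 0)) \<in> topspace (cube n)" "t(0 := max 0 (2 * t 0 - 1)) \<in> topspace (cube n)"
    if "t \<in> topspace (cube n)" for t
    using cube_coordD[OF that n] by (auto intro!: cube_update that n)
  have bd: "t(0 := min 1 (2 * t 0)) \<in> cube_bdry n" "t(0 := max 0 (2 * t 0 - 1)) \<in> cube_bdry n"
    if "t \<in> cube_bdry n" for t
    using that cube_coordD[OF cube_bdry_topspace[OF that] n] n by (auto intro!: cube_bdry_update)
  have upd': "t(0 := 2 * t 0) \<in> topspace (cube n)" if "t \<in> topspace (cube n)" "t 0 * 2 \<le> 1" for t
    using upd(1)[OF that(1)] that(2) by (simp add: min_absorb2)
  have upd'': "t(0 := 2 * t 0 - 1) \<in> topspace (cube n)" if "t \<in> topspace (cube n)" "\<not> t 0 * 2 \<le> 1" for t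
    using upd(2)[OF that(1)] that(2) by (simp add: max_absorb2)
  have bd': "t(0 := 2 * t 0) \<in> cube_bdry n" if "t \<in> cube_bdry n" "t 0 * 2 \<le> 1" for t
    using bd(1)[OF that(1)] that(2) by (simp add: min_absorb2)
  have bd'': "t(0 := 2 * t 0 - 1) \<in> cube_bdry n" if "t \<in> cube_bdry n" "\<not> t 0 * 2 \<le> 1" for t
    using bd(2)[OF that(1)] that(2) by (simp add: max_absorb2)
  \<comment> \<open>Clamping turns each branch into a map of the whole product, so its continuity is
    proved before cutting at \<open>1/2\<close>; on the half where a branch is used its clamp does
    nothing.\<close>
  let ?H = "\<lambda>z. if snd z 0 \<le> 1/2 then F (fst z, (snd z)(0 := min 1 (2 * snd z 0)))
                else G (fst z, (snd z)(0 := max 0 (2 * snd z 0 - 1)))"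
  show ?thesis
  proof (rule rel_htpcI)
    show "continuous_map ?Z T ?H"
    proof (rule continuous_map_cases_le)
      have "continuous_map ?Z T (\<lambda>z. F (fst z, (snd z)(0 := min 1 (2 * snd z 0))))"
        by (rule continuous_map_compose_pair[OF F(1) continuous_map_fst_real _ continuous_map_cube_update[OF continuous_map_snd _ _ n]];
            (intro continuous_intros c0)?) (auto dest: cube_coordD[OF _ n])
      then show "continuous_map (subtopology ?Z {x \<in> topspace ?Z. snd x 0 \<le> 1/2}) T (\<lambda>z. F (fst z, (snd z)(0 := min 1 (2 * snd z 0))))"
        by (rule continuous_map_from_subtopology)
      have "continuous_map ?Z T (\<lambda>z. G (fst z, (snd z)(0 := max 0 (2 * snd z 0 - 1))))"
        by (rule continuous_map_compose_pair[OF G(1) continuous_map_fst_real _ continuous_map_cube_update[OF continuous_map_snd _ _ n]];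
            (intro continuous_intros c0)?) (auto dest: cube_coordD[OF _ n])
      then show "continuous_map (subtopology ?Z {x \<in> topspace ?Z. 1/2 \<le> snd x 0}) T (\<lambda>z. G (fst z, (snd z)(0 := max 0 (2 * snd z 0 - 1))))"
        by (rule continuous_map_from_subtopology)
      fix z assume z: "z \<in> topspace ?Z" "snd z 0 = 1/2"
      then have "(snd z)(0 := 1) \<in> cube_bdry n" "(snd z)(0 := 0) \<in> cube_bdry n"
        by (auto intro: cube_face n)
      then show "F (fst z, (snd z)(0 := min 1 (2 * snd z 0))) = G (fst z, (snd z)(0 := max 0 (2 * snd z 0 - 1)))"
        using z F(4) G(4) by auto
    qed (use c0 in auto)
  qed (simp_all add: F G upd' upd'' bd' bd'' concat_def)
qed

lemma based_map_concat:
  assumes "based_map T x n f" "based_map T x n g" "0 < n"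
  shows "based_map T x n (concat f g)"
  by (rule rel_htpc_imp_based_map(1)[OF rel_htpc_concat[OF rel_htpc_refl[OF assms(1)] rel_htpc_refl[OF assms(2)] assms(3)]])

lemma rel_htpc_concat_assoc:
  assumes "based_map T x n f" "based_map T x n g" "based_map T x n h" "0 < n"
  shows "rel_htpc T x n (concat (concat f g) h) (concat f (concat g h))"
proof -
  \<comment> \<open>Piecewise linear with slopes 2, 1 and 1/2, carrying \<open>[0,1/4]\<close>,
    \<open>[1/4,1/2]\<close>, \<open>[1/2,1]\<close> onto \<open>[0,1/2]\<close>,
    \<open>[1/2,3/4]\<close>, \<open>[3/4,1]\<close>. Being concave, it is the minimum of its affine
    pieces.\<close>
  let ?p = "\<lambda>r::real. min (2 * r) (min (r + 1/4) ((r + 1) / 2))"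
  let ?k = "concat f (concat g h)"
  have c: "continuous_on UNIV ?p" by (intro continuous_intros) auto
  have pb: "0 \<le> ?p r \<and> ?p r \<le> 1" if "0 \<le> r" "r \<le> 1" for r using that by (auto simp: min_def)
  have "rel_htpc T x n (\<lambda>t. ?k (t(0 := ?p (t 0)))) (\<lambda>t. ?k (t(0 := id (t 0))))"
    by (rule rel_htpc_reparam_coordinate)
       (use assms c pb in \<open>auto intro: based_map_concat\<close>)
  moreover have "?k (t(0 := ?p (t 0))) = concat (concat f g) h t" for t
  proof -
    consider "t 0 \<le> 1/4" | "1/4 < t 0" "t 0 \<le> 1/2" | "1/2 < t 0" by linarith
    then show ?thesis
    proof cases
      case 1 then have "?p (t 0) = 2 * t 0" by (auto simp: min_def)
      then show ?thesis using 1 by (auto simp: concat_def)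
    next
      case 2 then have "?p (t 0) = t 0 + 1/4" by (auto simp: min_def)
      then show ?thesis using 2 by (auto simp: concat_def algebra_simps)
    next
      case 3 then have "?p (t 0) = (t 0 + 1) / 2" by (auto simp: min_def)
      then show ?thesis using 3 by (auto simp: concat_def field_simps)
    qed
  qed
  ultimately show ?thesis by (auto elim: rel_htpc_cong)
qed

lemma rel_htpc_concat_const:
  assumes f: "based_map T x n f" and n: "0 < n"
  shows "rel_htpc T x n (concat (\<lambda>_. x) f) f" "rel_htpc T x n (concat f (\<lambda>_. x)) f"
proof -
  have fb: "f (t(0 := r)) = x" if "t \<in> topspace (cube n)" "r = 0 \<or> r = 1" for t r
    using based_map_bdry[OF f cube_face[OF that(1) n that(2)]] .
  have 1: "rel_htpc T x n (\<lambda>t. f (t(0 := max 0 (2 * t 0 - 1)))) (\<lambda>t. f (t(0 := id (t 0))))"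
    by (rule rel_htpc_reparam_coordinate[OF f n]) (auto intro!: continuous_intros)
  show "rel_htpc T x n (concat (\<lambda>_. x) f) f"
    by (rule rel_htpc_cong[OF 1]) (use fb n in \<open>auto simp: concat_clamp max_def\<close>)
  have 2: "rel_htpc T x n (\<lambda>t. f (t(0 := min 1 (2 * t 0)))) (\<lambda>t. f (t(0 := id (t 0))))"
    by (rule rel_htpc_reparam_coordinate[OF f n]) (auto intro!: continuous_intros)
  show "rel_htpc T x n (concat f (\<lambda>_. x)) f"
    by (rule rel_htpc_cong[OF 2]) (use fb n in \<open>auto simp: concat_clamp min_def\<close>)
qed

lemma reverse_reverse: "reverse (reverse f) = f"
  by (auto simp: reverse_def fun_eq_iff)

lemma rel_htpc_reverse:
  assumes "rel_htpc T x n f g" and n: "0 < n"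
  shows "rel_htpc T x n (reverse f) (reverse g)"
proof -
  obtain F where F: "continuous_map (prod_topology unit_interval (cube n)) T F"
    "\<And>t. t \<in> topspace (cube n) \<Longrightarrow> F (0,t) = f t" "\<And>t. t \<in> topspace (cube n) \<Longrightarrow> F (1,t) = g t"
    "\<And>s t. \<lbrakk>0 \<le> s; s \<le> 1; t \<in> cube_bdry n\<rbrakk> \<Longrightarrow> F (s,t) = x" by (rule rel_htpcE[OF assms(1)]) (rule that)
  have c0: "continuous_map (prod_topology unit_interval (cube n)) euclideanreal (\<lambda>z. snd z 0)"
    using continuous_map_cube_coordinate_compose[OF continuous_map_snd[of unit_interval] n] by simp
  have upd: "t(0 := 1 - t 0) \<in> topspace (cube n)" if "t \<in> topspace (cube n)" for t
    using cube_coordD[OF that n] by (auto intro!: cube_update that n)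
  have bd: "t(0 := 1 - t 0) \<in> cube_bdry n" if "t \<in> cube_bdry n" for t
    using that cube_coordD[OF cube_bdry_topspace[OF that] n] n by (auto intro!: cube_bdry_update)
  show ?thesis
  proof (rule rel_htpcI)
    show "continuous_map (prod_topology unit_interval (cube n)) T (\<lambda>z. F (fst z, (snd z)(0 := 1 - snd z 0)))"
      by (rule continuous_map_compose_pair[OF F(1) continuous_map_fst_real _ continuous_map_cube_update[OF continuous_map_snd _ _ n]];
            (intro continuous_intros c0)?) (auto dest: cube_coordD[OF _ n])
  qed (use F upd bd in \<open>auto simp: reverse_def\<close>)
qed

lemma based_map_reverse:
  assumes "based_map T x n f" "0 < n" shows "based_map T x n (reverse f)"
  by (rule rel_htpc_imp_based_map(1)[OF rel_htpc_reverse[OF rel_htpc_refl[OF assms(1)] assms(2)]])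

lemma rel_htpc_concat_reverse_left:
  assumes f: "based_map T x n f" and n: "0 < n"
  shows "rel_htpc T x n (concat (reverse f) f) (\<lambda>_. x)"
proof -
  have fb: "f (t(0 := 1)) = x" if "t \<in> topspace (cube n)" for t
    using based_map_bdry[OF f cube_face[OF that n]] by simp
  \<comment> \<open>On both halves the concatenation reads \<open>f\<close> with
    \<open>\<bar>1 - 2 * t 0\<bar>\<close> as coordinate 0. This path starts and ends at 1, so it
    contracts in the interval to the constant 1, where \<open>f\<close> is \<open>x\<close>.\<close>
  have 1: "rel_htpc T x n (\<lambda>t. f (t(0 := \<bar>1 - 2 * t 0\<bar>))) (\<lambda>t. f (t(0 := 1)))"
    by (rule rel_htpc_reparam_coordinate[OF f n, where q = "\<lambda>_. 1"]) (auto intro!: continuous_intros)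
  show ?thesis
    by (rule rel_htpc_cong[OF 1]) (use fb n in \<open>auto simp: concat_def reverse_def abs_if\<close>)
qed

lemma rel_htpc_concat_reverse_right:
  assumes f: "based_map T x n f" and n: "0 < n"
  shows "rel_htpc T x n (concat f (reverse f)) (\<lambda>_. x)"
  using rel_htpc_concat_reverse_left[OF based_map_reverse[OF assms] n] by (simp add: reverse_reverse)

text \<open>Multiplying by \<open>f\<close> on the left and cancelling. It reduces the comparison of
  two maps into a wedge to the nullhomotopy of one map.\<close>

lemma rel_htpc_if_concat_reverse:
  assumes f: "based_map T x n f" and g: "based_map T x n g" and n: "0 < n"
    and "rel_htpc T x n (concat (reverse f) g) (\<lambda>_. x)"
  shows "rel_htpc T x n f g"
proof -
  note rf = based_map_reverse[OF f n]
  have "rel_htpc T x n f (concat f (\<lambda>_. x))" by (rule rel_htpc_sym[OF rel_htpc_concat_const(2)[OF f n]])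
  also have "rel_htpc T x n (concat f (\<lambda>_. x)) (concat f (concat (reverse f) g))"
    by (rule rel_htpc_concat[OF rel_htpc_refl[OF f] rel_htpc_sym[OF assms(4)] n])
  also have "rel_htpc T x n (concat f (concat (reverse f) g)) (concat (concat f (reverse f)) g)"
    by (rule rel_htpc_sym[OF rel_htpc_concat_assoc[OF f rf g n]])
  also have "rel_htpc T x n (concat (concat f (reverse f)) g) (concat (\<lambda>_. x) g)"
    by (rule rel_htpc_concat[OF rel_htpc_concat_reverse_right[OF f n] rel_htpc_refl[OF g] n])
  also have "rel_htpc T x n (concat (\<lambda>_. x) g) g" by (rule rel_htpc_concat_const(1)[OF g n])
  finally show ?thesis .
qed

section \<open>Grids in the cube\<close>

text \<open>The formula is explicit because later proofs need to know which values the joined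
  homotopy passes through; bare transitivity would forget them.\<close>

lemma continuous_map_homotopy_join:
  assumes H: "continuous_map (prod_topology unit_interval X) Y H"
    and K: "continuous_map (prod_topology unit_interval X) Y K"
    and eq: "\<And>x. x \<in> topspace X \<Longrightarrow> H (1,x) = K (0,x)"
  shows "continuous_map (prod_topology unit_interval X) Y
           (\<lambda>z. if fst z \<le> 1/2 then H (2 * fst z, snd z) else K (2 * fst z - 1, snd z))"
proof (rule continuous_map_cases_le)
  let ?Z = "prod_topology unit_interval X"
  have 1: "continuous_map ?Z Y (\<lambda>z. H (min 1 (2 * fst z), snd z))"
    by (rule continuous_map_compose_pair[OF H _ _ continuous_map_snd]; (intro continuous_intros continuous_map_fst_real)?) auto
  show "continuous_map (subtopology ?Z {z \<in> topspace ?Z. fst z \<le> 1/2}) Y (\<lambda>z. H (2 * fst z, snd z))"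
    by (rule continuous_map_eq[OF continuous_map_from_subtopology[OF 1]]) (auto simp: min_absorb2)
  have 2: "continuous_map ?Z Y (\<lambda>z. K (max 0 (2 * fst z - 1), snd z))"
    by (rule continuous_map_compose_pair[OF K _ _ continuous_map_snd]; (intro continuous_intros continuous_map_fst_real)?) auto
  show "continuous_map (subtopology ?Z {z \<in> topspace ?Z. 1/2 \<le> fst z}) Y (\<lambda>z. K (2 * fst z - 1, snd z))"
    by (rule continuous_map_eq[OF continuous_map_from_subtopology[OF 2]]) (auto simp: max_absorb2)
  show "H (2 * fst z, snd z) = K (2 * fst z - 1, snd z)" if "z \<in> topspace ?Z" "fst z = 1/2" for z
  proof -
    have "2 * fst z = 1" "2 * fst z - 1 = 0" using that(2) by auto
    then show ?thesis using that(1) eq by auto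
  qed
qed (simp_all add: continuous_map_fst_real)

text \<open>The skeleton of dimension \<open>k - 1\<close> of the grid of mesh \<open>1/N\<close>:
  the dimension counts the coordinates off the grid. The shift by one makes
  \<open>skel n N 0\<close> empty, which is where the inductions over skeleta start.\<close>

definition skel :: "nat \<Rightarrow> nat \<Rightarrow> nat \<Rightarrow> (nat \<Rightarrow> real) set" where
  "skel n N k = {t \<in> topspace (cube n). card {i. i < n \<and> real N * t i \<notin> \<int>} < k}"

text \<open>\<open>S\<close> is the set of directions in which the closed cell extends and
  \<open>a\<close> its corner with least coordinates, in units of \<open>1/N\<close>.\<close>

definition cell :: "nat \<Rightarrow> nat \<Rightarrow> (nat \<Rightarrow> nat) \<Rightarrow> nat set \<Rightarrow> (nat \<Rightarrow> real) set" where
  "cell n N a S = {t \<in> topspace (cube n). \<forall>i<n. if i \<in> S then real (a i) \<le> N * t i \<and> N * t i \<le> real (Suc (a i))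
                                                 else N * t i = real (a i)}"

definition cells :: "nat \<Rightarrow> nat \<Rightarrow> nat \<Rightarrow> ((nat \<Rightarrow> nat) \<times> nat set) set" where
  "cells n N k = {(a,S). S \<subseteq> {..<n} \<and> card S = k \<and> a \<in> PiE {..<n} (\<lambda>_. {..N}) \<and> (\<forall>i\<in>S. a i < N)}"

abbreviation gcube :: "nat \<Rightarrow> nat \<Rightarrow> (nat \<Rightarrow> nat) \<Rightarrow> (nat \<Rightarrow> real) set" where
  "gcube n N a \<equiv> cell n N a {..<n}"

text \<open>Expresses that \<open>t'\<close> lies in every closed grid cell containing
  \<open>t\<close>. A deformation that moves points only to near ones preserves cells, skeleta and
  the boundary of the cube.\<close>

definition near :: "nat \<Rightarrow> nat \<Rightarrow> (nat \<Rightarrow> real) \<Rightarrow> (nat \<Rightarrow> real) \<Rightarrow> bool" where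
  "near n N t t' \<longleftrightarrow> t' \<in> topspace (cube n) \<and>
     (\<forall>i<n. \<forall>a::nat. (real a \<le> N * t i \<longrightarrow> real a \<le> N * t' i) \<and> (N * t i \<le> real a \<longrightarrow> N * t' i \<le> real a))"

lemma finite_cells: "finite (cells n N k)"
proof (rule finite_subset)
  show "cells n N k \<subseteq> PiE {..<n} (\<lambda>_. {..N}) \<times> Pow {..<n}" by (auto simp: cells_def)
  show "finite (PiE {..<n} (\<lambda>_. {..N}) \<times> Pow {..<n})" by (intro finite_cartesian_product finite_PiE) auto
qed

lemma near_refl: "t \<in> topspace (cube n) \<Longrightarrow> near n N t t"
  by (simp add: near_def)

lemma near_topspace: "near n N t t' \<Longrightarrow> t' \<in> topspace (cube n)"
  by (simp add: near_def)

lemma nearD: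
  assumes "near n N t t'" "i < n"
  shows "real a \<le> N * t i \<Longrightarrow> real a \<le> N * t' i" "N * t i \<le> real a \<Longrightarrow> N * t' i \<le> real a"
  using assms by (simp_all add: near_def)

lemma near_grid:
  assumes "near n N t t'" "i < n" "N * t i = real a" shows "N * t' i = real a"
  using nearD[OF assms(1,2), of a] assms(3) by (intro antisym; simp)

lemma near_cell:
  assumes "near n N t t'" "t \<in> cell n N a S" shows "t' \<in> cell n N a S"
proof -
  have "if i \<in> S then real (a i) \<le> N * t' i \<and> N * t' i \<le> real (Suc (a i)) else N * t' i = real (a i)" if i: "i < n" for i
  proof (cases "i \<in> S")
    case True
    then have "real (a i) \<le> N * t i" "N * t i \<le> real (Suc (a i))" using assms(2) i by (auto simp: cell_def)
    from nearD(1)[OF assms(1) i this(1)] nearD(2)[OF assms(1) i this(2)] True show ?thesis by simp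
  next
    case False
    then have "N * t i = real (a i)" using assms(2) i by (auto simp: cell_def)
    then show ?thesis using near_grid[OF assms(1) i] False by simp
  qed
  then show ?thesis using near_topspace[OF assms(1)] by (simp add: cell_def del: of_nat_Suc)
qed

lemma near_bdry:
  assumes "near n N t t'" "t \<in> cube_bdry n" "0 < N" shows "t' \<in> cube_bdry n"
proof -
  obtain i where i: "i < n" "t i = 0 \<or> t i = 1" using assms(2) by (auto simp: cube_bdry_iff)
  have "N * t i = real 0 \<or> N * t i = real N" using i by auto
  then have "N * t' i = real 0 \<or> N * t' i = real N" using near_grid[OF assms(1) i(1)] by blast
  then have "t' i = 0 \<or> t' i = 1" using assms(3) by auto
  then show ?thesis using i near_topspace[OF assms(1)] by (auto simp: cube_bdry_iff)
qed

lemma cube_Ints: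
  assumes "t \<in> topspace (cube n)" "i < n" "real N * t i \<in> \<int>"
  shows "\<exists>a\<le>N. N * t i = real a"
proof -
  obtain z where z: "N * t i = of_int z" using assms(3) by (auto elim: Ints_cases)
  have c: "0 \<le> t i" "t i \<le> 1" using cube_coordD[OF assms(1,2)] by auto
  then have "0 \<le> N * t i" "N * t i \<le> N" by (auto intro: mult_left_le)
  then have "0 \<le> z" "z \<le> int N" using z by linarith+
  then show ?thesis using z by (intro exI[of _ "nat z"]) auto
qed

lemma near_skel:
  assumes "near n N t t'" "t \<in> skel n N k" shows "t' \<in> skel n N k"
proof -
  have t: "t \<in> topspace (cube n)" using assms(2) by (simp add: skel_def)
  have "real N * t' i \<in> \<int>" if i: "i < n" "real N * t i \<in> \<int>" for i
    using cube_Ints[OF t i] near_grid[OF assms(1) i(1)] by auto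
  then have "{i. i < n \<and> real N * t' i \<notin> \<int>} \<subseteq> {i. i < n \<and> real N * t i \<notin> \<int>}" by blast
  then have "card {i. i < n \<and> real N * t' i \<notin> \<int>} \<le> card {i. i < n \<and> real N * t i \<notin> \<int>}" by (intro card_mono) auto
  then show ?thesis using assms(2) near_topspace[OF assms(1)] by (simp add: skel_def)
qed

text \<open>The conditions are affine inequalities. Together with \<open>near_refl\<close> this
  shows that the straight line from the identity to a cell-preserving map is cell-preserving at all
  times.\<close>

lemma near_convex:
  assumes "near n N t t'" "near n N t t''" "0 \<le> s" "s \<le> 1"
  shows "near n N t (\<lambda>i\<in>{..<n}. (1 - s) * t' i + s * t'' i)"
proof -
  have "0 \<le> (1 - s) * t' i + s * t'' i \<and> (1 - s) * t' i + s * t'' i \<le> 1" if i: "i < n" for i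
    using cube_coordD[OF near_topspace[OF assms(1)] i] cube_coordD[OF near_topspace[OF assms(2)] i] assms(3,4)
    by (auto intro: convex_bound_le)
  then have 1: "(\<lambda>i\<in>{..<n}. (1 - s) * t' i + s * t'' i) \<in> topspace (cube n)"
    by (auto simp: topspace_cube)
  have eq: "N * ((1 - s) * t' i + s * t'' i) = (1 - s) * (N * t' i) + s * (N * t'' i)" for i
    by (simp add: algebra_simps)
  have lo: "b \<le> (1 - s) * x + s * y" if "b \<le> x" "b \<le> y" for b x y :: real
    using convex_bound_le[of "-x" "-b" "-y" "1 - s" s] that assms(3,4) by auto
  have hi: "(1 - s) * x + s * y \<le> b" if "x \<le> b" "y \<le> b" for b x y :: real
    using convex_bound_le[of "x" "b" "y" "1 - s" s] that assms(3,4) by auto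
  have 2: "(real a \<le> N * t i \<longrightarrow> real a \<le> N * (\<lambda>i\<in>{..<n}. (1 - s) * t' i + s * t'' i) i) \<and>
      (N * t i \<le> real a \<longrightarrow> N * (\<lambda>i\<in>{..<n}. (1 - s) * t' i + s * t'' i) i \<le> real a)" if i: "i < n" for i a
  proof -
    have "real a \<le> N * t i \<longrightarrow> real a \<le> N * t' i" "real a \<le> N * t i \<longrightarrow> real a \<le> N * t'' i"
      "N * t i \<le> real a \<longrightarrow> N * t' i \<le> real a" "N * t i \<le> real a \<longrightarrow> N * t'' i \<le> real a"
      using assms(1,2) i by (auto simp: near_def)
    then show ?thesis using i lo hi by (simp add: eq)
  qed
  show ?thesis using 1 2 by (simp add: near_def)
qed

lemma exists_gcube:
  assumes "t \<in> topspace (cube n)" "0 < N"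
  shows "\<exists>a. a \<in> PiE {..<n} (\<lambda>_. {..<N}) \<and> t \<in> gcube n N a"
proof -
  \<comment> \<open>The minimum with \<open>N - 1\<close> assigns coordinate 1, where the floor
    would be \<open>N\<close>, to the last interval.\<close>
  let ?a = "\<lambda>i\<in>{..<n}. min (N - 1) (nat \<lfloor>N * t i\<rfloor>)"
  have "real (?a i) \<le> N * t i \<and> N * t i \<le> real (Suc (?a i))" if i: "i < n" for i
  proof -
    have c: "0 \<le> t i" "t i \<le> 1" using cube_coordD[OF assms(1) i] by auto
    have u: "0 \<le> N * t i" "N * t i \<le> N" using c by (auto intro: mult_left_le)
    show ?thesis
    proof (cases "nat \<lfloor>N * t i\<rfloor> \<le> N - 1")
      case True
      have "real (nat \<lfloor>N * t i\<rfloor>) = of_int \<lfloor>N * t i\<rfloor>" using u by simp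
      then show ?thesis using True i by (simp add: min_absorb2) linarith
    next
      case False
      then have "real N \<le> N * t i" using assms(2) u by linarith
      then show ?thesis using False i u assms(2) by (simp add: min_absorb1 of_nat_diff)
    qed
  qed
  then have "t \<in> gcube n N ?a" using assms(1) by (simp add: cell_def)
  moreover have "?a \<in> PiE {..<n} (\<lambda>_. {..<N})" using assms(2) by auto
  ultimately show ?thesis by blast
qed

lemma cell_subset_skel:
  assumes "(a,S) \<in> cells n N k" shows "cell n N a S \<subseteq> skel n N (Suc k)"
proof
  fix t assume t: "t \<in> cell n N a S"
  have "{i. i < n \<and> real N * t i \<notin> \<int>} \<subseteq> S" using t by (auto simp: cell_def split: if_splits)
  moreover have "finite S" "card S = k" using assms finite_subset by (auto simp: cells_def)
  ultimately have "card {i. i < n \<and> real N * t i \<notin> \<int>} \<le> k" by (metis card_mono)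
  then show "t \<in> skel n N (Suc k)" using t by (simp add: skel_def cell_def)
qed

text \<open>The off-grid directions of \<open>t\<close> are enlarged to exactly \<open>k\<close>
  directions and the others are frozen at their own grid values, so the resulting face stays in the
  given grid cube. This allows homotopies built on \<open>k\<close>-cells to be controlled cube by
  cube.\<close>

lemma skel_cell_in_gcube:
  assumes t: "t \<in> gcube n N a" "t \<in> skel n N (Suc k)" and k: "k \<le> n" and a: "a \<in> PiE {..<n} (\<lambda>_. {..<N})"
  shows "\<exists>b S. (b,S) \<in> cells n N k \<and> t \<in> cell n N b S \<and> cell n N b S \<subseteq> gcube n N a"
proof -
  have tt: "t \<in> topspace (cube n)" using t by (simp add: skel_def)
  have "card {i. i < n \<and> real N * t i \<notin> \<int>} \<le> k" using t by (simp add: skel_def)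
  then obtain S where S: "{i. i < n \<and> real N * t i \<notin> \<int>} \<subseteq> S" "S \<subseteq> {..<n}" "card S = k"
    using exists_subset_between[of "{i. i < n \<and> real N * t i \<notin> \<int>}" k "{..<n}"] k by auto
  have "\<forall>i\<in>{..<n} - S. \<exists>c\<le>N. N * t i = real c" using cube_Ints[OF tt] S(1) by blast
  then obtain c where c: "\<And>i. i \<in> {..<n} - S \<Longrightarrow> c i \<le> N \<and> N * t i = real (c i)" by metis
  define b where "b = (\<lambda>i\<in>{..<n}. if i \<in> S then a i else c i)"
  have "(b,S) \<in> cells n N k"
    using S a c by (force simp: cells_def b_def PiE_def Pi_def)
  moreover have "t \<in> cell n N b S"
    using t(1) c by (auto simp: cell_def b_def)
  moreover have "cell n N b S \<subseteq> gcube n N a"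
  proof
    fix u assume u: "u \<in> cell n N b S"
    have "real (a i) \<le> N * u i \<and> N * u i \<le> real (Suc (a i))" if i: "i < n" for i
    proof (cases "i \<in> S")
      case True then show ?thesis using u i by (auto simp: cell_def b_def)
    next
      case False
      then have "N * u i = real (c i)" using u i by (auto simp: cell_def b_def)
      then have "N * u i = N * t i" using c i False by auto
      then show ?thesis using t(1) i by (auto simp: cell_def)
    qed
    then show "u \<in> gcube n N a" using u by (simp add: cell_def)
  qed
  ultimately show ?thesis by blast
qed

text \<open>For a point of a \<open>k\<close>-cell outside \<open>skel n N k\<close> the off-grid
  directions are all of \<open>S\<close>, and the integer parts of its coordinates recover
  \<open>a\<close>. So distinct \<open>k\<close>-cells meet only in the lower skeleton.\<close>

lemma cells_Int:
  assumes "(a,S) \<in> cells n N k" "(b,S') \<in> cells n N k" "t \<in> cell n N a S" "t \<in> cell n N b S'" "t \<notin> skel n N k"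
  shows "a = b \<and> S = S'"
proof -
  let ?I = "{i. i < n \<and> real N * t i \<notin> \<int>}"
  have k: "k \<le> card ?I" using assms(3,5) by (auto simp: skel_def cell_def)
  have sub: "?I \<subseteq> S" "?I \<subseteq> S'" using assms(3,4) by (auto simp: cell_def split: if_splits)
  have fin: "finite S" "finite S'" "card S = k" "card S' = k" "S \<subseteq> {..<n}" "S' \<subseteq> {..<n}"
    using assms(1,2) finite_subset by (auto simp: cells_def)
  have S: "?I = S" "?I = S'" using card_seteq[OF fin(1) sub(1)] card_seteq[OF fin(2) sub(2)] fin k by auto
  have "a i = b i" if i: "i < n" for i
  proof (cases "i \<in> S")
    case True
    then have ni: "real N * t i \<notin> \<int>" using S by auto
    have l: "real (a i) \<le> N * t i" "N * t i \<le> real (Suc (a i))" "real (b i) \<le> N * t i" "N * t i \<le> real (Suc (b i))"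
      using assms(3,4) True S i by (auto simp: cell_def)
    have "N * t i \<noteq> real (Suc (a i))" "N * t i \<noteq> real (Suc (b i))" using ni by (metis Ints_of_nat)+
    then have "real (a i) < real (Suc (b i))" "real (b i) < real (Suc (a i))" using l by linarith+
    then show ?thesis by linarith
  next
    case False
    then have "N * t i = real (a i)" using assms(3) i by (simp add: cell_def)
    moreover have "N * t i = real (b i)" using assms(4) i False S unfolding cell_def by auto
    ultimately show ?thesis by simp
  qed
  then have "a = b" using assms(1,2) by (intro PiE_ext[of a "{..<n}" "\<lambda>_. {..N}"]) (auto simp: cells_def)
  then show ?thesis using S by auto
qed

lemma closedin_all_less:
  assumes "\<And>i. i < n \<Longrightarrow> closedin X {t \<in> topspace X. P i t}"
  shows "closedin X {t \<in> topspace X. \<forall>i<(n::nat). P i t}"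
  using assms
proof (induction n)
  case (Suc n)
  have "{t \<in> topspace X. \<forall>i<Suc n. P i t} = {t \<in> topspace X. \<forall>i<n. P i t} \<inter> {t \<in> topspace X. P n t}"
    by (auto simp: less_Suc_eq)
  then show ?case using Suc by (simp add: closedin_Int)
qed simp

lemma openin_all_less:
  assumes "\<And>i. i < n \<Longrightarrow> openin X {t \<in> topspace X. P i t}"
  shows "openin X {t \<in> topspace X. \<forall>i<(n::nat). P i t}"
  using assms
proof (induction n)
  case (Suc n)
  have "{t \<in> topspace X. \<forall>i<Suc n. P i t} = {t \<in> topspace X. \<forall>i<n. P i t} \<inter> {t \<in> topspace X. P n t}"
    by (auto simp: less_Suc_eq)
  then show ?case using Suc by (simp add: openin_Int)
qed simp

lemma closedin_cell: "closedin (cube n) (cell n N a S)"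
  unfolding cell_def
proof (rule closedin_all_less)
  fix i assume i: "i < n"
  let ?C = "if i \<in> S then {real (a i)..real (Suc (a i))} else {real (a i)}"
  have "closedin (cube n) {t \<in> topspace (cube n). real N * t i \<in> ?C}"
    by (rule closedin_continuous_map_preimage[of _ euclideanreal])
       (auto intro!: continuous_intros continuous_map_cube_coordinate i)
  moreover have "{t \<in> topspace (cube n). real N * t i \<in> ?C} = {t :: nat \<Rightarrow> real. t \<in> topspace (cube n) \<and> (if i \<in> S then real (a i) \<le> N * t i \<and> N * t i \<le> real (Suc (a i))
                                                 else N * t i = real (a i))}" by auto
  ultimately show "closedin (cube n) {t \<in> topspace (cube n). if i \<in> S then real (a i) \<le> N * t i \<and> N * t i \<le> real (Suc (a i))
                                                 else N * t i = real (a i)}" by simp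
qed

lemma skel_Suc_eq:
  assumes "k \<le> n" "0 < N"
  shows "skel n N (Suc k) = (\<Union>(a,S)\<in>cells n N k. cell n N a S)"
proof (rule set_eqI, rule iffI)
  fix t assume t: "t \<in> skel n N (Suc k)"
  then obtain a where "a \<in> PiE {..<n} (\<lambda>_. {..<N})" "t \<in> gcube n N a"
    using exists_gcube[of t n N] assms(2) by (auto simp: skel_def)
  with skel_cell_in_gcube[OF _ t assms(1)] show "t \<in> (\<Union>(a,S)\<in>cells n N k. cell n N a S)" by blast
next
  fix t assume "t \<in> (\<Union>(a,S)\<in>cells n N k. cell n N a S)"
  then show "t \<in> skel n N (Suc k)" using cell_subset_skel by blast
qed

lemma skel_full: "n < k \<Longrightarrow> skel n N k = topspace (cube n)"
proof -
  assume "n < k"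
  have "card {i. i < n \<and> real N * t i \<notin> \<int>} \<le> card {..<n}" for t by (intro card_mono) auto
  then have "card {i. i < n \<and> real N * t i \<notin> \<int>} < k" for t using \<open>n < k\<close> by (metis card_lessThan le_less_trans)
  then show ?thesis by (auto simp: skel_def)
qed

lemma closedin_skel:
  assumes "0 < N" shows "closedin (cube n) (skel n N k)"
proof -
  consider "k = 0" | j where "k = Suc j" "j \<le> n" | "n < k" by (cases k) fastforce+
  then show ?thesis
  proof cases
    case 1 then show ?thesis by (simp add: skel_def)
  next
    case 2
    then show ?thesis using skel_Suc_eq[of j n N] assms finite_cells closedin_cell
      by (auto intro!: closedin_Union)
  next
    case 3 then show ?thesis by (simp add: skel_full)
  qed
qed

section \<open>Characteristic maps of the grid cells\<close>

definition enum :: "nat set \<Rightarrow> nat \<Rightarrow> nat" where "enum S j = sorted_list_of_set S ! j"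

definition index :: "nat set \<Rightarrow> nat \<Rightarrow> nat" where "index S = the_inv_into {..<card S} (enum S)"

text \<open>The affine characteristic map of a cell: free direction \<open>i\<close> reads
  coordinate \<open>index S i\<close> of the small cube. \<open>unchart\<close> inverts it on the
  cell.\<close>

definition chart :: "nat \<Rightarrow> nat \<Rightarrow> (nat \<Rightarrow> nat) \<Rightarrow> nat set \<Rightarrow> (nat \<Rightarrow> real) \<Rightarrow> nat \<Rightarrow> real" where
  "chart n N a S y = (\<lambda>i\<in>{..<n}. (real (a i) + (if i \<in> S then y (index S i) else 0)) / N)"

definition unchart :: "nat \<Rightarrow> (nat \<Rightarrow> nat) \<Rightarrow> nat set \<Rightarrow> (nat \<Rightarrow> real) \<Rightarrow> nat \<Rightarrow> real" where
  "unchart N a S t = (\<lambda>j\<in>{..<card S}. N * t (enum S j) - real (a (enum S j)))"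

lemma bij_enum: "finite S \<Longrightarrow> bij_betw (enum S) {..<card S} S"
  unfolding enum_def by (rule bij_betw_nth) auto

lemma enum_index:
  assumes "finite S" "i \<in> S" shows "enum S (index S i) = i" "index S i < card S"
proof -
  have b: "inj_on (enum S) {..<card S}" "enum S ` {..<card S} = S"
    using bij_enum[OF assms(1)] by (auto simp: bij_betw_def)
  show "enum S (index S i) = i" unfolding index_def
    by (rule f_the_inv_into_f[OF b(1)]) (use b assms in auto)
  show "index S i < card S" unfolding index_def
    using the_inv_into_into[OF b(1), of i "{..<card S}"] b assms by auto
qed

lemma enum_in: "finite S \<Longrightarrow> j < card S \<Longrightarrow> enum S j \<in> S"
  using bij_enum[of S] by (auto simp: bij_betw_def)

lemma cellsD:
  assumes "(a,S) \<in> cells n N k"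
  shows "finite S" "card S = k" "S \<subseteq> {..<n}" "\<And>i. i < n \<Longrightarrow> a i \<le> N" "\<And>i. i \<in> S \<Longrightarrow> a i < N"
  using assms by (auto simp: cells_def PiE_def Pi_def intro: finite_subset)

lemma chart_in_cell:
  assumes c: "(a,S) \<in> cells n N k" and N: "0 < N" and y: "y \<in> topspace (cube k)"
  shows "chart n N a S y \<in> cell n N a S"
proof -
  have b: "0 \<le> y (index S i)" "y (index S i) \<le> 1" if "i \<in> S" for i
    using cube_coordD[OF y] enum_index(2)[OF cellsD(1)[OF c] that] cellsD(2)[OF c] by auto
  have r: "0 \<le> (real (a i) + (if i \<in> S then y (index S i) else 0)) / N"
    "(real (a i) + (if i \<in> S then y (index S i) else 0)) / N \<le> 1" if "i < n" for i
    using b[of i] cellsD(4)[OF c that] cellsD(5)[OF c, of i] N by (auto simp: divide_simps)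
  then have "chart n N a S y \<in> topspace (cube n)" by (auto simp: topspace_cube chart_def)
  then show ?thesis using b N by (auto simp: cell_def chart_def)
qed

lemma continuous_map_chart:
  assumes c: "(a,S) \<in> cells n N k" and N: "0 < N"
  shows "continuous_map (cube k) (cube n) (chart n N a S)"
proof (rule continuous_map_cubeI)
  show "chart n N a S y \<in> topspace (cube n)" if "y \<in> topspace (cube k)" for y
    using chart_in_cell[OF c N that] by (simp add: cell_def)
  fix i assume i: "i < n"
  show "continuous_map (cube k) euclideanreal (\<lambda>y. chart n N a S y i)"
  proof (cases "i \<in> S")
    case True
    then have "index S i < k" using enum_index(2)[OF cellsD(1)[OF c] True] cellsD(2)[OF c] by simp
    then have "continuous_map (cube k) euclideanreal (\<lambda>y. (real (a i) + y (index S i)) / N)"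
      using N by (intro continuous_intros continuous_map_cube_coordinate) auto
    then show ?thesis using i True by (simp add: chart_def)
  qed (use i in \<open>simp add: chart_def\<close>)
qed

lemma unchart_in_cube:
  assumes c: "(a,S) \<in> cells n N k" and t: "t \<in> cell n N a S"
  shows "unchart N a S t \<in> topspace (cube k)"
proof -
  have "0 \<le> N * t (enum S j) - real (a (enum S j)) \<and> N * t (enum S j) - real (a (enum S j)) \<le> 1" if "j < k" for j
  proof -
    have "enum S j \<in> S" using enum_in[OF cellsD(1)[OF c]] cellsD(2)[OF c] that by simp
    moreover from this have "enum S j < n" using cellsD(3)[OF c] by auto
    ultimately show ?thesis using t by (auto simp: cell_def)
  qed
  then show ?thesis using cellsD(2)[OF c] by (auto simp: unchart_def topspace_cube)
qed

lemma continuous_map_unchart: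
  assumes c: "(a,S) \<in> cells n N k"
  shows "continuous_map (subtopology (cube n) (cell n N a S)) (cube k) (unchart N a S)"
proof (rule continuous_map_cubeI)
  show "unchart N a S t \<in> topspace (cube k)" if "t \<in> topspace (subtopology (cube n) (cell n N a S))" for t
    using unchart_in_cube[OF c] that by simp
  fix j assume j: "j < k"
  then have "enum S j < n" using enum_in[OF cellsD(1)[OF c]] cellsD(2,3)[OF c] by auto
  then have "continuous_map (cube n) euclideanreal (\<lambda>t. N * t (enum S j) - real (a (enum S j)))"
    by (intro continuous_intros continuous_map_cube_coordinate)
  then show "continuous_map (subtopology (cube n) (cell n N a S)) euclideanreal (\<lambda>t. unchart N a S t j)"
    using j cellsD(2)[OF c] by (simp add: unchart_def continuous_map_from_subtopology)
qed

lemma chart_unchart: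
  assumes c: "(a,S) \<in> cells n N k" and N: "0 < N" and t: "t \<in> cell n N a S"
  shows "chart n N a S (unchart N a S t) = t"
proof
  fix i
  have ext: "t \<in> extensional {..<n}" using t by (auto simp: cell_def topspace_cube PiE_def)
  show "chart n N a S (unchart N a S t) i = t i"
  proof (cases "i < n")
    case True
    show ?thesis
    proof (cases "i \<in> S")
      case True
      then show ?thesis using \<open>i < n\<close> enum_index[OF cellsD(1)[OF c] True] N by (simp add: chart_def unchart_def)
    next
      case False
      then have "N * t i = real (a i)" using t \<open>i < n\<close> by (auto simp: cell_def)
      then show ?thesis using False \<open>i < n\<close> N by (simp add: chart_def field_simps)
    qed
  qed (use ext in \<open>simp add: chart_def extensional_def\<close>)
qed

lemma chart_bdry_skel:
  assumes c: "(a,S) \<in> cells n N k" and N: "0 < N" and y: "y \<in> cube_bdry k"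
  shows "chart n N a S y \<in> skel n N k"
proof -
  obtain j where j: "j < k" "y j = 0 \<or> y j = 1" using y by (auto simp: cube_bdry_iff)
  let ?t = "chart n N a S y"
  have t: "?t \<in> cell n N a S" by (rule chart_in_cell[OF c N cube_bdry_topspace[OF y]])
  have e: "enum S j \<in> S" using enum_in[OF cellsD(1)[OF c]] cellsD(2)[OF c] j by simp
  have en: "enum S j < n" using e cellsD(3)[OF c] by auto
  have "index S (enum S j) = j"
    unfolding index_def using bij_enum[OF cellsD(1)[OF c]] cellsD(2)[OF c] j
    by (intro the_inv_into_f_f) (auto simp: bij_betw_def)
  then have "N * ?t (enum S j) = real (a (enum S j)) + y j" using e en N by (simp add: chart_def)
  also have "\<dots> \<in> \<int>" using j by auto
  finally have int: "N * ?t (enum S j) \<in> \<int>" .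
  have "{i. i < n \<and> real N * ?t i \<notin> \<int>} \<subseteq> S - {enum S j}" using t int by (auto simp: cell_def split: if_splits)
  then have "card {i. i < n \<and> real N * ?t i \<notin> \<int>} \<le> card (S - {enum S j})" using cellsD(1)[OF c] by (intro card_mono) auto
  also have "\<dots> < card S" using e cellsD(1)[OF c] by (intro psubset_card_mono) auto
  finally show ?thesis using t cellsD(2)[OF c] by (simp add: skel_def cell_def)
qed

lemma unchart_skel_bdry:
  assumes c: "(a,S) \<in> cells n N k" and t: "t \<in> cell n N a S" "t \<in> skel n N k"
  shows "unchart N a S t \<in> cube_bdry k"
proof -
  have "\<not> S \<subseteq> {i. i < n \<and> real N * t i \<notin> \<int>}"
  proof
    assume "S \<subseteq> {i. i < n \<and> real N * t i \<notin> \<int>}"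
    then have "card S \<le> card {i. i < n \<and> real N * t i \<notin> \<int>}" by (intro card_mono) auto
    then show False using t(2) cellsD(2)[OF c] by (simp add: skel_def)
  qed
  then obtain i where i: "i \<in> S" "i < n" "real N * t i \<in> \<int>" using cellsD(3)[OF c] by auto
  have tt: "t \<in> topspace (cube n)" using t by (simp add: cell_def)
  obtain m where m: "N * t i = real m" using cube_Ints[OF tt i(2,3)] by blast
  have "real (a i) \<le> N * t i" "N * t i \<le> real (Suc (a i))" using t i by (auto simp: cell_def)
  then have "m = a i \<or> m = Suc (a i)" using m by linarith
  then have "N * t i - real (a i) = 0 \<or> N * t i - real (a i) = 1" using m by auto
  then have "unchart N a S t (index S i) = 0 \<or> unchart N a S t (index S i) = 1"
    using enum_index[OF cellsD(1)[OF c] i(1)] by (simp add: unchart_def)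
  then show ?thesis
    using enum_index(2)[OF cellsD(1)[OF c] i(1)] unchart_in_cube[OF c t(1)] cellsD(2)[OF c] by (auto simp: cube_bdry_iff)
qed

text \<open>On the overlap of two different cells both homotopies are stationary with the value of
  \<open>f\<close>, by \<open>cells_Int\<close>, so they paste over the finite closed cover by
  cells.\<close>

lemma cell_homotopies_paste:
  assumes N: "0 < N" and k: "k \<le> n"
    and H: "\<And>a S. (a,S) \<in> cells n N k \<Longrightarrow> continuous_map (prod_topology unit_interval (cube k)) Y (H a S)"
    and bd: "\<And>a S s y. \<lbrakk>(a,S) \<in> cells n N k; 0 \<le> s; s \<le> 1; y \<in> cube_bdry k\<rbrakk> \<Longrightarrow> H a S (s,y) = f (chart n N a S y)"
  obtains G where "continuous_map (prod_topology unit_interval (subtopology (cube n) (skel n N (Suc k)))) Y G"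
    "\<And>a S s t. \<lbrakk>(a,S) \<in> cells n N k; t \<in> cell n N a S; 0 \<le> s; s \<le> 1\<rbrakk> \<Longrightarrow> G (s,t) = H a S (s, unchart N a S t)"
proof -
  let ?X = "prod_topology unit_interval (subtopology (cube n) (skel n N (Suc k)))"
  let ?T = "\<lambda>(a,S). {0..1} \<times> cell n N a S"
  let ?h = "\<lambda>(a,S) z. H a S (fst z, unchart N a S (snd z))"
  have sk: "skel n N (Suc k) \<subseteq> topspace (cube n)" by (auto simp: skel_def)
  obtain G where G: "continuous_map ?X Y G"
    "\<And>x i. i \<in> cells n N k \<Longrightarrow> x \<in> topspace ?X \<inter> ?T i \<Longrightarrow> G x = ?h i x"
  proof (rule pasting_lemma_exists_closed[of "cells n N k" ?X ?T Y ?h])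
    show "finite (cells n N k)" by (rule finite_cells)
    show "topspace ?X \<subseteq> \<Union>(?T ` cells n N k)"
      using skel_Suc_eq[OF k N] by (auto split: prod.splits)
    fix c assume "c \<in> cells n N k"
    then obtain a S where c: "c = (a,S)" "(a,S) \<in> cells n N k" by (cases c) auto
    have "closedin (subtopology (cube n) (skel n N (Suc k))) (cell n N a S)"
      by (rule closedin_subset_topspace[OF closedin_cell cell_subset_skel[OF c(2)]])
    then show "closedin ?X (?T c)" by (simp add: c closedin_prod_Times_iff)
    have eq: "subtopology ?X ({0..1} \<times> cell n N a S) = prod_topology unit_interval (subtopology (cube n) (cell n N a S))"
      using cell_subset_skel[OF c(2)] by (simp add: subtopology_Times subtopology_subtopology inf.absorb2)
    have "continuous_map (prod_topology unit_interval (subtopology (cube n) (cell n N a S))) Y (\<lambda>z. H a S (fst z, unchart N a S (snd z)))"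
      by (rule continuous_map_compose_pair[OF H[OF c(2)] continuous_map_fst_real])
         (use continuous_map_compose[OF continuous_map_snd continuous_map_unchart[OF c(2)]] in \<open>auto simp: o_def\<close>)
    then show "continuous_map (subtopology ?X (?T c)) Y (?h c)" by (simp only: c eq prod.case)
  next
    fix c d x assume cd: "c \<in> cells n N k" "d \<in> cells n N k" and x: "x \<in> topspace ?X \<inter> ?T c \<inter> ?T d"
    obtain a S b S' where c: "c = (a,S)" "d = (b,S')" by (cases c, cases d) auto
    obtain s t where st: "x = (s,t)" by (cases x)
    have s: "0 \<le> s" "s \<le> 1" and t: "t \<in> cell n N a S" "t \<in> cell n N b S'" using x c st by auto
    show "?h c x = ?h d x"
    proof (cases "t \<in> skel n N k")
      case True
      have "H a S (s, unchart N a S t) = f t"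
        using bd[OF _ s unchart_skel_bdry[OF _ t(1) True]] chart_unchart[OF _ N t(1)] cd c by simp
      moreover have "H b S' (s, unchart N b S' t) = f t"
        using bd[OF _ s unchart_skel_bdry[OF _ t(2) True]] chart_unchart[OF _ N t(2)] cd c by simp
      ultimately show ?thesis by (simp add: c st)
    next
      case False
      then have "a = b \<and> S = S'" using cells_Int[OF _ _ t] cd c by simp
      then show ?thesis by (simp add: c)
    qed
  qed blast
  show thesis
  proof (rule that[OF G(1)])
    fix a S s t assume *: "(a,S) \<in> cells n N k" "t \<in> cell n N a S" "(0::real) \<le> s" "s \<le> 1"
    have "t \<in> skel n N (Suc k)" using * cell_subset_skel by blast
    then have "(s,t) \<in> topspace ?X \<inter> ?T (a,S)" using * sk by auto
    from G(2)[OF *(1) this] show "G (s,t) = H a S (s, unchart N a S t)" by simp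
  qed
qed

section \<open>Self-maps of the cube that preserve every grid cell\<close>

definition stepfun :: "(real \<Rightarrow> real) \<Rightarrow> bool" where
  "stepfun \<phi> \<longleftrightarrow> continuous_on UNIV \<phi> \<and> (\<forall>x\<le>0. \<phi> x = 0) \<and> (\<forall>x\<ge>1. \<phi> x = 1) \<and> (\<forall>x. 0 \<le> \<phi> x \<and> \<phi> x \<le> 1)"

text \<open>For a step function \<open>\<phi>\<close> this is a self-map of \<open>[0,N]\<close>
  that fixes the integers and acts on every unit interval as a translate of \<open>\<phi>\<close>.
  As a finite sum it is continuous without any pasting.\<close>

definition stair :: "nat \<Rightarrow> (real \<Rightarrow> real) \<Rightarrow> real \<Rightarrow> real" where
  "stair N \<phi> x = (\<Sum>j<N. \<phi> (x - real j))"

definition gridmap :: "nat \<Rightarrow> nat \<Rightarrow> (nat \<Rightarrow> real \<Rightarrow> real) \<Rightarrow> (nat \<Rightarrow> real) \<Rightarrow> nat \<Rightarrow> real" where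
  "gridmap n N \<Phi> t = (\<lambda>i\<in>{..<n}. stair N (\<Phi> i) (N * t i) / N)"

text \<open>On \<open>[j,j+1]\<close> the summands before \<open>j\<close> have already reached 1
  and those after \<open>j\<close> are still 0.\<close>

lemma stair_eq:
  assumes "stepfun \<phi>" "j < N" "real j \<le> x" "x \<le> real (Suc j)"
  shows "stair N \<phi> x = real j + \<phi> (x - real j)"
proof -
  have *: "(\<Sum>i<M. if i < j then 1 else if i = j then c else 0) = (if M \<le> j then real M else real j + c)" for M c
    by (induction M) (auto simp: not_less le_Suc_eq)
  have "\<phi> (x - real i) = (if i < j then 1 else if i = j then \<phi> (x - real j) else 0)" for i
  proof -
    have "\<phi> (x - real i) = 1" if "i < j" using assms that unfolding stepfun_def by auto
    moreover have "\<phi> (x - real i) = 0" if "j < i" using assms that unfolding stepfun_def by auto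
    ultimately show ?thesis by (cases i j rule: linorder_cases) auto
  qed
  then have "stair N \<phi> x = (\<Sum>i<N. if i < j then 1 else if i = j then \<phi> (x - real j) else 0)"
    unfolding stair_def by (intro sum.cong) auto
  then show ?thesis using * assms(2) by simp
qed

lemma grid_interval:
  assumes "0 < N" "0 \<le> x" "x \<le> real N"
  obtains j where "j < N" "real j \<le> x" "x \<le> real (Suc j)"
proof (cases "x = real N")
  case True then show ?thesis using that[of "N - 1"] assms by auto
next
  case False
  then show ?thesis using that[of "nat \<lfloor>x\<rfloor>"] assms by (auto simp: nat_less_iff floor_less_iff) linarith
qed

lemma stair_bounds:
  assumes "stepfun \<phi>" "0 < N" "0 \<le> x" "x \<le> real N"
  shows "real a \<le> x \<Longrightarrow> real a \<le> stair N \<phi> x" "x \<le> real a \<Longrightarrow> stair N \<phi> x \<le> real a"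
    "0 \<le> stair N \<phi> x" "stair N \<phi> x \<le> real N"
proof -
  obtain j where j: "j < N" "real j \<le> x" "x \<le> real (Suc j)" using grid_interval[OF assms(2-4)] .
  note e = stair_eq[OF assms(1) j]
  have b: "0 \<le> \<phi> (x - real j)" "\<phi> (x - real j) \<le> 1" using assms(1) by (auto simp: stepfun_def)
  show "real a \<le> x \<Longrightarrow> real a \<le> stair N \<phi> x"
  proof -
    assume a: "real a \<le> x"
    then have "a \<le> Suc j" using j by linarith
    show ?thesis
    proof (cases "a = Suc j")
      case True
      then have "\<phi> (x - real j) = 1" using a assms(1) by (auto simp: stepfun_def)
      then show ?thesis using e True by simp
    qed (use e b \<open>a \<le> Suc j\<close> in simp)
  qed
  show "x \<le> real a \<Longrightarrow> stair N \<phi> x \<le> real a"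
  proof -
    assume a: "x \<le> real a"
    then have "j \<le> a" using j by linarith
    show ?thesis
    proof (cases "a = j")
      case True
      then have "\<phi> (x - real j) = 0" using a assms(1) by (auto simp: stepfun_def)
      then show ?thesis using e True by simp
    next
      case False
      then have "real (Suc j) \<le> real a" using \<open>j \<le> a\<close> by simp
      then show ?thesis using e b by simp
    qed
  qed
  show "0 \<le> stair N \<phi> x" using e b by simp
  have "real (Suc j) \<le> real N" using j(1) by simp
  then show "stair N \<phi> x \<le> real N" using e b by simp
qed

lemma gridmap_near:
  assumes "\<And>i. i < n \<Longrightarrow> stepfun (\<Phi> i)" "0 < N" "t \<in> topspace (cube n)"
  shows "near n N t (gridmap n N \<Phi> t)"
proof -
  have u: "0 \<le> N * t i" "N * t i \<le> N" if "i < n" for i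
    using cube_coordD[OF assms(3) that] by (auto intro: mult_left_le)
  note b = stair_bounds[OF assms(1) assms(2) u]
  have "0 \<le> stair N (\<Phi> i) (N * t i) / N \<and> stair N (\<Phi> i) (N * t i) / N \<le> 1" if "i < n" for i
    using b(3,4)[OF that that that] assms(2) by (auto simp: divide_simps)
  then have "gridmap n N \<Phi> t \<in> topspace (cube n)" by (auto simp: topspace_cube gridmap_def)
  then show ?thesis using b(1,2) assms(2) by (simp add: near_def gridmap_def)
qed

lemma continuous_map_gridmap:
  assumes "\<And>i. i < n \<Longrightarrow> stepfun (\<Phi> i)" "0 < N"
  shows "continuous_map (cube n) (cube n) (gridmap n N \<Phi>)"
proof (rule continuous_map_cubeI)
  show "gridmap n N \<Phi> t \<in> topspace (cube n)" if "t \<in> topspace (cube n)" for t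
    using near_topspace[OF gridmap_near[OF assms that]] by simp
  fix i assume i: "i < n"
  have "continuous_on UNIV (\<Phi> i)" using assms(1)[OF i] by (simp add: stepfun_def)
  then have "continuous_on UNIV (\<lambda>x. \<Phi> i (real N * x - real j))" for j
    by (rule continuous_on_compose2) (auto intro!: continuous_intros)
  then have "continuous_on UNIV (\<lambda>x. stair N (\<Phi> i) (real N * x) / N)"
    unfolding stair_def using assms(2) by (intro continuous_intros) auto
  from continuous_map_real_fun[OF continuous_map_cube_coordinate[OF i] this]
  show "continuous_map (cube n) euclideanreal (\<lambda>t. gridmap n N \<Phi> t i)"
    using i by (simp add: gridmap_def)
qed

text \<open>Sends \<open>[0,1/4]\<close> to 0 and \<open>[3/4,1]\<close> to 1 and is affine in
  between, so the grid collapse puts every coordinate within \<open>1/4\<close> of the rescaled grid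
  onto the grid.\<close>

definition collapse_fun :: "real \<Rightarrow> real" where
  "collapse_fun x = max 0 (min 1 (2 * x - 1/2))"

lemma stepfun_collapse: "stepfun collapse_fun"
  unfolding stepfun_def collapse_fun_def by (auto intro!: continuous_intros)

abbreviation collapse_grid :: "nat \<Rightarrow> nat \<Rightarrow> (nat \<Rightarrow> real) \<Rightarrow> nat \<Rightarrow> real" where
  "collapse_grid n N \<equiv> gridmap n N (\<lambda>_. collapse_fun)"

lemma stair_collapse:
  assumes "0 < N" "0 \<le> x" "x \<le> real N" "\<bar>x - real a\<bar> \<le> 1/4"
  shows "stair N collapse_fun x = real a"
proof -
  obtain j where j: "j < N" "real j \<le> x" "x \<le> real (Suc j)" using grid_interval[OF assms(1-3)] .
  note e = stair_eq[OF stepfun_collapse j]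
  have "a = j \<or> a = Suc j" using j assms(4) by linarith
  then show ?thesis
  proof
    assume "a = j"
    then have "2 * (x - real j) - 1/2 \<le> 0" using abs_le_D1[OF assms(4)] \<open>a = j\<close> by (simp add: field_simps)
    then have "collapse_fun (x - real j) = 0" by (simp add: collapse_fun_def)
    then show ?thesis using e \<open>a = j\<close> by simp
  next
    assume "a = Suc j"
    then have "1 \<le> 2 * (x - real j) - 1/2" using abs_le_D2[OF assms(4)] \<open>a = Suc j\<close> by (simp add: field_simps)
    then have "collapse_fun (x - real j) = 1" by (simp add: collapse_fun_def)
    then show ?thesis using e \<open>a = Suc j\<close> by simp
  qed
qed

text \<open>The skeleton has an open neighbourhood that the collapse carries into the skeleton.
  \<open>u\<close> is a Urysohn function for it and will scale the time in the homotopy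
  extension.\<close>

lemma skel_collar:
  assumes N: "0 < N"
  obtains u :: "(nat \<Rightarrow> real) \<Rightarrow> real" where "continuous_map (cube n) euclideanreal u"
    "\<And>t. t \<in> topspace (cube n) \<Longrightarrow> 0 \<le> u t \<and> u t \<le> 1"
    "\<And>t. t \<in> skel n N j \<Longrightarrow> u t = 1"
    "\<And>t. t \<in> topspace (cube n) \<Longrightarrow> u t \<noteq> 0 \<Longrightarrow> collapse_grid n N t \<in> skel n N j"
proof -
  \<comment> \<open>\<open>A\<close> is the set of directions allowed to be far from the grid. If it
    has fewer than \<open>j\<close> elements, the collapsed point lies in \<open>skel n N j\<close>.
    The radius \<open>1/4\<close> is that of \<open>collapse_fun\<close>.\<close>
  let ?W = "\<lambda>A. {t \<in> topspace (cube n). \<forall>i<n. i \<in> A \<or> real N * t i \<in> (\<Union>a::nat. {real a - 1/4<..<real a + 1/4})}"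
  let ?O = "\<Union>A\<in>{A. A \<subseteq> {..<n} \<and> card A < j}. ?W A"
  have "openin (cube n) {t \<in> topspace (cube n). i \<in> A \<or> real N * t i \<in> (\<Union>a::nat. {real a - 1/4<..<real a + 1/4})}" if "i < n" for i A
  proof (cases "i \<in> A")
    case False
    have "openin (cube n) {t \<in> topspace (cube n). real N * t i \<in> (\<Union>a::nat. {real a - 1/4<..<real a + 1/4})}"
      by (rule openin_continuous_map_preimage[of _ euclideanreal])
         (use that in \<open>auto intro!: continuous_intros continuous_map_cube_coordinate\<close>)
    then show ?thesis using False by simp
  qed simp
  then have "openin (cube n) (?W A)" for A by (rule openin_all_less)
  then have op: "openin (cube n) ?O" by blast
  have sub: "skel n N j \<subseteq> ?O"
  proof
    fix t assume t: "t \<in> skel n N j"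
    then have tt: "t \<in> topspace (cube n)" by (simp add: skel_def)
    have "N * t i \<in> (\<Union>a::nat. {real a - 1/4<..<real a + 1/4})" if i: "i < n" "real N * t i \<in> \<int>" for i
    proof -
      obtain a where a: "real N * t i = real a" using cube_Ints[OF tt i] by blast
      show ?thesis by (rule UN_I[of a]) (simp_all add: a)
    qed
    then have "t \<in> ?W {i. i < n \<and> real N * t i \<notin> \<int>}" using tt by blast
    moreover have "{i. i < n \<and> real N * t i \<notin> \<int>} \<in> {A. A \<subseteq> {..<n} \<and> card A < j}"
      using t unfolding skel_def by blast
    ultimately show "t \<in> ?O" by (rule UN_I[rotated])
  qed
  have col: "collapse_grid n N t \<in> skel n N j" if t: "t \<in> ?O" for t
  proof -
    obtain A where A: "A \<subseteq> {..<n}" "card A < j" "t \<in> ?W A" using t by blast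
    have tt: "t \<in> topspace (cube n)" using A by simp
    have "real N * collapse_grid n N t i \<in> \<int>" if i: "i < n" "i \<notin> A" for i
    proof -
      have "real N * t i \<in> (\<Union>a::nat. {real a - 1/4<..<real a + 1/4})" using A i by blast
      then obtain a :: nat where "real N * t i \<in> {real a - 1/4<..<real a + 1/4}" by blast
      then have "N * t i - real a < 1/4" "- (N * t i - real a) < 1/4" by auto
      then have "\<bar>N * t i - real a\<bar> \<le> 1/4" by linarith
      moreover have "0 \<le> N * t i" "N * t i \<le> N" using cube_coordD[OF tt i(1)] by (auto intro: mult_left_le)
      ultimately have "stair N collapse_fun (N * t i) = real a" using stair_collapse[OF N] by blast
      then show ?thesis using i N by (simp add: gridmap_def)
    qed
    then have "{i. i < n \<and> real N * collapse_grid n N t i \<notin> \<int>} \<subseteq> A" by blast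
    then have "card {i. i < n \<and> real N * collapse_grid n N t i \<notin> \<int>} \<le> card A"
      using A(1) by (intro card_mono) (auto intro: finite_subset)
    then show ?thesis using A(2) near_topspace[OF gridmap_near[OF _ N tt]] stepfun_collapse by (auto simp: skel_def)
  qed
  have norm: "normal_space (cube n)"
    using compact_cube Hausdorff_cube compact_Hausdorff_or_regular_imp_normal_space by blast
  obtain f where f: "continuous_map (cube n) (top_of_set {0..(1::real)}) f" "f ` (topspace (cube n) - ?O) \<subseteq> {0}" "f ` skel n N j \<subseteq> {1}"
  proof (rule Urysohn_lemma[where X = "cube n" and S = "topspace (cube n) - ?O" and T = "skel n N j" and a = 0 and b = 1])
    show "normal_space (cube n)" by (rule norm)
    show "closedin (cube n) (skel n N j)" by (rule closedin_skel[OF N])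
    show "closedin (cube n) (topspace (cube n) - ?O)" using op by blast
    show "disjnt (topspace (cube n) - ?O) (skel n N j)" using sub unfolding disjnt_def by blast
  qed (simp, rule that)
  show thesis
  proof (rule that[of f])
    show "continuous_map (cube n) euclideanreal f" using f(1) continuous_map_in_subtopology by blast
    show "0 \<le> f t \<and> f t \<le> 1" if "t \<in> topspace (cube n)" for t
      using continuous_map_in_topspace[OF f(1) that] by simp
    show "f t = 1" if "t \<in> skel n N j" for t using f(3) that by blast
    show "collapse_grid n N t \<in> skel n N j" if "t \<in> topspace (cube n)" "f t \<noteq> 0" for t
    proof (rule col, rule ccontr)
      assume "t \<notin> ?O"
      then have "f t \<in> f ` (topspace (cube n) - ?O)" using that(1) by blast
      then show False using f(2) that(2) by blast
    qed
  qed
qed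

text \<open>First the cube is slid to its collapse, then \<open>G\<close> is run over the collapsed
  point up to time \<open>s * u t\<close>. The slide is why the end map on the skeleton is
  \<open>G\<close> at time 1 after the collapse. The last conclusion records that every value is a
  value of \<open>f\<close> or \<open>G\<close> at a point near \<open>t\<close>, which is how
  cellwise properties are inherited.\<close>

lemma skel_homotopy_extension:
  assumes N: "0 < N" and f: "continuous_map (cube n) Y f"
    and G: "continuous_map (prod_topology unit_interval (subtopology (cube n) (skel n N j))) Y G"
    and G0: "\<And>t. t \<in> skel n N j \<Longrightarrow> G (0,t) = f t"
  obtains F where "continuous_map (prod_topology unit_interval (cube n)) Y F"
    "\<And>t. t \<in> topspace (cube n) \<Longrightarrow> F (0,t) = f t"
    "\<And>t. t \<in> skel n N j \<Longrightarrow> F (1,t) = G (1, collapse_grid n N t)"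
    "\<And>s t. \<lbrakk>0 \<le> s; s \<le> 1; t \<in> topspace (cube n)\<rbrakk> \<Longrightarrow> \<exists>t'. near n N t t' \<and>
       (F (s,t) = f t' \<or> t' \<in> skel n N j \<and> (\<exists>s'. 0 \<le> s' \<and> s' \<le> 1 \<and> F (s,t) = G (s',t')))"
proof -
  let ?Z = "prod_topology unit_interval (cube n)" and ?\<psi> = "collapse_grid n N"
  obtain u :: "(nat \<Rightarrow> real) \<Rightarrow> real" where u: "continuous_map (cube n) euclideanreal u"
    "\<And>t. t \<in> topspace (cube n) \<Longrightarrow> 0 \<le> u t \<and> u t \<le> 1"
    "\<And>t. t \<in> skel n N j \<Longrightarrow> u t = 1"
    "\<And>t. t \<in> topspace (cube n) \<Longrightarrow> u t \<noteq> 0 \<Longrightarrow> ?\<psi> t \<in> skel n N j"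
    using skel_collar[OF N] by blast
  have c\<psi>: "continuous_map (cube n) (cube n) ?\<psi>" by (rule continuous_map_gridmap[OF stepfun_collapse N])
  have n\<psi>: "near n N t (?\<psi> t)" if "t \<in> topspace (cube n)" for t by (rule gridmap_near[OF stepfun_collapse N that])
  let ?C = "{t \<in> topspace (cube n). ?\<psi> t \<in> skel n N j}" and ?D = "{t \<in> topspace (cube n). u t \<in> {0}}"
  have cC: "closedin (cube n) ?C" by (rule closedin_continuous_map_preimage[OF c\<psi> closedin_skel[OF N]])
  have cD: "closedin (cube n) ?D" by (rule closedin_continuous_map_preimage[OF u(1)]) simp
  let ?K = "\<lambda>z. if u (snd z) = 0 then f (?\<psi> (snd z)) else G (fst z * u (snd z), ?\<psi> (snd z))"
  have cf: "continuous_map (cube n) Y (f \<circ> ?\<psi>)" by (rule continuous_map_compose[OF c\<psi> f])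
  have lb: "0 \<le> a * u t \<and> a * u t \<le> 1" if "0 \<le> a" "a \<le> 1" "t \<in> topspace (cube n)" for a t
    using u(2)[OF that(3)] that by (auto intro: mult_le_one)
  \<comment> \<open>The two closed pieces are where the collapse lies in the skeleton and where
    \<open>u\<close> vanishes; on their overlap \<open>G\<close> is at time 0 and equals
    \<open>f\<close>.\<close>
  have K: "continuous_map ?Z Y ?K"
  proof (rule pasting_lemma_closed[of "{True,False}" ?Z "\<lambda>b. {0..1} \<times> (if b then ?C else ?D)" Y
        "\<lambda>b z. if b then G (fst z * u (snd z), ?\<psi> (snd z)) else f (?\<psi> (snd z))"])
    show "closedin ?Z ({0..1} \<times> (if b then ?C else ?D))" for b
      using cC cD by (auto simp: closedin_prod_Times_iff)
    show "continuous_map (subtopology ?Z ({0..1} \<times> (if b then ?C else ?D))) Y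
       (\<lambda>z. if b then G (fst z * u (snd z), ?\<psi> (snd z)) else f (?\<psi> (snd z)))" for b
    proof (cases b)
      case True
      have "continuous_map (subtopology ?Z ({0..1} \<times> ?C)) Y (\<lambda>z. G (fst z * u (snd z), ?\<psi> (snd z)))"
      proof (rule continuous_map_compose_pair[OF G])
        show "continuous_map (subtopology ?Z ({0..1} \<times> ?C)) euclideanreal (\<lambda>z. fst z * u (snd z))"
          using continuous_map_compose[OF continuous_map_snd[of unit_interval] u(1)]
          by (intro continuous_map_from_subtopology continuous_intros continuous_map_fst_real) (simp add: o_def)
        have "continuous_map (subtopology ?Z ({0..1} \<times> ?C)) (cube n) (?\<psi> \<circ> snd)"
          by (rule continuous_map_from_subtopology[OF continuous_map_compose[OF continuous_map_snd c\<psi>]])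
        then show "continuous_map (subtopology ?Z ({0..1} \<times> ?C)) (subtopology (cube n) (skel n N j)) (\<lambda>z. ?\<psi> (snd z))"
          by (auto simp: continuous_map_in_subtopology o_def)
      qed (use lb in auto)
      then show ?thesis using True by simp
    next
      case False
      have "continuous_map ?Z Y (\<lambda>z. f (?\<psi> (snd z)))"
        using continuous_map_compose[OF continuous_map_snd cf] by (simp add: o_def)
      then show ?thesis using False by (simp add: continuous_map_from_subtopology)
    qed
    show "(if a then G (fst x * u (snd x), ?\<psi> (snd x)) else f (?\<psi> (snd x))) = (if b then G (fst x * u (snd x), ?\<psi> (snd x)) else f (?\<psi> (snd x)))"
      if "x \<in> topspace ?Z \<inter> ({0..1} \<times> (if a then ?C else ?D)) \<inter> ({0..1} \<times> (if b then ?C else ?D))" for a b x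
      using that G0 by (auto split: if_splits)
    show "\<exists>b. b \<in> {True,False} \<and> x \<in> {0..1} \<times> (if b then ?C else ?D) \<and>
       ?K x = (if b then G (fst x * u (snd x), ?\<psi> (snd x)) else f (?\<psi> (snd x)))" if "x \<in> topspace ?Z" for x
      by (rule exI[of _ "u (snd x) \<noteq> 0"]) (use that u(4) in auto)
  qed simp
  let ?L = "f \<circ> (\<lambda>(s,t). \<lambda>i\<in>{..<n}. (1 - s) * id t i + s * ?\<psi> t i)"
  have L: "continuous_map ?Z Y ?L"
    by (rule continuous_map_compose[OF continuous_map_straight_line[OF continuous_map_id c\<psi>] f])
  have res: "restrict t {..<n} = t" if "t \<in> topspace (cube n)" for t
    using that by (auto simp: topspace_cube intro: extensional_restrict)
  have \<psi>top: "?\<psi> t \<in> topspace (cube n)" if "t \<in> topspace (cube n)" for t by (rule continuous_map_in_topspace[OF c\<psi> that])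
  have LK: "?L (1,t) = ?K (0,t)" if "t \<in> topspace (cube n)" for t
    using res[OF \<psi>top[OF that]] G0[OF u(4)[OF that]] by auto
  let ?F = "\<lambda>z. if fst z \<le> 1/2 then ?L (2 * fst z, snd z) else ?K (2 * fst z - 1, snd z)"
  show thesis
  proof (rule that[of ?F])
    show "continuous_map ?Z Y ?F" by (rule continuous_map_homotopy_join[OF L K LK])
    show "?F (0,t) = f t" if "t \<in> topspace (cube n)" for t using res[OF that] by simp
    show "?F (1,t) = G (1, ?\<psi> t)" if "t \<in> skel n N j" for t using u(3)[OF that] by simp
    fix s :: real and t assume s: "0 \<le> s" "s \<le> 1" and t: "t \<in> topspace (cube n)"
    show "\<exists>t'. near n N t t' \<and> (?F (s,t) = f t' \<or> t' \<in> skel n N j \<and> (\<exists>s'. 0 \<le> s' \<and> s' \<le> 1 \<and> ?F (s,t) = G (s',t')))"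
    proof (cases "s \<le> 1/2")
      case True
      then have "near n N t (\<lambda>i\<in>{..<n}. (1 - 2 * s) * t i + 2 * s * ?\<psi> t i)"
        using near_convex[OF near_refl[OF t] n\<psi>[OF t], of "2 * s"] s by simp
      then show ?thesis using True by (intro exI conjI) (assumption, simp)
    next
      case False
      show ?thesis
      proof (cases "u t = 0")
        case True
        then show ?thesis using False n\<psi>[OF t] by (intro exI[of _ "?\<psi> t"]) simp
      next
        case ne: False
        have "0 \<le> (2 * s - 1) * u t \<and> (2 * s - 1) * u t \<le> 1" using lb[OF _ _ t, of "2 * s - 1"] s False by auto
        then show ?thesis using False ne n\<psi>[OF t] u(4)[OF t ne] by (intro exI[of _ "?\<psi> t"]) auto
      qed
    qed
  qed
qed

section \<open>Maps that vanish on a skeleton\<close>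

text \<open>Triviality of the homotopy set in dimension \<open>n\<close> at a single base point. For
  \<open>n = 0\<close> the cube is one point with empty boundary, and the condition is that every
  point can be joined to \<open>x\<close>.\<close>

definition null_at :: "'a topology \<Rightarrow> 'a \<Rightarrow> nat \<Rightarrow> bool" where
  "null_at T x n \<longleftrightarrow> (\<forall>f. based_map T x n f \<longrightarrow> rel_htpc T x n f (\<lambda>_. x))"

lemma k_connected_null_at:
  assumes "k_connected k T" "m \<le> k" "x \<in> topspace T" shows "null_at T x m"
  unfolding null_at_def
proof (intro allI impI)
  fix f assume f: "based_map T x m f"
  let ?g = "restrict f (topspace (cube m))"
  have "based_map T x m ?g" by (rule based_map_eq[OF f]) simp
  then have "?g \<in> Omega T x m" by (auto simp: Omega_def based_map_def)
  then have "rel_htpc T x m ?g (\<lambda>_. x)" using assms by (auto simp: k_connected_def)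
  then show "rel_htpc T x m f (\<lambda>_. x)" by (rule rel_htpc_cong) auto
qed

text \<open>A coordinate of \<open>t\<close> equal to 0 or 1 is on the grid. As \<open>t\<close>
  avoids the lower skeleton, its direction must be frozen in the cell, so all points of the cell
  share this coordinate.\<close>

lemma cell_subset_bdry:
  assumes c: "(a,S) \<in> cells n N k" and N: "0 < N" and t: "t \<in> cell n N a S" "t \<in> cube_bdry n" "t \<notin> skel n N k"
  shows "cell n N a S \<subseteq> cube_bdry n"
proof
  fix u assume u: "u \<in> cell n N a S"
  obtain i where i: "i < n" "t i = 0 \<or> t i = 1" using t by (auto simp: cube_bdry_iff)
  have int: "real N * t i \<in> \<int>" using i by auto
  have "i \<notin> S"
  proof
    assume "i \<in> S"
    have "{i. i < n \<and> real N * t i \<notin> \<int>} \<subseteq> S - {i}" using t(1) int by (auto simp: cell_def split: if_splits)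
    then have "card {i. i < n \<and> real N * t i \<notin> \<int>} \<le> card (S - {i})" using cellsD(1)[OF c] by (intro card_mono) auto
    also have "\<dots> < card S" using \<open>i \<in> S\<close> cellsD(1)[OF c] by (intro psubset_card_mono) auto
    finally show False using t(1,3) cellsD(2)[OF c] by (simp add: skel_def cell_def)
  qed
  then have "real N * t i = real N * u i" using t(1) u i(1) by (simp add: cell_def)
  then have "u i = t i" using N by simp
  then show "u \<in> cube_bdry n" using u i by (auto simp: cube_bdry_iff cell_def)
qed

text \<open>Once the map is \<open>x\<close> on \<open>skel n N k\<close>, its restriction to a
  \<open>k\<close>-cell is a based map of the \<open>k\<close>-cube and can be contracted. Where the
  map is already \<open>x\<close> on a cell, the constant homotopy is chosen. This keeps the result
  stationary on the boundary of the cube and on the grid cubes of the last clause, which later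
  preserves the separation of the two maps.\<close>

lemma kill_skeleton:
  assumes N: "0 < N" and k: "k \<le> Suc n" and conn: "\<And>m. m < k \<Longrightarrow> null_at A x m" and \<alpha>: "based_map A x n \<alpha>"
  shows "\<exists>H. continuous_map (prod_topology unit_interval (cube n)) A H \<and>
    (\<forall>t\<in>topspace (cube n). H (0,t) = \<alpha> t) \<and> (\<forall>s\<in>{0..1}. \<forall>t\<in>cube_bdry n. H (s,t) = x) \<and>
    (\<forall>t\<in>skel n N k. H (1,t) = x) \<and>
    (\<forall>a\<in>PiE {..<n} (\<lambda>_. {..<N}). (\<forall>t\<in>gcube n N a. \<alpha> t = x) \<longrightarrow> (\<forall>s\<in>{0..1}. \<forall>t\<in>gcube n N a. H (s,t) = x))"
  using k conn
proof (induction k)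
  case 0
  have "continuous_map (prod_topology unit_interval (cube n)) A (\<lambda>z. \<alpha> (snd z))"
    using \<alpha> by (auto simp: based_map_def o_def intro: continuous_map_compose[OF continuous_map_snd, unfolded o_def])
  then show ?case using \<alpha> by (intro exI[of _ "\<lambda>z. \<alpha> (snd z)"]) (auto simp: based_map_def skel_def)
next
  case (Suc k)
  let ?Z = "prod_topology unit_interval (cube n)"
  have "\<exists>H. continuous_map ?Z A H \<and>
    (\<forall>t\<in>topspace (cube n). H (0,t) = \<alpha> t) \<and> (\<forall>s\<in>{0..1}. \<forall>t\<in>cube_bdry n. H (s,t) = x) \<and>
    (\<forall>t\<in>skel n N k. H (1,t) = x) \<and>
    (\<forall>a\<in>PiE {..<n} (\<lambda>_. {..<N}). (\<forall>t\<in>gcube n N a. \<alpha> t = x) \<longrightarrow> (\<forall>s\<in>{0..1}. \<forall>t\<in>gcube n N a. H (s,t) = x))"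
    by (rule Suc.IH) (use Suc.prems in auto)
  then obtain H1 where H1': "continuous_map ?Z A H1"
    "\<forall>t\<in>topspace (cube n). H1 (0,t) = \<alpha> t" "\<forall>s\<in>{0..1}. \<forall>t\<in>cube_bdry n. H1 (s,t) = x"
    "\<forall>t\<in>skel n N k. H1 (1,t) = x"
    "\<forall>a\<in>PiE {..<n} (\<lambda>_. {..<N}). (\<forall>t\<in>gcube n N a. \<alpha> t = x) \<longrightarrow> (\<forall>s\<in>{0..1}. \<forall>t\<in>gcube n N a. H1 (s,t) = x)"
    by (elim exE conjE) (rule that)
  have H1: "continuous_map ?Z A H1"
    "\<And>t. t \<in> topspace (cube n) \<Longrightarrow> H1 (0,t) = \<alpha> t" "\<And>s t. s \<in> {0..1} \<Longrightarrow> t \<in> cube_bdry n \<Longrightarrow> H1 (s,t) = x"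
    "\<And>t. t \<in> skel n N k \<Longrightarrow> H1 (1,t) = x"
    using H1'(1-4) by blast+
  have H15: "H1 (s,t) = x" if "a \<in> PiE {..<n} (\<lambda>_. {..<N})" "\<forall>t\<in>gcube n N a. \<alpha> t = x" "s \<in> {0..1}" "t \<in> gcube n N a" for a s t
    using bspec[OF H1'(5) that(1)] that(2-4) by blast
  have kn: "k \<le> n" using Suc.prems by simp
  define \<alpha>1 where "\<alpha>1 = (\<lambda>t. H1 (1,t))"
  have c\<alpha>1: "continuous_map (cube n) A \<alpha>1"
    unfolding \<alpha>1_def by (rule continuous_map_compose_pair[OF H1(1)]) auto
  have b\<alpha>1: "based_map A x n \<alpha>1" using c\<alpha>1 H1(3) by (simp add: based_map_def \<alpha>1_def)
  have sk\<alpha>1: "\<alpha>1 t = x" if "t \<in> skel n N k" for t using H1(4)[OF that] by (simp add: \<alpha>1_def)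
  let ?P = "\<lambda>c h. continuous_map (prod_topology unit_interval (cube k)) A h \<and>
      (\<forall>y\<in>topspace (cube k). h (0,y) = \<alpha>1 (chart n N (fst c) (snd c) y)) \<and> (\<forall>y\<in>topspace (cube k). h (1,y) = x) \<and>
      (\<forall>s\<in>{0..1}. \<forall>y\<in>cube_bdry k. h (s,y) = x) \<and>
      ((\<forall>t\<in>cell n N (fst c) (snd c). \<alpha>1 t = x) \<longrightarrow> (\<forall>s\<in>{0..1}. \<forall>y\<in>topspace (cube k). h (s,y) = x))"
  have "\<forall>c\<in>cells n N k. \<exists>h. ?P c h"
  proof
    fix c assume "c \<in> cells n N k"
    then obtain a S where c: "c = (a,S)" "(a,S) \<in> cells n N k" by (cases c) auto
    show "\<exists>h. ?P c h"
    proof (cases "\<forall>t\<in>cell n N a S. \<alpha>1 t = x")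
      case True
      have "x \<in> topspace A"
      proof -
        have "chart n N a S y \<in> topspace (cube n)" if "y \<in> topspace (cube k)" for y
          using chart_in_cell[OF c(2) N that] by (simp add: cell_def)
        moreover have "(\<lambda>i\<in>{..<k}. 0) \<in> topspace (cube k)" by (auto simp: topspace_cube)
        ultimately show ?thesis
          using True chart_in_cell[OF c(2) N] continuous_map_in_topspace[OF c\<alpha>1] by metis
      qed
      then show ?thesis using True chart_in_cell[OF c(2) N] by (intro exI[of _ "\<lambda>_. x"]) (auto simp: c(1))
    next
      case False
      have "continuous_map (cube k) A (\<alpha>1 \<circ> chart n N a S)"
        by (rule continuous_map_compose[OF continuous_map_chart[OF c(2) N] c\<alpha>1])
      then have "based_map A x k (\<alpha>1 \<circ> chart n N a S)"
        using sk\<alpha>1 chart_bdry_skel[OF c(2) N] by (simp add: based_map_def)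
      then have "rel_htpc A x k (\<alpha>1 \<circ> chart n N a S) (\<lambda>_. x)"
        using Suc.prems(2)[of k] by (simp add: null_at_def)
      then obtain h where "continuous_map (prod_topology unit_interval (cube k)) A h"
        "\<forall>t\<in>topspace (cube k). h (0,t) = (\<alpha>1 \<circ> chart n N a S) t" "\<forall>t\<in>topspace (cube k). h (1,t) = x"
        "\<forall>s\<in>{0..1}. \<forall>t\<in>cube_bdry k. h (s,t) = x" unfolding rel_htpc_iff by blast
      then have "?P c h" using False unfolding c(1) by auto
      then show ?thesis by blast
    qed
  qed
  then obtain h where h: "\<And>c. c \<in> cells n N k \<Longrightarrow> ?P c (h c)" by metis
  have hD: "continuous_map (prod_topology unit_interval (cube k)) A (h (a,S))"
    "\<And>y. y \<in> topspace (cube k) \<Longrightarrow> h (a,S) (0,y) = \<alpha>1 (chart n N a S y)"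
    "\<And>y. y \<in> topspace (cube k) \<Longrightarrow> h (a,S) (1,y) = x"
    "\<And>s y. \<lbrakk>0 \<le> s; s \<le> 1; y \<in> cube_bdry k\<rbrakk> \<Longrightarrow> h (a,S) (s,y) = x"
    "\<And>s y. \<lbrakk>\<And>t. t \<in> cell n N a S \<Longrightarrow> \<alpha>1 t = x; 0 \<le> s; s \<le> 1; y \<in> topspace (cube k)\<rbrakk> \<Longrightarrow> h (a,S) (s,y) = x"
    if "(a,S) \<in> cells n N k" for a S
    using h[OF that] by auto
  obtain G where G: "continuous_map (prod_topology unit_interval (subtopology (cube n) (skel n N (Suc k)))) A G"
    and Gc: "\<And>a S s t. \<lbrakk>(a,S) \<in> cells n N k; t \<in> cell n N a S; 0 \<le> s; s \<le> 1\<rbrakk> \<Longrightarrow> G (s,t) = h (a,S) (s, unchart N a S t)"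
  proof (rule cell_homotopies_paste[OF N kn, where Y = A and H = "\<lambda>a S. h (a,S)" and f = \<alpha>1])
    show "continuous_map (prod_topology unit_interval (cube k)) A (h (a,S))" if "(a,S) \<in> cells n N k" for a S
      by (rule hD(1)[OF that])
    show "h (a,S) (s,y) = \<alpha>1 (chart n N a S y)"
      if "(a,S) \<in> cells n N k" "0 \<le> s" "s \<le> 1" "y \<in> cube_bdry k" for a S s y
      using hD(4)[OF that] sk\<alpha>1[OF chart_bdry_skel[OF that(1) N that(4)]] by simp
  qed (rule that)
  have cover: "\<exists>a S. (a,S) \<in> cells n N k \<and> t \<in> cell n N a S" if "t \<in> skel n N (Suc k)" for t
    using that unfolding skel_Suc_eq[OF kn N] by blast
  have G0: "G (0,t) = \<alpha>1 t" if t: "t \<in> skel n N (Suc k)" for t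
  proof -
    obtain a S where c: "(a,S) \<in> cells n N k" "t \<in> cell n N a S" using cover[OF t] by blast
    show ?thesis using Gc[OF c, of 0] hD(2)[OF c(1) unchart_in_cube[OF c]] chart_unchart[OF c(1) N c(2)] by simp
  qed
  obtain F where F: "continuous_map ?Z A F"
    "\<And>t. t \<in> topspace (cube n) \<Longrightarrow> F (0,t) = \<alpha>1 t"
    "\<And>t. t \<in> skel n N (Suc k) \<Longrightarrow> F (1,t) = G (1, collapse_grid n N t)"
    "\<And>s t. \<lbrakk>0 \<le> s; s \<le> 1; t \<in> topspace (cube n)\<rbrakk> \<Longrightarrow> \<exists>t'. near n N t t' \<and>
       (F (s,t) = \<alpha>1 t' \<or> t' \<in> skel n N (Suc k) \<and> (\<exists>s'. 0 \<le> s' \<and> s' \<le> 1 \<and> F (s,t) = G (s',t')))"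
    by (rule skel_homotopy_extension[OF N c\<alpha>1 G], erule G0, rule that)
  have F1: "F (1,t) = x" if t: "t \<in> skel n N (Suc k)" for t
  proof -
    have "t \<in> topspace (cube n)" using t by (simp add: skel_def)
    then have "collapse_grid n N t \<in> skel n N (Suc k)"
      using near_skel[OF gridmap_near[OF stepfun_collapse N] t] by blast
    then obtain a S where c: "(a,S) \<in> cells n N k" "collapse_grid n N t \<in> cell n N a S" using cover by blast
    show ?thesis using F(3)[OF t] Gc[OF c, of 1] hD(3)[OF c(1) unchart_in_cube[OF c]] by simp
  qed
  \<comment> \<open>\<open>F\<close> is evaluated through a near point \<open>t'\<close>, which is
    again in the boundary. If \<open>t'\<close> is in the lower skeleton, the cell homotopy has its
    boundary value; otherwise the whole cell lies in the boundary of the cube, where the homotopy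
    was chosen constant.\<close>
  have Fbd: "F (s,t) = x" if s: "0 \<le> s" "s \<le> 1" and t: "t \<in> cube_bdry n" for s t
  proof -
    obtain t' where t': "near n N t t'"
      "F (s,t) = \<alpha>1 t' \<or> t' \<in> skel n N (Suc k) \<and> (\<exists>s'. 0 \<le> s' \<and> s' \<le> 1 \<and> F (s,t) = G (s',t'))"
      using F(4)[OF s cube_bdry_topspace[OF t]] by blast
    have tb: "t' \<in> cube_bdry n" by (rule near_bdry[OF t'(1) t N])
    show ?thesis using t'(2)
    proof (elim disjE conjE exE)
      assume "F (s,t) = \<alpha>1 t'" then show ?thesis using b\<alpha>1 tb by (simp add: based_map_def)
    next
      fix s' assume *: "t' \<in> skel n N (Suc k)" "0 \<le> s'" "s' \<le> 1" "F (s,t) = G (s',t')"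
      obtain a S where c: "(a,S) \<in> cells n N k" "t' \<in> cell n N a S" using cover[OF *(1)] by blast
      have e: "F (s,t) = h (a,S) (s', unchart N a S t')" using *(4) Gc[OF c *(2,3)] by simp
      show ?thesis
      proof (cases "t' \<in> skel n N k")
        case True
        then show ?thesis using e hD(4)[OF c(1) *(2,3) unchart_skel_bdry[OF c True]] by simp
      next
        case False
        have "\<alpha>1 u = x" if "u \<in> cell n N a S" for u
          using cell_subset_bdry[OF c(1) N c(2) tb False] that b\<alpha>1 by (auto simp: based_map_def)
        then show ?thesis using e hD(5)[OF c(1) _ *(2,3) unchart_in_cube[OF c]] by simp
      qed
    qed
  qed
  have Fg: "F (s,t) = x" if a: "a \<in> PiE {..<n} (\<lambda>_. {..<N})" "\<forall>t\<in>gcube n N a. \<alpha> t = x" and s: "0 \<le> s" "s \<le> 1" and t: "t \<in> gcube n N a" for a s t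
  proof -
    have \<alpha>a: "\<alpha>1 u = x" if "u \<in> gcube n N a" for u using H15[OF a _ that, of 1] by (simp add: \<alpha>1_def)
    have "t \<in> topspace (cube n)" using t by (simp add: cell_def)
    then obtain t' where t': "near n N t t'"
      "F (s,t) = \<alpha>1 t' \<or> t' \<in> skel n N (Suc k) \<and> (\<exists>s'. 0 \<le> s' \<and> s' \<le> 1 \<and> F (s,t) = G (s',t'))"
      using F(4)[OF s] by blast
    have tg: "t' \<in> gcube n N a" by (rule near_cell[OF t'(1) t])
    show ?thesis using t'(2)
    proof (elim disjE conjE exE)
      assume "F (s,t) = \<alpha>1 t'" then show ?thesis using \<alpha>a[OF tg] by simp
    next
      fix s' assume *: "t' \<in> skel n N (Suc k)" "0 \<le> s'" "s' \<le> 1" "F (s,t) = G (s',t')"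
      obtain b S where c: "(b,S) \<in> cells n N k" "t' \<in> cell n N b S" and sub: "cell n N b S \<subseteq> gcube n N a"
        using skel_cell_in_gcube[OF tg *(1) kn a(1)] by blast
      have "\<alpha>1 u = x" if "u \<in> cell n N b S" for u using \<alpha>a sub that by blast
      then show ?thesis using *(4) Gc[OF c *(2,3)] hD(5)[OF c(1) _ *(2,3) unchart_in_cube[OF c]] by simp
    qed
  qed
  let ?H = "\<lambda>z. if fst z \<le> 1/2 then H1 (2 * fst z, snd z) else F (2 * fst z - 1, snd z)"
  have "H1 (1,t) = F (0,t)" if "t \<in> topspace (cube n)" for t using F(2)[OF that] by (simp add: \<alpha>1_def)
  from continuous_map_homotopy_join[OF H1(1) F(1) this]
  have "continuous_map ?Z A ?H" .
  moreover have "?H (0,t) = \<alpha> t" if "t \<in> topspace (cube n)" for t using H1(2)[OF that] by simp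
  moreover have "?H (s,t) = x" if "s \<in> {0..1}" "t \<in> cube_bdry n" for s t
    using H1(3)[of "2 * s" t] Fbd[of "2 * s - 1" t] that by auto
  moreover have "?H (1,t) = x" if "t \<in> skel n N (Suc k)" for t using F1[OF that] by simp
  moreover have "?H (s,t) = x" if "a \<in> PiE {..<n} (\<lambda>_. {..<N})" "\<forall>t\<in>gcube n N a. \<alpha> t = x" "s \<in> {0..1}" "t \<in> gcube n N a" for a s t
    using H15[OF that(1,2) _ that(4), of "2 * s"] Fg[OF that(1,2) _ _ that(4), of "2 * s - 1"] that(3) by auto
  ultimately show ?case by (intro exI[of _ ?H]) blast
qed

lemma openin_cube_box:
  assumes C: "openin (cube n) C" and t: "t \<in> C"
  shows "\<exists>e>0. \<forall>u\<in>topspace (cube n). (\<forall>i<n. \<bar>u i - t i\<bar> < e) \<longrightarrow> u \<in> C"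
proof -
  obtain U where U: "\<And>i. i < n \<Longrightarrow> openin unit_interval (U i)" "t \<in> PiE {..<n} U" "PiE {..<n} U \<subseteq> C"
    using C t unfolding cube_eq_product openin_product_topology_alt by (metis lessThan_iff)
  have "\<exists>e>0. \<forall>r\<in>{0..1}. \<bar>r - t i\<bar> < e \<longrightarrow> r \<in> U i" if i: "i < n" for i
  proof -
    have "t i \<in> U i" using U(2) i by auto
    then show ?thesis using U(1)[OF i] unfolding openin_euclidean_subtopology_iff by (simp add: dist_real_def)
  qed
  then obtain e where e: "\<And>i. i < n \<Longrightarrow> 0 < e i" "\<And>i r. \<lbrakk>i < n; r \<in> {0..1}; \<bar>r - t i\<bar> < e i\<rbrakk> \<Longrightarrow> r \<in> U i" by metis
  let ?e = "Min (insert 1 (e ` {..<n}))"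
  have "0 < ?e" using e(1) by (subst Min_gr_iff) auto
  moreover have "u \<in> C" if u: "u \<in> topspace (cube n)" "\<forall>i<n. \<bar>u i - t i\<bar> < ?e" for u
  proof -
    have "u i \<in> U i" if i: "i < n" for i
    proof (rule e(2)[OF i])
      show "u i \<in> {0..1}" using cube_coordD[OF u(1) i] by simp
      have "?e \<le> e i" using i by (intro Min_le) auto
      then show "\<bar>u i - t i\<bar> < e i" using u(2) i by fastforce
    qed
    then have "u \<in> PiE {..<n} U" using u(1) by (auto simp: topspace_cube PiE_def)
    then show ?thesis using U(3) by blast
  qed
  ultimately show ?thesis by blast
qed

text \<open>A Lebesgue number for the sup metric: finitely many boxes of half the admissible radius
  cover the cube, and a grid cube whose mesh is below half the least radius stays in the full box as
  soon as it meets the half box.\<close>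

lemma Lebesgue_grid:
  assumes op: "\<And>C. C \<in> \<C> \<Longrightarrow> openin (cube n) C" and cov: "topspace (cube n) \<subseteq> \<Union>\<C>"
  shows "\<exists>N>0. \<forall>a. \<exists>C\<in>\<C>. gcube n N a \<subseteq> C"
proof -
  have "\<exists>C e. C \<in> \<C> \<and> e > 0 \<and> (\<forall>u\<in>topspace (cube n). (\<forall>i<n. \<bar>u i - t i\<bar> < e) \<longrightarrow> u \<in> C)" if t: "t \<in> topspace (cube n)" for t
    using openin_cube_box[OF op] cov t by blast
  then obtain C e where Ce: "\<And>t. t \<in> topspace (cube n) \<Longrightarrow> C t \<in> \<C>" "\<And>t. t \<in> topspace (cube n) \<Longrightarrow> 0 < e t"
    "\<And>t u. \<lbrakk>t \<in> topspace (cube n); u \<in> topspace (cube n); \<forall>i<n. \<bar>u i - t i\<bar> < e t\<rbrakk> \<Longrightarrow> u \<in> C t" by metis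
  let ?B = "\<lambda>t. {u \<in> topspace (cube n). \<forall>i<n. u i \<in> {t i - e t / 2 <..< t i + e t / 2}}"
  have oB: "openin (cube n) (?B t)" for t
    by (rule openin_all_less, rule openin_continuous_map_preimage[OF continuous_map_cube_coordinate]) auto
  have tB: "t \<in> ?B t" if "t \<in> topspace (cube n)" for t using Ce(2)[OF that] that by simp
  have "\<forall>U\<in>?B ` topspace (cube n). openin (cube n) U" using oB by (intro ballI) (elim imageE, simp only:)
  moreover have "topspace (cube n) \<subseteq> \<Union>(?B ` topspace (cube n))" by (rule subsetI, rule UN_I, assumption, erule tB)
  ultimately have "\<exists>\<F>. finite \<F> \<and> \<F> \<subseteq> ?B ` topspace (cube n) \<and> topspace (cube n) \<subseteq> \<Union>\<F>"
    using spec[OF compact_cube[of n, unfolded compact_space_alt], of "?B ` topspace (cube n)"] by (simp only: simp_thms)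
  then obtain \<F> where \<F>: "finite \<F>" "\<F> \<subseteq> ?B ` topspace (cube n)" "topspace (cube n) \<subseteq> \<Union>\<F>" by blast
  obtain F where F: "finite F" "F \<subseteq> topspace (cube n)" "\<F> = ?B ` F" using finite_subset_image[OF \<F>(1,2)] by blast
  let ?d = "Min (insert 1 (e ` F))"
  have d: "0 < ?d" using F Ce(2) by (subst Min_gr_iff) auto
  obtain N where N: "2 / ?d < real N" using reals_Archimedean2 by blast
  have N0: "0 < real N" using d N by (meson divide_pos_pos less_trans zero_less_numeral)
  then have Nd: "1 / real N < ?d / 2" using N d by (simp add: field_simps)
  have "\<exists>C\<in>\<C>. gcube n N a \<subseteq> C" for a
  proof (cases "gcube n N a = {}")
    case True
    have "(\<lambda>i\<in>{..<n}. 0) \<in> topspace (cube n)" by (auto simp: topspace_cube)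
    then show ?thesis using Ce(1) True by blast
  next
    case False
    then obtain w where w: "w \<in> gcube n N a" by blast
    then have wt: "w \<in> topspace (cube n)" by (simp add: cell_def)
    then obtain t where t: "t \<in> F" "w \<in> ?B t" using \<F>(3) F(3) by blast
    have tt: "t \<in> topspace (cube n)" using t F by blast
    have "u \<in> C t" if u: "u \<in> gcube n N a" for u
    proof (rule Ce(3)[OF tt])
      show "u \<in> topspace (cube n)" using u by (simp add: cell_def)
      show "\<forall>i<n. \<bar>u i - t i\<bar> < e t"
      proof (intro allI impI)
        fix i assume i: "i < n"
        have "real (a i) \<le> N * u i" "N * u i \<le> real (a i) + 1" "real (a i) \<le> N * w i" "N * w i \<le> real (a i) + 1"
          using u w i by (auto simp: cell_def)
        then have "N * (u i - w i) \<le> 1" "N * (w i - u i) \<le> 1" by (simp_all add: algebra_simps)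
        then have "u i - w i \<le> 1 / N" "w i - u i \<le> 1 / N" using N0 by (simp_all add: field_simps)
        moreover have "?d \<le> e t" using F(1) t(1) by (intro Min_le) auto
        moreover have "w i < t i + e t / 2" "t i - e t / 2 < w i" using t(2) i by auto
        ultimately have "u i - t i < e t" "t i - u i < e t" using Nd by linarith+
        then show "\<bar>u i - t i\<bar> < e t" by (simp add: abs_less_iff)
      qed
    qed
    then show ?thesis using Ce(1)[OF tt] by blast
  qed
  then show ?thesis using N0 by auto
qed

section \<open>Finite CW spaces are well pointed\<close>

lemma topspace_disc: "topspace (disc d) = {x \<in> extensional {..<d}. L2_set x {..<d} \<le> 1}"
  by (auto simp: disc_def euclid_def PiE_def L2_set_def)

lemma disc_bdry_iff: "x \<in> disc_bdry d \<longleftrightarrow> x \<in> topspace (disc d) \<and> L2_set x {..<d} = 1"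
  by (auto simp: disc_bdry_def topspace_disc euclid_def PiE_def L2_set_def)

lemma open_disc_iff: "x \<in> open_disc_set d \<longleftrightarrow> x \<in> topspace (disc d) \<and> L2_set x {..<d} < 1"
  by (auto simp: open_disc_set_def topspace_disc euclid_def PiE_def L2_set_def)

lemma continuous_map_discI:
  assumes "\<And>z. z \<in> topspace Z \<Longrightarrow> f z \<in> topspace (disc d)"
    and "\<And>i. i < d \<Longrightarrow> continuous_map Z euclideanreal (\<lambda>z. f z i)"
  shows "continuous_map Z (disc d) f"
  unfolding disc_def euclid_def continuous_map_in_subtopology continuous_map_componentwise
  using assms by (auto simp: disc_def euclid_def PiE_def)

lemma continuous_map_disc_coordinate: "i < d \<Longrightarrow> continuous_map (disc d) euclideanreal (\<lambda>t. t i)"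
  unfolding disc_def euclid_def
  by (intro continuous_map_from_subtopology) (auto intro: continuous_map_product_projection)

lemma continuous_map_L2_set:
  fixes d :: nat
  assumes "\<And>i. i < d \<Longrightarrow> continuous_map Z euclideanreal (\<lambda>z. f z i)"
  shows "continuous_map Z euclideanreal (\<lambda>z. L2_set (f z) {..<d})"
proof -
  have "continuous_map Z euclideanreal (\<lambda>z. sqrt (\<Sum>i<d. (f z i)\<^sup>2))"
  proof (rule continuous_map_real_fun[where p = sqrt])
    show "continuous_map Z euclideanreal (\<lambda>z. \<Sum>i<d. (f z i)\<^sup>2)"
      by (rule continuous_map_sum) (auto intro: continuous_map_real_pow assms)
    show "continuous_on UNIV sqrt" by (intro continuous_intros)
  qed
  then show ?thesis by (simp add: L2_set_def)
qed

lemma compact_disc: "compact_space (disc d)"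
proof -
  let ?K = "PiE {..<d} (\<lambda>_. {-1..1::real})"
  have K: "compactin (euclid d) ?K"
    by (simp add: euclid_def compactin_PiE)
  have c: "continuous_map (euclid d) euclideanreal (\<lambda>x. \<Sum>i<d. (x i)\<^sup>2)"
    unfolding euclid_def by (intro continuous_map_sum continuous_map_real_pow) (auto intro: continuous_map_product_projection)
  have "closedin (euclid d) {x \<in> topspace (euclid d). (\<Sum>i<d. (x i)\<^sup>2) \<in> {..1}}"
    by (rule closedin_continuous_map_preimage[OF c]) simp
  moreover have "{x \<in> topspace (euclid d). (\<Sum>i<d. (x i)\<^sup>2) \<in> {..1}} \<subseteq> ?K"
  proof
    fix x assume x: "x \<in> {x \<in> topspace (euclid d). (\<Sum>i<d. (x i)\<^sup>2) \<in> {..1}}"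
    have "\<bar>x i\<bar> \<le> 1" if "i < d" for i
    proof -
      have "(x i)\<^sup>2 \<le> (\<Sum>i<d. (x i)\<^sup>2)" using that by (intro member_le_sum) auto
      also have "\<dots> \<le> 1" using x by simp
      finally show ?thesis by (simp add: abs_square_le_1)
    qed
    then show "x \<in> ?K" using x by (auto simp: euclid_def PiE_def Pi_def abs_le_iff)
  qed
  ultimately have "compactin (euclid d) {x \<in> topspace (euclid d). (\<Sum>i<d. (x i)\<^sup>2) \<in> {..1}}"
    using closed_compactin[OF K] by blast
  then have "compact_space (subtopology (euclid d) {x \<in> topspace (euclid d). (\<Sum>i<d. (x i)\<^sup>2) \<in> {..1}})"
    by (simp add: compactin_subspace)
  moreover have "subtopology (euclid d) {x \<in> topspace (euclid d). (\<Sum>i<d. (x i)\<^sup>2) \<in> {..1}} = disc d"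
    unfolding disc_def using subtopology_restrict[of "euclid d" "{x. (\<Sum>i<d. (x i)\<^sup>2) \<le> 1}"]
    by (simp add: Int_def)
  ultimately show ?thesis by simp
qed

text \<open>The pushout property of attaching \<open>K\<close> to \<open>C\<close> along
  \<open>B\<close>, multiplied by the interval. As a map from a compact space to a Hausdorff space,
  \<open>id \<times> \<Phi>\<close> is a quotient map onto its image, so \<open>k\<close> descends;
  the result is pasted with \<open>h\<close> along closed sets.\<close>

lemma homotopy_glue:
  assumes T: "Hausdorff_space T" and C: "closedin T C" and K: "compact_space K"
    and \<Phi>: "continuous_map K T \<Phi>" and B: "\<Phi> ` B \<subseteq> C" "inj_on \<Phi> (topspace K - B)" "\<Phi> ` (topspace K - B) \<inter> C = {}"
    and h: "continuous_map (prod_topology unit_interval (subtopology T C)) T' h"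
    and k: "continuous_map (prod_topology unit_interval K) T' k"
    and hk: "\<And>s x. \<lbrakk>0 \<le> s; s \<le> 1; x \<in> topspace K; x \<in> B\<rbrakk> \<Longrightarrow> k (s,x) = h (s, \<Phi> x)"
  obtains g where "continuous_map (prod_topology unit_interval (subtopology T (C \<union> \<Phi> ` topspace K))) T' g"
    "\<And>s x. \<lbrakk>0 \<le> s; s \<le> 1; x \<in> C\<rbrakk> \<Longrightarrow> g (s,x) = h (s,x)"
    "\<And>s x. \<lbrakk>0 \<le> s; s \<le> 1; x \<in> topspace K\<rbrakk> \<Longrightarrow> g (s, \<Phi> x) = k (s,x)"
proof -
  let ?P = "subtopology T (\<Phi> ` topspace K)" and ?Y = "subtopology T (C \<union> \<Phi> ` topspace K)"
  have CT: "C \<subseteq> topspace T" using C closedin_subset by blast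
  have \<Phi>T: "\<Phi> ` topspace K \<subseteq> topspace T" by (rule continuous_map_image_subset_topspace[OF \<Phi>])
  have cl: "closedin T (\<Phi> ` topspace K)"
    using continuous_imp_closed_map[OF \<Phi> K T] by (simp add: closed_map_def)
  let ?q = "\<lambda>z. (fst z, \<Phi> (snd z))"
  have cI: "compact_space unit_interval" by (simp add: compact_space_subtopology)
  have HI: "Hausdorff_space unit_interval" by (simp add: Hausdorff_space_subtopology)
  have "continuous_map K ?P \<Phi>" using \<Phi> by (simp add: continuous_map_in_subtopology)
  from continuous_map_compose[OF continuous_map_snd this]
  have "continuous_map (prod_topology unit_interval K) (prod_topology unit_interval ?P) ?q"
    by (simp add: continuous_map_pairwise o_def continuous_map_fst)
  then have q: "quotient_map (prod_topology unit_interval K) (prod_topology unit_interval ?P) ?q"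
  proof (rule continuous_imp_quotient_map)
    show "compact_space (prod_topology unit_interval K)" using cI K by (simp add: compact_space_prod_topology)
    show "Hausdorff_space (prod_topology unit_interval ?P)"
      using HI Hausdorff_space_subtopology[OF T] by (simp add: Hausdorff_space_prod_topology)
    show "?q ` topspace (prod_topology unit_interval K) = topspace (prod_topology unit_interval ?P)"
      using \<Phi>T by (force simp: image_iff)
  qed
  have k_eq: "k (s,x) = k (s,x')" if s: "0 \<le> s" "s \<le> 1" and x: "x \<in> topspace K" "x' \<in> topspace K" and e: "\<Phi> x = \<Phi> x'" for s x x'
  proof (cases "x \<in> B")
    case True
    then have "\<Phi> x' \<in> C" using B(1) e by auto
    then have "x' \<in> B" using B(3) x by blast
    then show ?thesis using hk[OF s x(1) True] hk[OF s x(2)] e by simp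
  next
    case False
    then have "\<Phi> x \<notin> C" using B(3) x by blast
    then have "x' \<notin> B" using B(1) e by auto
    then have "x = x'" using inj_onD[OF B(2) e] x False by simp
    then show ?thesis by simp
  qed
  have keq: "k p = k p'" if "p \<in> topspace (prod_topology unit_interval K)" "p' \<in> topspace (prod_topology unit_interval K)" "?q p = ?q p'" for p p'
  proof -
    have "fst p = fst p'" "\<Phi> (snd p) = \<Phi> (snd p')" using that(3) by simp_all
    then have "k (fst p, snd p) = k (fst p', snd p')"
      using k_eq[of "fst p" "snd p" "snd p'"] that(1,2) by (simp add: mem_Times_iff)
    then show ?thesis by simp
  qed
  obtain k' where k': "continuous_map (prod_topology unit_interval ?P) T' k'"
    "\<And>p. p \<in> topspace (prod_topology unit_interval K) \<Longrightarrow> k' (?q p) = k p"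
  proof (rule quotient_map_lift_exists[OF q k])
    fix p p' assume "p \<in> topspace (prod_topology unit_interval K)" "p' \<in> topspace (prod_topology unit_interval K)" "?q p = ?q p'"
    then show "k p = k p'" by (rule keq)
  next
    fix g assume "continuous_map (prod_topology unit_interval ?P) T' g"
      "\<And>x. x \<in> topspace (prod_topology unit_interval K) \<Longrightarrow> g (fst x, \<Phi> (snd x)) = k x"
    then show thesis by (rule that)
  qed
  have k'2: "k' (s, \<Phi> x) = k (s,x)" if "0 \<le> s" "s \<le> 1" "x \<in> topspace K" for s x
    using k'(2)[of "(s,x)"] that by simp
  let ?g = "\<lambda>z. if snd z \<in> C then h z else k' z"
  have "continuous_map (prod_topology unit_interval ?Y) T' ?g"
  proof (rule pasting_lemma_closed[of "{True,False}" _ "\<lambda>b. {0..1} \<times> (if b then C else \<Phi> ` topspace K)" _ "\<lambda>b. if b then h else k'"])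
    show "closedin (prod_topology unit_interval ?Y) ({0..1} \<times> (if b then C else \<Phi> ` topspace K))" for b
      using closedin_subset_topspace[OF C, of "C \<union> \<Phi> ` topspace K"] closedin_subset_topspace[OF cl, of "C \<union> \<Phi> ` topspace K"]
      by (simp add: closedin_prod_Times_iff)
    have "subtopology (prod_topology unit_interval ?Y) ({0..1} \<times> C) = prod_topology unit_interval (subtopology T C)"
      "subtopology (prod_topology unit_interval ?Y) ({0..1} \<times> \<Phi> ` topspace K) = prod_topology unit_interval ?P"
      by (simp_all add: subtopology_Times subtopology_subtopology Int_absorb1)
    then show "continuous_map (subtopology (prod_topology unit_interval ?Y) ({0..1} \<times> (if b then C else \<Phi> ` topspace K))) T' (if b then h else k')" for b
      using h k'(1) by (cases b) simp_all
    have agree: "h (s,y) = k' (s,y)" if "0 \<le> s" "s \<le> 1" "y \<in> C" and y: "y \<in> \<Phi> ` topspace K" for s y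
    proof -
      obtain x where x: "x \<in> topspace K" "y = \<Phi> x" using y by blast
      then have "x \<in> B" using B(3) that by blast
      then show ?thesis using k'2[OF that(1,2) x(1)] hk[OF that(1,2) x(1)] x by simp
    qed
    show "(if a then h else k') z = (if b then h else k') z"
      if "z \<in> topspace (prod_topology unit_interval ?Y) \<inter> ({0..1} \<times> (if a then C else \<Phi> ` topspace K)) \<inter> ({0..1} \<times> (if b then C else \<Phi> ` topspace K))" for a b z
      using that agree[of "fst z" "snd z"] by (cases a; cases b) (auto simp: mem_Times_iff)
    show "\<exists>b. b \<in> {True,False} \<and> z \<in> {0..1} \<times> (if b then C else \<Phi> ` topspace K) \<and> ?g z = (if b then h else k') z"
      if "z \<in> topspace (prod_topology unit_interval ?Y)" for z
      by (rule exI[of _ "snd z \<in> C"]) (use that in \<open>auto simp: mem_Times_iff\<close>)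
  qed simp
  then show thesis
  proof (rule that)
    show "?g (s,x) = h (s,x)" if "x \<in> C" for s x using that by simp
    fix s :: real and x assume s: "0 \<le> s" "s \<le> 1" and x: "x \<in> topspace K"
    show "?g (s, \<Phi> x) = k (s,x)"
    proof (cases "\<Phi> x \<in> C")
      case True
      then have "x \<in> B" using B(3) x by blast
      then show ?thesis using True hk[OF s x] by simp
    next
      case False then show ?thesis using k'2[OF s x] by simp
    qed
  qed
qed

section \<open>Well pointedness under attaching a cell\<close>

definition well_pointed :: "'a topology \<Rightarrow> 'a \<Rightarrow> bool" where
  "well_pointed T z \<longleftrightarrow> (\<exists>h V. continuous_map (prod_topology unit_interval T) T h \<and>
     (\<forall>x\<in>topspace T. h (0,x) = x) \<and> (\<forall>s\<in>{0..1}. h (s,z) = z) \<and> openin T V \<and> z \<in> V \<and> (\<forall>x\<in>V. h (1,x) = z))"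

text \<open>The homotopy may leave \<open>C\<close>: this makes the induction over the cells work.\<close>

definition pointed_in :: "'a topology \<Rightarrow> 'a set \<Rightarrow> 'a \<Rightarrow> bool" where
  "pointed_in T C z \<longleftrightarrow> (\<exists>h V. continuous_map (prod_topology unit_interval (subtopology T C)) T h \<and>
     (\<forall>x\<in>C. h (0,x) = x) \<and> (\<forall>s\<in>{0..1}. h (s,z) = z) \<and> openin (subtopology T C) V \<and> z \<in> V \<and> (\<forall>x\<in>V. h (1,x) = z))"

lemma pointed_inI:
  assumes "continuous_map (prod_topology unit_interval (subtopology T C)) T h"
    "\<And>x. x \<in> C \<Longrightarrow> h (0,x) = x" "\<And>s. s \<in> {0..1} \<Longrightarrow> h (s,z) = z"
    "openin (subtopology T C) V" "z \<in> V" "\<And>x. x \<in> V \<Longrightarrow> h (1,x) = z"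
  shows "pointed_in T C z"
  unfolding pointed_in_def using assms by blast

lemma L2_set_scale: "0 \<le> c \<Longrightarrow> L2_set (\<lambda>i\<in>{..<d}. c * x i) {..<d} = c * L2_set x {..<d}"
  by (simp add: L2_set_right_distrib cong: L2_set_cong_simp)

text \<open>Points of the new cell are pushed outwards along radii; on reaching the attaching sphere
  they follow the homotopy already given on \<open>C\<close>.\<close>

lemma pointed_in_attach_away:
  assumes T: "Hausdorff_space T" and C: "closedin T C"
    and \<Phi>: "continuous_map (disc d) T \<Phi>" and B: "\<Phi> ` disc_bdry d \<subseteq> C" "inj_on \<Phi> (open_disc_set d)" "\<Phi> ` open_disc_set d \<inter> C = {}"
    and z: "z \<in> C" and wp: "pointed_in T C z"
  shows "pointed_in T (C \<union> \<Phi> ` topspace (disc d)) z"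
proof -
  have op: "topspace (disc d) - disc_bdry d = open_disc_set d" by (auto simp: disc_bdry_iff open_disc_iff topspace_disc)
  have CT: "C \<subseteq> topspace T" using C closedin_subset by blast
  have \<Phi>T: "\<Phi> ` topspace (disc d) \<subseteq> topspace T" by (rule continuous_map_image_subset_topspace[OF \<Phi>])
  obtain h V where h: "continuous_map (prod_topology unit_interval (subtopology T C)) T h"
     "\<And>x. x \<in> C \<Longrightarrow> h (0,x) = x" "\<And>s. s \<in> {0..1} \<Longrightarrow> h (s,z) = z" and V: "openin (subtopology T C) V" "z \<in> V" "\<And>x. x \<in> V \<Longrightarrow> h (1,x) = z"
    using wp unfolding pointed_in_def by blast
  \<comment> \<open>Twice as fast as \<open>h\<close>, so it is finished at time \<open>1/2\<close>.
    This lets a whole collar of the sphere, and not just the sphere, complete the homotopy.\<close>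
  define h2 where "h2 = (\<lambda>p. h (min 1 (2 * fst p), snd p))"
  have h2: "continuous_map (prod_topology unit_interval (subtopology T C)) T h2"
    unfolding h2_def by (rule continuous_map_compose_pair[OF h(1) _ _ continuous_map_snd]; (intro continuous_intros continuous_map_fst_real)?) auto
  let ?r = "\<lambda>x. L2_set x {..<d}" and ?Z = "prod_topology unit_interval (disc d)"
  let ?dir = "\<lambda>x. \<lambda>i\<in>{..<d}. x i / ?r x"
  have cr: "continuous_map (disc d) euclideanreal ?r" by (intro continuous_map_L2_set continuous_map_disc_coordinate)
  have crs: "continuous_map ?Z euclideanreal (\<lambda>p. ?r (snd p))"
    using continuous_map_compose[OF continuous_map_snd cr] by (simp add: o_def)
  have cs: "continuous_map ?Z euclideanreal (\<lambda>p. snd p i)" if "i < d" for i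
    using continuous_map_compose[OF continuous_map_snd continuous_map_disc_coordinate[OF that]] by (simp add: o_def)
  have r1: "?r x \<le> 1" if "x \<in> topspace (disc d)" for x using that by (simp add: topspace_disc)
  have dir: "?dir x \<in> disc_bdry d" if "0 < ?r x" for x
  proof -
    have "?dir x = (\<lambda>i\<in>{..<d}. (1 / ?r x) * x i)" by simp
    then have "?r (?dir x) = (1 / ?r x) * ?r x" using L2_set_scale[of "1 / ?r x" x d] by simp
    then show ?thesis using that by (simp add: disc_bdry_iff topspace_disc)
  qed
  have dirC: "\<Phi> (?dir x) \<in> C" if "0 < ?r x" for x using dir[OF that] B(1) by blast
  \<comment> \<open>At time \<open>s\<close> the radius is multiplied by \<open>1 + s\<close>; the
    excess over 1 becomes the time of \<open>h2\<close> at the exit point. On the sphere the excess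
    is \<open>s\<close>, as the gluing requires, and at \<open>s = 1\<close> it is at least
    \<open>1/2\<close> exactly for radius at least \<open>3/4\<close>.\<close>
  let ?k = "\<lambda>p. if ?r (snd p) * (1 + fst p) \<le> 1 then \<Phi> (\<lambda>i\<in>{..<d}. (1 + fst p) * snd p i)
                else h2 (?r (snd p) * (1 + fst p) - 1, \<Phi> (?dir (snd p)))"
  have rpos: "0 < ?r x" if "0 \<le> s" "s \<le> 1" "1 \<le> ?r x * (1 + s)" for s x
    using that by (metis L2_set_nonneg mult_zero_left not_one_le_zero order_le_less)
  have k: "continuous_map ?Z T ?k"
  proof (rule continuous_map_cases_le)
    let ?Z1 = "subtopology ?Z {p \<in> topspace ?Z. ?r (snd p) * (1 + fst p) \<le> 1}"
    have "continuous_map ?Z1 (disc d) (\<lambda>p. \<lambda>i\<in>{..<d}. (1 + fst p) * snd p i)"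
    proof (rule continuous_map_discI)
      fix p assume p: "p \<in> topspace ?Z1"
      then have "L2_set (\<lambda>i\<in>{..<d}. (1 + fst p) * snd p i) {..<d} = (1 + fst p) * ?r (snd p)"
        by (intro L2_set_scale) auto
      then show "(\<lambda>i\<in>{..<d}. (1 + fst p) * snd p i) \<in> topspace (disc d)" using p by (simp add: topspace_disc mult.commute)
    next
      fix i assume i: "i < d"
      have "continuous_map ?Z1 euclideanreal (\<lambda>p. (1 + fst p) * snd p i)"
        by (intro continuous_map_from_subtopology continuous_intros continuous_map_fst_real cs i)
      then show "continuous_map ?Z1 euclideanreal (\<lambda>p. (\<lambda>i\<in>{..<d}. (1 + fst p) * snd p i) i)" using i by simp
    qed
    from continuous_map_compose[OF this \<Phi>]
    show "continuous_map ?Z1 T (\<lambda>p. \<Phi> (\<lambda>i\<in>{..<d}. (1 + fst p) * snd p i))" by (simp add: o_def)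
    let ?Z2 = "subtopology ?Z {p \<in> topspace ?Z. 1 \<le> ?r (snd p) * (1 + fst p)}"
    have pos: "0 < ?r (snd p)" if "p \<in> topspace ?Z2" for p using that rpos[of "fst p" "snd p"] by auto
    have "continuous_map ?Z2 (disc d) (\<lambda>p. ?dir (snd p))"
    proof (rule continuous_map_discI)
      show "?dir (snd p) \<in> topspace (disc d)" if "p \<in> topspace ?Z2" for p
        using dir[OF pos[OF that]] by (simp add: disc_bdry_iff)
      fix i assume i: "i < d"
      have "continuous_map ?Z2 euclideanreal (\<lambda>p. snd p i / ?r (snd p))"
        by (rule continuous_map_real_divide)
           (use pos in \<open>fastforce intro: continuous_map_from_subtopology[OF crs] continuous_map_from_subtopology[OF cs[OF i]]\<close>)+
      then show "continuous_map ?Z2 euclideanreal (\<lambda>p. ?dir (snd p) i)" using i by simp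
    qed
    from continuous_map_compose[OF this \<Phi>]
    have "continuous_map ?Z2 (subtopology T C) (\<lambda>p. \<Phi> (?dir (snd p)))"
      using dirC pos by (auto simp: continuous_map_in_subtopology o_def)
    then show "continuous_map ?Z2 T (\<lambda>p. h2 (?r (snd p) * (1 + fst p) - 1, \<Phi> (?dir (snd p))))"
    proof (rule continuous_map_compose_pair[OF h2, rotated 2])
      show "continuous_map ?Z2 euclideanreal (\<lambda>p. ?r (snd p) * (1 + fst p) - 1)"
        by (intro continuous_map_from_subtopology continuous_intros continuous_map_fst_real crs)
      fix p assume p: "p \<in> topspace ?Z2"
      then have "?r (snd p) * (1 + fst p) \<le> 1 * 2" using r1[of "snd p"] by (intro mult_mono) auto
      then show "0 \<le> ?r (snd p) * (1 + fst p) - 1 \<and> ?r (snd p) * (1 + fst p) - 1 \<le> 1" using p by auto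
    qed
  next
    fix p assume p: "p \<in> topspace ?Z" "?r (snd p) * (1 + fst p) = 1"
    have pos: "0 < ?r (snd p)" using rpos[of "fst p" "snd p"] p by auto
    have "(\<lambda>i\<in>{..<d}. (1 + fst p) * snd p i) = ?dir (snd p)"
      using p(2) pos by (auto simp: fun_eq_iff divide_simps mult_ac)
    then show "\<Phi> (\<lambda>i\<in>{..<d}. (1 + fst p) * snd p i) = h2 (?r (snd p) * (1 + fst p) - 1, \<Phi> (?dir (snd p)))"
      using p(2) h(2)[OF dirC[OF pos]] by (simp add: h2_def)
  qed (auto intro!: continuous_intros continuous_map_fst_real crs)
  have h20: "h2 (0,x) = x" if "x \<in> C" for x using h(2)[OF that] by (simp add: h2_def)
  have dir1: "?dir x = x" if "x \<in> topspace (disc d)" "?r x = 1" for x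
    using that by (auto simp: topspace_disc extensional_def fun_eq_iff)
  have ext: "(\<lambda>i\<in>{..<d}. x i) = x" if "x \<in> topspace (disc d)" for x
    using that by (auto simp: topspace_disc intro: extensional_restrict)
  have hk: "?k (s,x) = h2 (s, \<Phi> x)" if s: "0 \<le> s" "s \<le> 1" and x: "x \<in> topspace (disc d)" "x \<in> disc_bdry d" for s x
  proof -
    have r: "?r x = 1" using x by (simp add: disc_bdry_iff)
    have "\<Phi> x \<in> C" using x B(1) by blast
    then show ?thesis using r s dir1[OF x(1) r] h20 ext[OF x(1)] by (cases "s = 0") auto
  qed
  obtain g where g: "continuous_map (prod_topology unit_interval (subtopology T (C \<union> \<Phi> ` topspace (disc d)))) T g"
    "\<And>s x. \<lbrakk>0 \<le> s; s \<le> 1; x \<in> C\<rbrakk> \<Longrightarrow> g (s,x) = h2 (s,x)"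
    "\<And>s x. \<lbrakk>0 \<le> s; s \<le> 1; x \<in> topspace (disc d)\<rbrakk> \<Longrightarrow> g (s, \<Phi> x) = ?k (s,x)"
    by (rule homotopy_glue[OF T C compact_disc \<Phi> B(1) B(2,3)[folded op] h2 k], rule hk, assumption+, rule that)
  let ?R = "{x \<in> topspace (disc d). ?r x \<in> {3/4..}}"
  have cR: "closedin (disc d) ?R" by (rule closedin_continuous_map_preimage[OF cr]) simp
  have posR: "0 < ?r x" if "x \<in> topspace (subtopology (disc d) ?R)" for x using that by auto
  have "continuous_map (subtopology (disc d) ?R) (disc d) ?dir"
  proof (rule continuous_map_discI)
    show "?dir x \<in> topspace (disc d)" if "x \<in> topspace (subtopology (disc d) ?R)" for x
      using dir[OF posR[OF that]] by (simp add: disc_bdry_iff)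
    fix i assume i: "i < d"
    have "continuous_map (subtopology (disc d) ?R) euclideanreal (\<lambda>x. x i / ?r x)"
      by (rule continuous_map_real_divide)
         (use posR in \<open>fastforce intro: continuous_map_from_subtopology[OF cr] continuous_map_from_subtopology[OF continuous_map_disc_coordinate[OF i]]\<close>)+
    then show "continuous_map (subtopology (disc d) ?R) euclideanreal (\<lambda>x. ?dir x i)" using i by simp
  qed
  from continuous_map_compose[OF this \<Phi>]
  have cdir: "continuous_map (subtopology (disc d) ?R) (subtopology T C) (\<lambda>x. \<Phi> (?dir x))"
    using dirC posR by (auto simp: continuous_map_in_subtopology o_def)
  have VC: "V \<subseteq> C" using openin_subset[OF V(1)] by auto
  have "closedin (subtopology T C) (C - V)"
    using V(1) CT by (metis closedin_def openin_closedin_eq topspace_subtopology_subset)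
  from closedin_continuous_map_preimage[OF cdir this]
  have "closedin (disc d) {x \<in> topspace (subtopology (disc d) ?R). \<Phi> (?dir x) \<in> C - V}"
    using closedin_trans_full[OF _ cR] by blast
  moreover have "closedin (disc d) {x \<in> topspace (disc d). ?r x \<in> {..3/4}}"
    by (rule closedin_continuous_map_preimage[OF cr]) simp
  \<comment> \<open>The disc points to be kept out of the neighbourhood: those whose exit point is
    outside \<open>V\<close> and those whose radius is too small for \<open>h2\<close> to
    finish.\<close>
  ultimately have cQ: "closedin (disc d) ({x \<in> topspace (subtopology (disc d) ?R). \<Phi> (?dir x) \<in> C - V} \<union> {x \<in> topspace (disc d). ?r x \<in> {..3/4}})"
    (is "closedin _ ?Q") by (rule closedin_Un)
  have cPQ: "closedin T (\<Phi> ` ?Q)"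
    using continuous_imp_closed_map[OF \<Phi> compact_disc T] cQ by (simp add: closed_map_def)
  have cCV: "closedin T (C - V)" by (rule closedin_trans_full[OF \<open>closedin (subtopology T C) (C - V)\<close> C])
  let ?Y = "C \<union> \<Phi> ` topspace (disc d)"
  let ?V = "?Y - ((C - V) \<union> \<Phi> ` ?Q)"
  have "openin (subtopology T ?Y) (?Y \<inter> (topspace T - ((C - V) \<union> \<Phi> ` ?Q)))"
    using cPQ cCV by (intro openin_subtopology_Int2) auto
  moreover have "?Y \<inter> (topspace T - ((C - V) \<union> \<Phi> ` ?Q)) = ?V" using CT \<Phi>T by blast
  ultimately have oV: "openin (subtopology T ?Y) ?V" by simp
  \<comment> \<open>Any preimage of \<open>z\<close> lies on the sphere, where the radius is 1 and
    the exit point is the point itself, so its image lies in \<open>V\<close>.\<close>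
  have zV: "z \<in> ?V"
  proof -
    have "z \<noteq> \<Phi> x" if x: "x \<in> ?Q" for x
    proof
      assume e: "z = \<Phi> x"
      have xd: "x \<in> topspace (disc d)" using x by auto
      have "x \<in> disc_bdry d" using e z B(3) op xd by blast
      then have r: "?r x = 1" by (simp add: disc_bdry_iff)
      then have "\<Phi> (?dir x) \<in> V" using dir1[OF xd r] e V by simp
      then show False using x r by auto
    qed
    then show ?thesis using z V by blast
  qed
  have g1: "g (1,p) = z" if p: "p \<in> ?V" for p
  proof (cases "p \<in> C")
    case True
    then have "p \<in> V" using p by blast
    then show ?thesis using g(2)[of 1 p] True V(3) by (simp add: h2_def)
  next
    case False
    then obtain x where x: "x \<in> topspace (disc d)" "p = \<Phi> x" "x \<notin> ?Q" using p by blast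
    then have r: "3/4 < ?r x" by auto
    then have "\<Phi> (?dir x) \<in> V" using x dirC[of x] by auto
    moreover have "min 1 (2 * (?r x * 2 - 1)) = 1" using r by simp
    ultimately show ?thesis using g(3)[of 1 x] x r V(3) by (simp add: h2_def)
  qed
  have g0: "g (0,p) = p" if p: "p \<in> ?Y" for p
  proof (cases "p \<in> C")
    case True then show ?thesis using g(2)[of 0 p] h20 by simp
  next
    case False
    then obtain x where x: "x \<in> topspace (disc d)" "p = \<Phi> x" using p by blast
    then show ?thesis using g(3)[of 0 x] r1[OF x(1)] ext[OF x(1)] by simp
  qed
  have gz: "g (s,z) = z" if "s \<in> {0..1}" for s
    using g(2)[of s z] z h(3)[of "min 1 (2 * s)"] that by (auto simp: h2_def)
  show ?thesis by (rule pointed_inI[OF g(1) _ _ oV zV], erule g0, erule gz, erule g1)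
qed

text \<open>A ball around the preimage \<open>p\<close> of \<open>z\<close> is contracted to
  \<open>p\<close> along segments, with a cutoff that leaves the attaching sphere, and hence
  \<open>C\<close>, fixed.\<close>

lemma pointed_in_attach_at:
  assumes T: "Hausdorff_space T" and C: "closedin T C"
    and \<Phi>: "continuous_map (disc d) T \<Phi>" and B: "\<Phi> ` disc_bdry d \<subseteq> C" "inj_on \<Phi> (open_disc_set d)" "\<Phi> ` open_disc_set d \<inter> C = {}"
    and z: "z \<in> \<Phi> ` open_disc_set d"
  shows "pointed_in T (C \<union> \<Phi> ` topspace (disc d)) z"
proof -
  have op: "topspace (disc d) - disc_bdry d = open_disc_set d" by (auto simp: disc_bdry_iff open_disc_iff topspace_disc)
  have CT: "C \<subseteq> topspace T" using C closedin_subset by blast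
  have \<Phi>T: "\<Phi> ` topspace (disc d) \<subseteq> topspace T" by (rule continuous_map_image_subset_topspace[OF \<Phi>])
  obtain p where p: "p \<in> open_disc_set d" "z = \<Phi> p" using z by blast
  let ?r = "\<lambda>x. L2_set x {..<d}" and ?Z = "prod_topology unit_interval (disc d)"
  have pd: "p \<in> topspace (disc d)" "?r p < 1" using p(1) by (auto simp: open_disc_iff)
  \<comment> \<open>Half the distance of \<open>p\<close> from the sphere. The cutoff
    \<open>m\<close> is 1 up to distance \<open>r\<close> from \<open>p\<close> and 0 from distance
    \<open>2 * r\<close> on, so it vanishes on the sphere.\<close>
  define r where "r = (1 - ?r p) / 2"
  have r: "0 < r" using pd by (simp add: r_def)
  define e where "e = (\<lambda>x. ?r (\<lambda>i. x i - p i))"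
  have ce: "continuous_map (disc d) euclideanreal e"
    unfolding e_def by (intro continuous_map_L2_set continuous_intros continuous_map_disc_coordinate)
  define m where "m = (\<lambda>x. max 0 (min 1 (2 - e x / r)))"
  have cm: "continuous_map (disc d) euclideanreal m"
    unfolding m_def using r by (intro continuous_intros ce) auto
  have m: "0 \<le> m x" "m x \<le> 1" for x by (auto simp: m_def)
  let ?f = "\<lambda>q. \<lambda>i\<in>{..<d}. (1 - fst q * m (snd q)) * snd q i + fst q * m (snd q) * p i"
  have f: "continuous_map ?Z (disc d) ?f"
  proof (rule continuous_map_discI)
    fix q assume q: "q \<in> topspace ?Z"
    let ?c = "fst q * m (snd q)"
    have c: "0 \<le> ?c" "?c \<le> 1" using q m[of "snd q"] by (auto intro: mult_le_one)
    have "?r (?f q) = ?r (\<lambda>i. (1 - ?c) * snd q i + ?c * p i)" by (simp cong: L2_set_cong_simp)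
    also have "\<dots> \<le> ?r (\<lambda>i. (1 - ?c) * snd q i) + ?r (\<lambda>i. ?c * p i)" by (rule L2_set_triangle_ineq)
    also have "\<dots> = (1 - ?c) * ?r (snd q) + ?c * ?r p" using c by (simp add: L2_set_right_distrib)
    also have "\<dots> \<le> 1" using c q pd by (intro convex_bound_le) (auto simp: topspace_disc)
    finally show "?f q \<in> topspace (disc d)" by (simp add: topspace_disc)
  next
    fix i assume i: "i < d"
    have "continuous_map ?Z euclideanreal (\<lambda>q. m (snd q))" "continuous_map ?Z euclideanreal (\<lambda>q. snd q i)"
      using continuous_map_compose[OF continuous_map_snd cm] continuous_map_compose[OF continuous_map_snd continuous_map_disc_coordinate[OF i]]
      by (simp_all add: o_def)
    then have "continuous_map ?Z euclideanreal (\<lambda>q. (1 - fst q * m (snd q)) * snd q i + fst q * m (snd q) * p i)"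
      by (intro continuous_intros continuous_map_fst_real)
    then show "continuous_map ?Z euclideanreal (\<lambda>q. ?f q i)" using i by simp
  qed
  have k: "continuous_map ?Z T (\<Phi> \<circ> ?f)" by (rule continuous_map_compose[OF f \<Phi>])
  have ext: "(\<lambda>i\<in>{..<d}. x i) = x" if "x \<in> topspace (disc d)" for x
    using that by (auto simp: topspace_disc intro: extensional_restrict)
  have hk: "(\<Phi> \<circ> ?f) (s,x) = snd (s, \<Phi> x)" if "0 \<le> s" "s \<le> 1" and x: "x \<in> topspace (disc d)" "x \<in> disc_bdry d" for s x
  proof -
    have "1 = ?r (\<lambda>i. (x i - p i) + p i)" using x by (simp add: disc_bdry_iff)
    also have "\<dots> \<le> e x + ?r p" unfolding e_def by (rule L2_set_triangle_ineq)
    finally have "2 * r \<le> e x" by (simp add: r_def)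
    then have "m x = 0" using r by (simp add: m_def field_simps)
    then show ?thesis using ext[OF x(1)] by simp
  qed
  have h: "continuous_map (prod_topology unit_interval (subtopology T C)) T snd"
    using continuous_map_snd continuous_map_into_fulltopology by blast
  obtain g where g: "continuous_map (prod_topology unit_interval (subtopology T (C \<union> \<Phi> ` topspace (disc d)))) T g"
    "\<And>s x. \<lbrakk>0 \<le> s; s \<le> 1; x \<in> C\<rbrakk> \<Longrightarrow> g (s,x) = snd (s,x)"
    "\<And>s x. \<lbrakk>0 \<le> s; s \<le> 1; x \<in> topspace (disc d)\<rbrakk> \<Longrightarrow> g (s, \<Phi> x) = (\<Phi> \<circ> ?f) (s,x)"
    by (rule homotopy_glue[OF T C compact_disc \<Phi> B(1) B(2,3)[folded op] h k], rule hk, assumption+, rule that)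
  have "closedin (disc d) {x \<in> topspace (disc d). e x \<in> {r..}}"
    by (rule closedin_continuous_map_preimage[OF ce]) simp
  then have cQ: "closedin T (\<Phi> ` {x \<in> topspace (disc d). e x \<in> {r..}})" (is "closedin T (\<Phi> ` ?Q)")
    using continuous_imp_closed_map[OF \<Phi> compact_disc T] by (simp add: closed_map_def)
  let ?Y = "C \<union> \<Phi> ` topspace (disc d)"
  let ?V = "?Y - (C \<union> \<Phi> ` ?Q)"
  have "openin (subtopology T ?Y) (?Y \<inter> (topspace T - (C \<union> \<Phi> ` ?Q)))"
    using cQ C by (intro openin_subtopology_Int2) auto
  moreover have "?Y \<inter> (topspace T - (C \<union> \<Phi> ` ?Q)) = ?V" using CT \<Phi>T by blast
  ultimately have oV: "openin (subtopology T ?Y) ?V" by simp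
  have zC: "z \<notin> C" using z B(3) by blast
  have ep: "e p = 0" by (simp add: e_def L2_set_0')
  have zV: "z \<in> ?V"
  proof -
    have "z \<noteq> \<Phi> x" if x: "x \<in> ?Q" for x
    proof
      assume eq: "z = \<Phi> x"
      then have "x \<notin> disc_bdry d" using B(1) zC by blast
      then have "x \<in> open_disc_set d" using x op by blast
      then have "x = p" using inj_onD[OF B(2), of x p] eq p by simp
      then show False using x ep r by simp
    qed
    then show ?thesis using zC p pd by blast
  qed
  have g1: "g (1,q) = z" if q: "q \<in> ?V" for q
  proof -
    obtain x where x: "x \<in> topspace (disc d)" "q = \<Phi> x" "x \<notin> ?Q" using q by blast
    then have "e x < r" by auto
    then have "m x = 1" using r by (simp add: m_def field_simps)
    then show ?thesis using g(3)[of 1 x] x ext[OF pd(1)] p by simp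
  qed
  have g0: "g (0,q) = q" if q: "q \<in> ?Y" for q
  proof (cases "q \<in> C")
    case True then show ?thesis using g(2)[of 0 q] by simp
  next
    case False
    then obtain x where x: "x \<in> topspace (disc d)" "q = \<Phi> x" using q by blast
    then show ?thesis using g(3)[of 0 x] ext[OF x(1)] by simp
  qed
  have gz: "g (s,z) = z" if "s \<in> {0..1}" for s
  proof -
    have "?f (s,p) = (\<lambda>i\<in>{..<d}. p i)" by (auto simp: fun_eq_iff algebra_simps)
    then show ?thesis using g(3)[of s p] pd that p ext[OF pd(1)] by simp
  qed
  show ?thesis by (rule pointed_inI[OF g(1) _ _ oV zV], erule g0, erule gz, erule g1)
qed

text \<open>Induction over sets of cells that contain all cells of smaller dimension than any of
  their members. Removing a cell of top dimension leaves such a set, and the boundary of the removed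
  cell lies in what remains. One of the two attaching lemmas applies, according to where
  \<open>z\<close> lies.\<close>

theorem CW_well_pointed:
  assumes CW: "compact_CW_space T" and z: "z \<in> topspace T"
  shows "well_pointed T z"
proof -
  have T: "compact_space T" "Hausdorff_space T" using CW by (auto simp: compact_CW_space_def)
  obtain cs :: "'a set set" and dm :: "'a set \<Rightarrow> nat" and \<Phi> where cs0: "finite cs" "{} \<notin> cs" "pairwise disjnt cs" "\<Union>cs = topspace T"
    and cell: "\<forall>e\<in>cs. continuous_map (disc (dm e)) T (\<Phi> e) \<and>
          homeomorphic_map (subtopology (disc (dm e)) (open_disc_set (dm e))) (subtopology T e) (\<Phi> e) \<and>
          \<Phi> e ` disc_bdry (dm e) \<subseteq> \<Union>{e'\<in>cs. dm e' < dm e}"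
    using CW unfolding compact_CW_space_def by (elim conjE exE) (rule that)
  note cs = cs0(1,3,4)
  have main: "closedin T (\<Union>D) \<and> (z \<in> \<Union>D \<longrightarrow> pointed_in T (\<Union>D) z)"
    if "finite D" "D \<subseteq> cs" "\<And>e e'. \<lbrakk>e \<in> D; e' \<in> cs; dm e' < dm e\<rbrakk> \<Longrightarrow> e' \<in> D" for D
    using that
  proof (induction D rule: finite_psubset_induct)
    case (psubset D)
    show ?case
    proof (cases "D = {}")
      case False
      have "finite (dm ` D)" "dm ` D \<noteq> {}" using psubset.hyps False by auto
      note mx = Max_in[OF this] Max_ge[OF this(1)]
      obtain e0 where e0: "e0 \<in> D" "Max (dm ` D) = dm e0" using mx(1) by (rule imageE)
      have e: "e0 \<in> D" "\<And>e'. e' \<in> D \<Longrightarrow> dm e' \<le> dm e0" using e0 mx(2) by auto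
      define e where "e = e0"
      note e = e[folded e_def]
      let ?C = "\<Union>(D - {e})" and ?d = "dm e" and ?P = "\<Phi> e"
      have ec: "e \<in> cs" using e psubset.prems by blast
      have IH: "closedin T ?C \<and> (z \<in> ?C \<longrightarrow> pointed_in T ?C z)"
      proof (rule psubset.IH)
        show "D - {e} \<subset> D" using e by blast
        show "D - {e} \<subseteq> cs" using psubset.prems by blast
        show "e'' \<in> D - {e}" if "e' \<in> D - {e}" "e'' \<in> cs" "dm e'' < dm e'" for e' e''
          using that psubset.prems(2)[of e' e''] e(2)[of e'] by auto
      qed
      have cont: "continuous_map (disc ?d) T ?P" and hom: "homeomorphic_map (subtopology (disc ?d) (open_disc_set ?d)) (subtopology T e) ?P"
        and bd: "?P ` disc_bdry ?d \<subseteq> \<Union>{e'\<in>cs. dm e' < dm e}" using bspec[OF cell ec] by blast+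
      have osub: "open_disc_set ?d \<subseteq> topspace (disc ?d)" by (auto simp: open_disc_iff)
      have inj: "inj_on ?P (open_disc_set ?d)"
        using homeomorphic_imp_injective_map[OF hom] osub by (simp add: Int_absorb1)
      have eT: "e \<subseteq> topspace T" using ec cs(3) by blast
      have im: "?P ` open_disc_set ?d = e"
        using homeomorphic_imp_surjective_map[OF hom] osub eT by (simp add: Int_absorb1)
      have bC: "?P ` disc_bdry ?d \<subseteq> ?C" 
      proof -
        have "{e'\<in>cs. dm e' < dm e} \<subseteq> D - {e}" using psubset.prems(2)[OF e(1)] by auto
        from order_trans[OF bd Union_mono[OF this]] show ?thesis .
      qed
      have dis: "?P ` open_disc_set ?d \<inter> ?C = {}"
        using cs(2) ec psubset.prems(1) unfolding im pairwise_def disjnt_def by blast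
      have split: "topspace (disc ?d) = open_disc_set ?d \<union> disc_bdry ?d"
        by (auto simp: open_disc_iff disc_bdry_iff topspace_disc)
      have UD: "\<Union>D = ?C \<union> ?P ` topspace (disc ?d)"
        using e(1) im bC unfolding split by (auto simp: image_Un)
      have cl: "closedin T (?P ` topspace (disc ?d))"
        using continuous_imp_closed_map[OF cont compact_disc T(2)] by (simp add: closed_map_def)
      have "pointed_in T (?C \<union> ?P ` topspace (disc ?d)) z" if "z \<in> \<Union>D"
      proof (cases "z \<in> ?C")
        case True
        then show ?thesis using pointed_in_attach_away[OF T(2) _ cont bC inj dis True] IH by blast
      next
        case False
        then have "z \<in> e" using that by blast
        then show ?thesis using pointed_in_attach_at[OF T(2) _ cont bC inj dis] IH im by blast
      qed
      then show ?thesis using IH cl UD by (metis closedin_Un)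
    qed simp
  qed
  have "pointed_in T (topspace T) z" using main[OF cs(1)] cs(3) z by auto
  then show ?thesis by (simp add: pointed_in_def well_pointed_def)
qed

section \<open>Wedges of two spaces\<close>

text \<open>As a subspace of the product, so that homotopies into the wedge are pairs of homotopies;
  the one joint condition is that at every moment one member of the pair is at its base
  point.\<close>

definition wedge2 :: "'a topology \<Rightarrow> 'a \<Rightarrow> 'b topology \<Rightarrow> 'b \<Rightarrow> ('a \<times> 'b) topology" where
  "wedge2 A a B b = subtopology (prod_topology A B) {(x,y). x = a \<or> y = b}"

lemma rel_htpc_wedge2I:
  assumes "continuous_map (prod_topology unit_interval (cube n)) A F" "continuous_map (prod_topology unit_interval (cube n)) B G"
    "\<And>t. t \<in> topspace (cube n) \<Longrightarrow> F (0,t) = \<alpha> t" "\<And>t. t \<in> topspace (cube n) \<Longrightarrow> F (1,t) = \<alpha>' t"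
    "\<And>t. t \<in> topspace (cube n) \<Longrightarrow> G (0,t) = \<beta> t" "\<And>t. t \<in> topspace (cube n) \<Longrightarrow> G (1,t) = \<beta>' t"
    "\<And>s t. \<lbrakk>0 \<le> s; s \<le> 1; t \<in> cube_bdry n\<rbrakk> \<Longrightarrow> F (s,t) = a" "\<And>s t. \<lbrakk>0 \<le> s; s \<le> 1; t \<in> cube_bdry n\<rbrakk> \<Longrightarrow> G (s,t) = b"
    "\<And>s t. \<lbrakk>0 \<le> s; s \<le> 1; t \<in> topspace (cube n)\<rbrakk> \<Longrightarrow> F (s,t) = a \<or> G (s,t) = b"
  shows "rel_htpc (wedge2 A a B b) (a,b) n (\<lambda>t. (\<alpha> t, \<beta> t)) (\<lambda>t. (\<alpha>' t, \<beta>' t))"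
proof (rule rel_htpcI)
  show "continuous_map (prod_topology unit_interval (cube n)) (wedge2 A a B b) (\<lambda>z. (F z, G z))"
  proof -
    have "F z = a \<or> G z = b" if "z \<in> topspace (prod_topology unit_interval (cube n))" for z
      using assms(9)[of "fst z" "snd z"] that by (simp add: mem_Times_iff)
    then show ?thesis
      using assms(1,2) by (simp add: wedge2_def continuous_map_in_subtopology continuous_map_pairwise o_def image_subset_iff Pi_iff)
  qed
qed (use assms in auto)

lemma rel_htpc_wedge2_swap:
  assumes "rel_htpc (wedge2 A a B b) (a,b) n (\<lambda>t. (\<alpha> t, \<beta> t)) (\<lambda>t. (\<alpha>' t, \<beta>' t))"
  shows "rel_htpc (wedge2 B b A a) (b,a) n (\<lambda>t. (\<beta> t, \<alpha> t)) (\<lambda>t. (\<beta>' t, \<alpha>' t))"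
proof -
  have c: "continuous_map (wedge2 A a B b) (prod_topology B A) (\<lambda>p. (snd p, fst p))"
    unfolding wedge2_def
    by (intro continuous_map_from_subtopology) (simp add: continuous_map_pairwise o_def continuous_map_fst continuous_map_snd)
  have "continuous_map (wedge2 A a B b) (wedge2 B b A a) (\<lambda>p. (snd p, fst p))"
    unfolding wedge2_def[of B] continuous_map_in_subtopology using c by (auto simp: wedge2_def)
  from rel_htpc_compose_left[OF assms this, of "(b,a)"] show ?thesis by (simp add: o_def)
qed

definition wedge_pair :: "'a topology \<Rightarrow> 'a \<Rightarrow> 'b topology \<Rightarrow> 'b \<Rightarrow> nat \<Rightarrow> ((nat \<Rightarrow> real) \<Rightarrow> 'a) \<Rightarrow> ((nat \<Rightarrow> real) \<Rightarrow> 'b) \<Rightarrow> bool" where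
  "wedge_pair A a B b n \<alpha> \<beta> \<longleftrightarrow> based_map A a n \<alpha> \<and> based_map B b n \<beta> \<and> (\<forall>t\<in>topspace (cube n). \<alpha> t = a \<or> \<beta> t = b)"

text \<open>Stronger than the pointwise alternative: on a whole closed grid cube the same one of the
  two maps is constant. Hence the two maps may be deformed independently of each other by
  cell-preserving maps.\<close>

definition grid_separated :: "nat \<Rightarrow> nat \<Rightarrow> 'a \<Rightarrow> 'b \<Rightarrow> ((nat \<Rightarrow> real) \<Rightarrow> 'a) \<Rightarrow> ((nat \<Rightarrow> real) \<Rightarrow> 'b) \<Rightarrow> bool" where
  "grid_separated n N a b \<alpha> \<beta> \<longleftrightarrow> (\<forall>c\<in>PiE {..<n} (\<lambda>_. {..<N}). (\<forall>t\<in>gcube n N c. \<alpha> t = a) \<or> (\<forall>t\<in>gcube n N c. \<beta> t = b))"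

lemma grid_separated_swap: "grid_separated n N a b \<alpha> \<beta> \<Longrightarrow> grid_separated n N b a \<beta> \<alpha>"
  by (auto simp: grid_separated_def)

lemma grid_separatedD:
  assumes "grid_separated n N a b \<alpha> \<beta>" "0 < N" "near n N t u" "near n N t v" "t \<in> topspace (cube n)"
  shows "\<alpha> u = a \<or> \<beta> v = b"
proof -
  obtain c where c: "c \<in> PiE {..<n} (\<lambda>_. {..<N})" "t \<in> gcube n N c" using exists_gcube[OF assms(5,2)] by blast
  show ?thesis using assms(1) c near_cell[OF assms(3) c(2)] near_cell[OF assms(4) c(2)] by (auto simp: grid_separated_def)
qed

lemma continuous_map_snd_compose:
  "continuous_map X Y f \<Longrightarrow> continuous_map (prod_topology Z X) Y (\<lambda>z. f (snd z))"
  using continuous_map_compose[OF continuous_map_snd] by (fastforce simp: o_def)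

text \<open>The cube is covered by the set where \<open>\<alpha>\<close> differs from
  \<open>a\<close>, so that \<open>\<beta>\<close> is \<open>b\<close>, and the set where
  \<open>\<alpha>\<close> lies in the neighbourhood that well pointedness collapses to
  \<open>a\<close>. A Lebesgue grid for this cover separates the two maps once
  \<open>\<alpha>\<close> has been collapsed.\<close>

lemma wedge_pair_separate:
  assumes wp: "well_pointed A a" and A: "Hausdorff_space A" and p: "wedge_pair A a B b n \<alpha> \<beta>"
  obtains \<alpha>' N where "0 < N" "based_map A a n \<alpha>'" "rel_htpc A a n \<alpha> \<alpha>'"
    "rel_htpc (wedge2 A a B b) (a,b) n (\<lambda>t. (\<alpha> t, \<beta> t)) (\<lambda>t. (\<alpha>' t, \<beta> t))" "grid_separated n N a b \<alpha>' \<beta>"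
proof -
  obtain h V where h: "continuous_map (prod_topology unit_interval A) A h" "\<And>x. x \<in> topspace A \<Longrightarrow> h (0,x) = x"
    "\<And>s. s \<in> {0..1} \<Longrightarrow> h (s,a) = a" and V: "openin A V" "a \<in> V" "\<And>x. x \<in> V \<Longrightarrow> h (1,x) = a"
    using wp unfolding well_pointed_def by blast
  have \<alpha>: "continuous_map (cube n) A \<alpha>" "\<And>t. t \<in> cube_bdry n \<Longrightarrow> \<alpha> t = a"
    and \<beta>: "continuous_map (cube n) B \<beta>" "\<And>t. t \<in> cube_bdry n \<Longrightarrow> \<beta> t = b"
    and d: "\<And>t. t \<in> topspace (cube n) \<Longrightarrow> \<alpha> t = a \<or> \<beta> t = b"
    using p by (auto simp: wedge_pair_def based_map_def)
  let ?F = "\<lambda>z. h (fst z, \<alpha> (snd z))" and ?\<alpha> = "\<lambda>t. h (1, \<alpha> t)"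
  have F: "continuous_map (prod_topology unit_interval (cube n)) A ?F"
    by (rule continuous_map_compose_pair[OF h(1) continuous_map_fst_real _ continuous_map_snd_compose[OF \<alpha>(1)]]) auto
  have \<alpha>T: "\<alpha> t \<in> topspace A" if "t \<in> topspace (cube n)" for t by (rule continuous_map_in_topspace[OF \<alpha>(1) that])
  have r: "rel_htpc A a n \<alpha> ?\<alpha>" by (rule rel_htpcI[OF F]) (use h(2) \<alpha>T \<alpha>(2) h(3) in auto)
  have w: "rel_htpc (wedge2 A a B b) (a,b) n (\<lambda>t. (\<alpha> t, \<beta> t)) (\<lambda>t. (?\<alpha> t, \<beta> t))"
  proof (rule rel_htpc_wedge2I[OF F continuous_map_snd_compose[OF \<beta>(1)]])
    show "?F (s,t) = a \<or> \<beta> (snd (s,t)) = b" if "0 \<le> s" "s \<le> 1" "t \<in> topspace (cube n)" for s t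
      using d[OF that(3)] h(3)[of s] that by auto
  qed (use h(2) \<alpha>T \<alpha>(2) \<beta>(2) h(3) in auto)
  let ?U = "{t \<in> topspace (cube n). \<alpha> t \<in> topspace A - {a}}" and ?W = "{t \<in> topspace (cube n). \<alpha> t \<in> V}"
  have aT: "a \<in> topspace A" using V openin_subset by blast
  have "openin A (topspace A - {a})"
    using A aT by (simp add: openin_diff closedin_Hausdorff_sing_eq)
  then have oU: "openin (cube n) ?U" by (rule openin_continuous_map_preimage[OF \<alpha>(1)])
  have oW: "openin (cube n) ?W" by (rule openin_continuous_map_preimage[OF \<alpha>(1) V(1)])
  have cov: "topspace (cube n) \<subseteq> \<Union>{?U,?W}" using \<alpha>T V(2) by auto
  obtain N where N: "0 < N" "\<And>c. \<exists>C\<in>{?U,?W}. gcube n N c \<subseteq> C"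
    using Lebesgue_grid[OF _ cov] oU oW by blast
  have "grid_separated n N a b ?\<alpha> \<beta>"
    unfolding grid_separated_def
  proof
    fix c
    consider "gcube n N c \<subseteq> ?U" | "gcube n N c \<subseteq> ?W" using N(2)[of c] by blast
    then show "(\<forall>t\<in>gcube n N c. ?\<alpha> t = a) \<or> (\<forall>t\<in>gcube n N c. \<beta> t = b)"
    proof cases
      case 1
      have "\<beta> t = b" if "t \<in> gcube n N c" for t using 1 that d[of t] by auto
      then show ?thesis by blast
    next
      case 2
      have "?\<alpha> t = a" if "t \<in> gcube n N c" for t using 2 that V(3) by auto
      then show ?thesis by blast
    qed
  qed
  then show thesis by (rule that[OF N(1) rel_htpc_imp_based_map(2)[OF r] r w])
qed

text \<open>Fixing \<open>\<beta>\<close> is compatible with the wedge: on a grid cube where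
  \<open>\<alpha>\<close> is \<open>a\<close> the homotopy of \<open>kill_skeleton\<close> is
  stationary, and on the other grid cubes \<open>\<beta>\<close> is \<open>b\<close>.\<close>

lemma wedge_pair_kill:
  assumes sep: "grid_separated n N a b \<alpha> \<beta>" and N: "0 < N" and k: "k \<le> Suc n"
    and conn: "\<And>m. m < k \<Longrightarrow> null_at A a m" and \<alpha>: "based_map A a n \<alpha>" and \<beta>: "based_map B b n \<beta>"
  obtains \<alpha>' where "based_map A a n \<alpha>'" "rel_htpc A a n \<alpha> \<alpha>'"
    "rel_htpc (wedge2 A a B b) (a,b) n (\<lambda>t. (\<alpha> t, \<beta> t)) (\<lambda>t. (\<alpha>' t, \<beta> t))" "grid_separated n N a b \<alpha>' \<beta>"
    "\<And>t. t \<in> skel n N k \<Longrightarrow> \<alpha>' t = a"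
proof -
  obtain H where H: "continuous_map (prod_topology unit_interval (cube n)) A H"
    "\<forall>t\<in>topspace (cube n). H (0,t) = \<alpha> t" "\<forall>s\<in>{0..1}. \<forall>t\<in>cube_bdry n. H (s,t) = a"
    "\<forall>t\<in>skel n N k. H (1,t) = a"
    "\<forall>c\<in>PiE {..<n} (\<lambda>_. {..<N}). (\<forall>t\<in>gcube n N c. \<alpha> t = a) \<longrightarrow> (\<forall>s\<in>{0..1}. \<forall>t\<in>gcube n N c. H (s,t) = a)"
    by (rule exE[OF kill_skeleton[OF N k _ \<alpha>]], erule conn, elim conjE, rule that)
  have r: "rel_htpc A a n \<alpha> (\<lambda>t. H (1,t))" by (rule rel_htpcI[OF H(1)]) (use H in auto)
  have c\<beta>: "continuous_map (cube n) B \<beta>" "\<And>t. t \<in> cube_bdry n \<Longrightarrow> \<beta> t = b" using \<beta> by (auto simp: based_map_def)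
  have w: "rel_htpc (wedge2 A a B b) (a,b) n (\<lambda>t. (\<alpha> t, \<beta> t)) (\<lambda>t. (H (1,t), \<beta> t))"
  proof (rule rel_htpc_wedge2I[OF H(1) continuous_map_snd_compose[OF c\<beta>(1)]])
    fix s :: real and t assume s: "0 \<le> s" "s \<le> 1" and t: "t \<in> topspace (cube n)"
    obtain c where c: "c \<in> PiE {..<n} (\<lambda>_. {..<N})" "t \<in> gcube n N c" using exists_gcube[OF t N] by blast
    show "H (s,t) = a \<or> \<beta> (snd (s,t)) = b"
    proof (cases "\<forall>t\<in>gcube n N c. \<alpha> t = a")
      case True then show ?thesis using H(5) c s by auto
    next
      case False then show ?thesis using sep c by (auto simp: grid_separated_def)
    qed
  qed (use H c\<beta> in auto)
  have "grid_separated n N a b (\<lambda>t. H (1,t)) \<beta>"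
    unfolding grid_separated_def
  proof
    fix c assume c: "c \<in> PiE {..<n} (\<lambda>_. {..<N})"
    have "(\<forall>t\<in>gcube n N c. \<alpha> t = a) \<or> (\<forall>t\<in>gcube n N c. \<beta> t = b)" using sep c by (auto simp: grid_separated_def)
    moreover have "\<forall>t\<in>gcube n N c. H (1,t) = a" if "\<forall>t\<in>gcube n N c. \<alpha> t = a"
      using bspec[OF H(5) c] that by simp
    ultimately show "(\<forall>t\<in>gcube n N c. H (1,t) = a) \<or> (\<forall>t\<in>gcube n N c. \<beta> t = b)" by blast
  qed
  then show thesis by (rule that[OF rel_htpc_imp_based_map(2)[OF r] r w]) (use H(4) in blast)
qed

text \<open>Stretches the upper or the lower half of each grid interval of coordinate 1 over the whole interval.\<close>

definition squeeze :: "bool \<Rightarrow> nat \<Rightarrow> real \<Rightarrow> real" where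
  "squeeze up i x = max 0 (min 1 (if i = 1 then (if up then 2 * x - 1 else 2 * x) else x))"

lemma stepfun_squeeze: "stepfun (squeeze up i)"
proof -
  have "continuous_on UNIV (\<lambda>x::real. max 0 (min 1 (2 * x - 1)))" "continuous_on UNIV (\<lambda>x::real. max 0 (min 1 (2 * x)))"
    "continuous_on UNIV (\<lambda>x::real. max 0 (min 1 x))"
    by (intro continuous_intros)+
  then have "continuous_on UNIV (squeeze up i)" unfolding squeeze_def[abs_def] by (cases "i = 1"; cases up) simp_all
  then show ?thesis by (auto simp: stepfun_def squeeze_def)
qed

text \<open>At any value of coordinate 1 one of the two squeezes brings this coordinate onto the
  grid. As \<open>u\<close> and \<open>t\<close> share coordinate 1 only, the conclusion survives
  moving the two maps separately in other directions; \<open>1 < n\<close> makes coordinate 1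
  different from the last available direction 0.\<close>

lemma squeeze_skel:
  assumes N: "0 < N" and n: "1 < n" and t: "t \<in> topspace (cube n)" and u: "u \<in> topspace (cube n)" "u 1 = t 1"
  shows "gridmap n N (squeeze False) t \<in> skel n N n \<or> gridmap n N (squeeze True) u \<in> skel n N n"
proof -
  have c: "0 \<le> N * t 1" "N * t 1 \<le> N" using cube_coordD[OF t n] by (auto intro: mult_left_le)
  obtain j where j: "j < N" "real j \<le> N * t 1" "N * t 1 \<le> real (Suc j)" using grid_interval[OF N c] .
  note e = stair_eq[OF stepfun_squeeze j]
  have sk: "v \<in> skel n N n" if "v \<in> topspace (cube n)" "real N * v 1 \<in> \<int>" for v
  proof -
    have "{i. i < n \<and> real N * v i \<notin> \<int>} \<subset> {..<n}" using that n by auto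
    then have "card {i. i < n \<and> real N * v i \<notin> \<int>} < card {..<n}" by (intro psubset_card_mono) auto
    then show ?thesis using that by (simp add: skel_def)
  qed
  have in_cube: "gridmap n N (squeeze up) v \<in> topspace (cube n)" if "v \<in> topspace (cube n)" for up v
    by (rule near_topspace[OF gridmap_near[OF stepfun_squeeze N that]])
  show ?thesis
  proof (cases "N * t 1 \<le> real j + 1/2")
    case True
    then have "squeeze True 1 (N * t 1 - real j) = 0" by (simp add: squeeze_def)
    then have "real N * gridmap n N (squeeze True) u 1 = real j" using e[of True 1] u(2) n N by (simp add: gridmap_def)
    then show ?thesis using sk[OF in_cube[OF u(1)]] by simp
  next
    case False
    then have "squeeze False 1 (N * t 1 - real j) = 1" by (simp add: squeeze_def)
    then have "real N * gridmap n N (squeeze False) t 1 = real (Suc j)" using e[of False 1] n N by (simp add: gridmap_def)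
    then show ?thesis using sk[OF in_cube[OF t]] by (metis Ints_of_nat)
  qed
qed

text \<open>Once \<open>\<alpha>\<close> and \<open>\<beta>\<close> are supported over disjoint sets of values of coordinate 1, they can be slid
  independently in direction 0 until \<open>\<alpha>\<close> lives in the left and \<open>\<beta>\<close> in the right half of the cube.\<close>

lemma wedge_pair_slide:
  assumes sep: "grid_separated n N a b \<alpha> \<beta>" and N: "0 < N" and n: "1 < n"
    and \<alpha>: "based_map A a n \<alpha>" and \<beta>: "based_map B b n \<beta>"
    and sk: "\<And>t. t \<in> skel n N n \<Longrightarrow> \<alpha> t = a" "\<And>t. t \<in> skel n N n \<Longrightarrow> \<beta> t = b"
    and null: "rel_htpc A a n \<alpha> (\<lambda>_. a)"
  shows "\<exists>\<beta>'. rel_htpc (wedge2 A a B b) (a,b) n (\<lambda>t. (\<alpha> t, \<beta> t)) (\<lambda>t. (a, \<beta>' t))"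
proof -
  let ?Z = "prod_topology unit_interval (cube n)"
  have c\<alpha>: "continuous_map (cube n) A \<alpha>" "\<And>t. t \<in> cube_bdry n \<Longrightarrow> \<alpha> t = a" using \<alpha> by (auto simp: based_map_def)
  have c\<beta>: "continuous_map (cube n) B \<beta>" "\<And>t. t \<in> cube_bdry n \<Longrightarrow> \<beta> t = b" using \<beta> by (auto simp: based_map_def)
  let ?\<sigma> = "\<lambda>up. gridmap n N (squeeze up)"
  have c\<sigma>: "continuous_map (cube n) (cube n) (?\<sigma> up)" for up by (rule continuous_map_gridmap[OF stepfun_squeeze N])
  let ?L = "\<lambda>up. (\<lambda>(s,t). \<lambda>i\<in>{..<n}. (1 - s) * id t i + s * ?\<sigma> up t i)"
  have cL: "continuous_map ?Z (cube n) (?L up)" for up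
    by (rule continuous_map_straight_line[OF continuous_map_id c\<sigma>])
  have nL: "near n N t (?L up (s,t))" if "0 \<le> s" "s \<le> 1" "t \<in> topspace (cube n)" for s t up
    using near_convex[OF near_refl[OF that(3)] gridmap_near[OF stepfun_squeeze N that(3)] that(1,2)] by simp
  have res: "restrict t {..<n} = t" if "t \<in> topspace (cube n)" for t
    using that by (auto simp: topspace_cube PiE_def intro: extensional_restrict)
  have \<sigma>T: "?\<sigma> up t \<in> topspace (cube n)" if "t \<in> topspace (cube n)" for t up by (rule continuous_map_in_topspace[OF c\<sigma> that])
  have L01: "?L up (0,t) = t" "?L up (1,t) = ?\<sigma> up t" if "t \<in> topspace (cube n)" for t up
    using res[OF that] res[OF \<sigma>T[OF that]] by simp_all
  let ?\<alpha> = "\<lambda>t. \<alpha> (?\<sigma> False t)" and ?\<beta> = "\<lambda>t. \<beta> (?\<sigma> True t)"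
  have FA: "continuous_map ?Z A (\<lambda>z. \<alpha> (?L False z))" and FB: "continuous_map ?Z B (\<lambda>z. \<beta> (?L True z))"
    using continuous_map_compose[OF cL c\<alpha>(1)] continuous_map_compose[OF cL c\<beta>(1)] by (simp_all only: o_def)
  have bdA: "\<alpha> (?L False (s,t)) = a" and bdB: "\<beta> (?L True (s,t)) = b" if "0 \<le> s" "s \<le> 1" "t \<in> cube_bdry n" for s t
    using c\<alpha>(2) c\<beta>(2) near_bdry[OF nL[OF that(1,2) cube_bdry_topspace[OF that(3)]] that(3) N] by blast+
  \<comment> \<open>Both squeezes run at once. At each time the two evaluation points are near the
    same \<open>t\<close>, so grid separation keeps the pair in the wedge.\<close>
  have w1: "rel_htpc (wedge2 A a B b) (a,b) n (\<lambda>t. (\<alpha> t, \<beta> t)) (\<lambda>t. (?\<alpha> t, ?\<beta> t))"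
  proof (rule rel_htpc_wedge2I[OF FA FB])
    show "\<alpha> (?L False (s,t)) = a \<or> \<beta> (?L True (s,t)) = b" if "0 \<le> s" "s \<le> 1" "t \<in> topspace (cube n)" for s t
      by (rule grid_separatedD[OF sep N nL[OF that] nL[OF that] that(3)])
  qed (simp_all only: L01 bdA bdB)
  have r1: "rel_htpc A a n \<alpha> ?\<alpha>" by (rule rel_htpcI[OF FA]) (simp_all only: L01 bdA)
  have dis: "?\<alpha> t = a \<or> ?\<beta> u = b" if "t \<in> topspace (cube n)" "u \<in> topspace (cube n)" "u 1 = t 1" for t u
    using squeeze_skel[OF N n that] sk by blast
  have b1: "based_map A a n ?\<alpha>" by (rule rel_htpc_imp_based_map(2)[OF r1])
  have b2: "based_map B b n ?\<beta>"
    using continuous_map_compose[OF c\<sigma> c\<beta>(1)] c\<beta>(2) near_bdry[OF gridmap_near[OF stepfun_squeeze N cube_bdry_topspace] _ N]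
    by (auto simp: based_map_def o_def)
  note c1 = b1[unfolded based_map_def, THEN conjunct1] and c2 = b2[unfolded based_map_def, THEN conjunct1]
  have n0: "0 < n" using n by simp
  \<comment> \<open>Reparametrisations of coordinate 0 that end with \<open>\<alpha>\<close> running
    on the left half and \<open>\<beta>\<close> on the right half. Coordinate 1 is untouched, so
    \<open>dis\<close> keeps the pair in the wedge meanwhile.\<close>
  let ?p = "\<lambda>s r::real. (1 - s) * r + s * min 1 (2 * r)" and ?q = "\<lambda>s r::real. (1 - s) * r + s * max 0 (2 * r - 1)"
  have pq: "0 \<le> ?p s r \<and> ?p s r \<le> 1" "0 \<le> ?q s r \<and> ?q s r \<le> 1" if "0 \<le> s" "s \<le> 1" "0 \<le> r" "r \<le> 1" for s r
    using that by (auto intro!: convex_bound_le add_nonneg_nonneg mult_nonneg_nonneg)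
  have c0: "continuous_map ?Z euclideanreal (\<lambda>z. snd z 0)"
    by (rule continuous_map_snd_compose[OF continuous_map_cube_coordinate[OF n0]])
  have pqz: "0 \<le> ?p (fst z) (snd z 0) \<and> ?p (fst z) (snd z 0) \<le> 1" "0 \<le> ?q (fst z) (snd z 0) \<and> ?q (fst z) (snd z 0) \<le> 1" if "z \<in> topspace ?Z" for z
    using pq[of "fst z" "snd z 0"] cube_coordD[of "snd z" n 0] that n0 by auto
  have cp: "continuous_map ?Z (cube n) (\<lambda>z. (snd z)(0 := ?p (fst z) (snd z 0)))"
    and cq: "continuous_map ?Z (cube n) (\<lambda>z. (snd z)(0 := ?q (fst z) (snd z 0)))"
    by (rule continuous_map_cube_update[OF continuous_map_snd _ pqz(1) n0], (intro continuous_intros continuous_map_fst_real c0), assumption)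
       (rule continuous_map_cube_update[OF continuous_map_snd _ pqz(2) n0], (intro continuous_intros continuous_map_fst_real c0), assumption)
  let ?pt = "\<lambda>s t. t(0 := ?p s (t 0))" and ?qt = "\<lambda>s t. t(0 := ?q s (t 0))"
  have GA: "continuous_map ?Z A (\<lambda>z. ?\<alpha> (?pt (fst z) (snd z)))" and GB: "continuous_map ?Z B (\<lambda>z. ?\<beta> (?qt (fst z) (snd z)))"
    using continuous_map_compose[OF cp c1] continuous_map_compose[OF cq c2] by (simp_all only: o_def)
  have ptb: "?pt s t \<in> cube_bdry n" "?qt s t \<in> cube_bdry n" if "0 \<le> s" "s \<le> 1" "t \<in> cube_bdry n" for s t
    using pq[OF that(1,2)] cube_coordD[OF cube_bdry_topspace[OF that(3)] n0]
    by (intro cube_bdry_update[OF that(3) _ _ n0]; auto)+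
  have ptT: "?pt s t \<in> topspace (cube n)" "?qt s t \<in> topspace (cube n)" if "0 \<le> s" "s \<le> 1" "t \<in> topspace (cube n)" for s t
    using pq[OF that(1,2)] cube_coordD[OF that(3) n0]
    by (intro cube_update[OF that(3) _ _ n0]; auto)+
  have bA: "?\<alpha> t = a" and bB: "?\<beta> t = b" if "t \<in> cube_bdry n" for t
    using based_map_bdry[OF b1 that] based_map_bdry[OF b2 that] by auto
  have w2: "rel_htpc (wedge2 A a B b) (a,b) n (\<lambda>t. (?\<alpha> t, ?\<beta> t)) (\<lambda>t. (?\<alpha> (?pt 1 t), ?\<beta> (?qt 1 t)))"
  proof (rule rel_htpc_wedge2I[OF GA GB])
    show "?\<alpha> (?pt (fst (s,t)) (snd (s,t))) = a \<or> ?\<beta> (?qt (fst (s,t)) (snd (s,t))) = b" if "0 \<le> s" "s \<le> 1" "t \<in> topspace (cube n)" for s t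
      unfolding fst_conv snd_conv by (rule dis[OF ptT[OF that]]) simp
    show "?\<alpha> (?pt (fst (s,t)) (snd (s,t))) = a" "?\<beta> (?qt (fst (s,t)) (snd (s,t))) = b" if "0 \<le> s" "s \<le> 1" "t \<in> cube_bdry n" for s t
      unfolding fst_conv snd_conv by (rule bA[OF ptb(1)[OF that]], rule bB[OF ptb(2)[OF that]])
  qed simp_all
  have "rel_htpc A a n ?\<alpha> (\<lambda>_. a)" by (rule rel_htpc_trans[OF rel_htpc_sym[OF r1] null])
  then obtain P where P: "continuous_map ?Z A P"
    "\<And>t. t \<in> topspace (cube n) \<Longrightarrow> P (0,t) = ?\<alpha> t" "\<And>t. t \<in> topspace (cube n) \<Longrightarrow> P (1,t) = a"
    "\<And>s t. \<lbrakk>0 \<le> s; s \<le> 1; t \<in> cube_bdry n\<rbrakk> \<Longrightarrow> P (s,t) = a" by (rule rel_htpcE) (rule that)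
  let ?h = "\<lambda>t. t(0 := min 1 (2 * t 0))"
  have pt1: "?pt 1 t = ?h t" for t :: "nat \<Rightarrow> real" by simp
  have z1: "0 \<le> (1::real)" "(1::real) \<le> 1" by auto
  have hb: "?h t \<in> cube_bdry n" if "t \<in> cube_bdry n" for t using ptb(1)[OF z1 that] unfolding pt1 .
  have hT: "?h t \<in> topspace (cube n)" if "t \<in> topspace (cube n)" for t using ptT(1)[OF z1 that] unfolding pt1 .
  have hz: "0 \<le> min 1 (2 * snd z 0) \<and> min 1 (2 * snd z 0) \<le> 1" if "z \<in> topspace ?Z" for z
    using cube_coordD[of "snd z" n 0] that n0 by auto
  have ch: "continuous_map ?Z (cube n) (\<lambda>z. ?h (snd z))"
    by (rule continuous_map_cube_update[OF continuous_map_snd _ hz n0], (intro continuous_intros c0), assumption)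
  have HA: "continuous_map ?Z A (\<lambda>z. P (fst z, ?h (snd z)))"
    by (rule continuous_map_compose_pair[OF P(1) continuous_map_fst_real _ ch]) auto
  let ?\<beta>3 = "\<lambda>t. ?\<beta> (?qt 1 t)"
  have HB: "continuous_map ?Z B (\<lambda>z. ?\<beta>3 (snd z))"
  proof -
    have "continuous_map (cube n) (cube n) (\<lambda>t. ?qt 1 t)"
      using pq(2)[OF z1] cube_coordD[OF _ n0]
      by (intro continuous_map_cube_update[OF _ _ _ n0] continuous_intros continuous_map_cube_coordinate n0) auto
    from continuous_map_snd_compose[OF continuous_map_compose[OF this c2]] show ?thesis by (simp only: o_def)
  qed
  \<comment> \<open>On the left half the second member of the pair is \<open>b\<close>, so the
    nullhomotopy \<open>P\<close> is free to move there; on the right half \<open>?h t\<close> is a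
    boundary point, where \<open>P\<close> stays at \<open>a\<close>.\<close>
  have w3: "rel_htpc (wedge2 A a B b) (a,b) n (\<lambda>t. (?\<alpha> (?pt 1 t), ?\<beta>3 t)) (\<lambda>t. (a, ?\<beta>3 t))"
  proof (rule rel_htpc_wedge2I[OF HA HB])
    show "P (fst (s,t), ?h (snd (s,t))) = a \<or> ?\<beta>3 (snd (s,t)) = b" if "0 \<le> s" "s \<le> 1" "t \<in> topspace (cube n)" for s t
    proof (cases "t 0 \<le> 1/2")
      case True
      then have "?qt 1 t = t(0 := 0)" by simp
      then have "?qt 1 t \<in> cube_bdry n" using cube_face[OF that(3) n0, of 0] by simp
      then show ?thesis using bB by simp
    next
      case False
      then have "?h t = t(0 := 1)" by simp
      then have "?h t \<in> cube_bdry n" using cube_face[OF that(3) n0, of 1] by simp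
      then show ?thesis using P(4)[OF that(1,2)] by simp
    qed
    show "P (fst (0,t), ?h (snd (0,t))) = ?\<alpha> (?pt 1 t)" if "t \<in> topspace (cube n)" for t
      unfolding fst_conv snd_conv pt1 by (rule P(2)[OF hT[OF that]])
    show "P (fst (1,t), ?h (snd (1,t))) = a" if "t \<in> topspace (cube n)" for t
      unfolding fst_conv snd_conv by (rule P(3)[OF hT[OF that]])
    show "P (fst (s,t), ?h (snd (s,t))) = a" "?\<beta>3 (snd (s,t)) = b" if "0 \<le> s" "s \<le> 1" "t \<in> cube_bdry n" for s t
      unfolding fst_conv snd_conv by (rule P(4)[OF that(1,2) hb[OF that(3)]], rule bB[OF ptb(2)[OF z1 that(3)]])
  qed simp_all
  show ?thesis by (rule exI[of _ ?\<beta>3], rule rel_htpc_trans[OF rel_htpc_trans[OF w1 w2] w3])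
qed

text \<open>The asymmetry of the hypotheses is deliberate: \<open>B\<close> will be the wedge of all
  remaining coordinates. The construction also deforms \<open>\<beta>\<close>, so the next
  coordinate has to be treated for the new map \<open>\<beta>'\<close>.\<close>

theorem wedge_pair_kill_null_summand:
  assumes n: "1 < n" and A: "Hausdorff_space A" "well_pointed A a" "\<And>m. m < n \<Longrightarrow> null_at A a m"
    and B: "\<And>m. m < n \<Longrightarrow> null_at B b m"
    and p: "wedge_pair A a B b n \<alpha> \<beta>" and null: "rel_htpc A a n \<alpha> (\<lambda>_. a)"
  shows "\<exists>\<beta>'. rel_htpc (wedge2 A a B b) (a,b) n (\<lambda>t. (\<alpha> t, \<beta> t)) (\<lambda>t. (a, \<beta>' t))"
proof -
  have b\<beta>: "based_map B b n \<beta>" using p by (simp add: wedge_pair_def)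
  obtain \<alpha>1 N where 1: "0 < N" "based_map A a n \<alpha>1" "rel_htpc A a n \<alpha> \<alpha>1"
    "rel_htpc (wedge2 A a B b) (a,b) n (\<lambda>t. (\<alpha> t, \<beta> t)) (\<lambda>t. (\<alpha>1 t, \<beta> t))" "grid_separated n N a b \<alpha>1 \<beta>"
    by (rule wedge_pair_separate[OF A(2,1) p], rule that)
  obtain \<alpha>2 where 2: "based_map A a n \<alpha>2" "rel_htpc A a n \<alpha>1 \<alpha>2"
    "rel_htpc (wedge2 A a B b) (a,b) n (\<lambda>t. (\<alpha>1 t, \<beta> t)) (\<lambda>t. (\<alpha>2 t, \<beta> t))" "grid_separated n N a b \<alpha>2 \<beta>"
    "\<And>t. t \<in> skel n N n \<Longrightarrow> \<alpha>2 t = a"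
    by (rule wedge_pair_kill[OF 1(5,1) _ _ 1(2) b\<beta>, of n], simp, erule A(3), rule that)
  obtain \<beta>2 where 3: "based_map B b n \<beta>2" "rel_htpc B b n \<beta> \<beta>2"
    "rel_htpc (wedge2 B b A a) (b,a) n (\<lambda>t. (\<beta> t, \<alpha>2 t)) (\<lambda>t. (\<beta>2 t, \<alpha>2 t))" "grid_separated n N b a \<beta>2 \<alpha>2"
    "\<And>t. t \<in> skel n N n \<Longrightarrow> \<beta>2 t = b"
    by (rule wedge_pair_kill[OF grid_separated_swap[OF 2(4)] 1(1) _ _ b\<beta> 2(1), of n], simp, erule B, rule that)
  have "rel_htpc A a n \<alpha>2 (\<lambda>_. a)"
    by (rule rel_htpc_trans[OF rel_htpc_sym[OF rel_htpc_trans[OF 1(3) 2(2)]] null])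
  from wedge_pair_slide[OF grid_separated_swap[OF 3(4)] 1(1) n 2(1) 3(1) 2(5) 3(5) this]
  obtain \<beta>' where "rel_htpc (wedge2 A a B b) (a,b) n (\<lambda>t. (\<alpha>2 t, \<beta>2 t)) (\<lambda>t. (a, \<beta>' t))" by blast
  from rel_htpc_trans[OF rel_htpc_trans[OF rel_htpc_trans[OF 1(4) 2(3)] rel_htpc_wedge2_swap[OF 3(3)]] this]
  show ?thesis by - (rule exI[of _ \<beta>'])
qed

text \<open>With connectivity in dimension \<open>n\<close> included, \<open>\<alpha>\<close> is
  erased on \<open>skel n N (Suc n)\<close>, the whole cube, while \<open>\<beta>\<close> stays
  fixed. Since nothing has to be slid, dimensions 0 and 1 are covered too. This provides the
  connectivity of infinite wedges that \<open>wedge_pair_kill_null_summand\<close> asks of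
  \<open>B\<close>.\<close>

theorem wedge_pair_kill_connected_summand:
  assumes A: "Hausdorff_space A" "well_pointed A a" "\<And>m. m \<le> n \<Longrightarrow> null_at A a m"
    and p: "wedge_pair A a B b n \<alpha> \<beta>"
  shows "rel_htpc (wedge2 A a B b) (a,b) n (\<lambda>t. (\<alpha> t, \<beta> t)) (\<lambda>t. (a, \<beta> t))"
proof -
  have b\<beta>: "based_map B b n \<beta>" using p by (simp add: wedge_pair_def)
  obtain \<alpha>1 N where 1: "0 < N" "based_map A a n \<alpha>1" "rel_htpc A a n \<alpha> \<alpha>1"
    "rel_htpc (wedge2 A a B b) (a,b) n (\<lambda>t. (\<alpha> t, \<beta> t)) (\<lambda>t. (\<alpha>1 t, \<beta> t))" "grid_separated n N a b \<alpha>1 \<beta>"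
    by (rule wedge_pair_separate[OF A(2,1) p], rule that)
  have conn: "null_at A a m" if "m < Suc n" for m using A(3) that by simp
  obtain \<alpha>2 where 2: "based_map A a n \<alpha>2" "rel_htpc A a n \<alpha>1 \<alpha>2"
    "rel_htpc (wedge2 A a B b) (a,b) n (\<lambda>t. (\<alpha>1 t, \<beta> t)) (\<lambda>t. (\<alpha>2 t, \<beta> t))" "grid_separated n N a b \<alpha>2 \<beta>"
    "\<And>t. t \<in> skel n N (Suc n) \<Longrightarrow> \<alpha>2 t = a"
    by (rule wedge_pair_kill[OF 1(5,1) order_refl _ 1(2) b\<beta>], erule conn, rule that)
  have "skel n N (Suc n) = topspace (cube n)" by (rule skel_full) simp
  then have "\<alpha>2 t = a" if "t \<in> topspace (cube n)" for t using 2(5) that by simp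
  then show ?thesis by (intro rel_htpc_cong[OF rel_htpc_trans[OF 1(4) 2(3)]]) auto
qed

section \<open>Infinite wedges\<close>

text \<open>\<open>coord_wedge Xs xb J\<close> is the (possibly infinite) wedge of the spaces indexed by \<open>J\<close>, realised inside
  the product; \<open>J = {..i}\<close> gives \<open>Y\<^sub>i\<close> and \<open>J = UNIV\<close> gives the Hawaiian like space.\<close>

definition coord_wedge :: "(nat \<Rightarrow> 'a topology) \<Rightarrow> (nat \<Rightarrow> 'a) \<Rightarrow> nat set \<Rightarrow> (nat \<Rightarrow> 'a) topology" where
  "coord_wedge Xs xb J = subtopology (product_topology Xs UNIV)
     {p. (\<forall>j. j \<notin> J \<longrightarrow> p j = xb j) \<and> (\<forall>j k. j \<noteq> k \<longrightarrow> p j = xb j \<or> p k = xb k)}"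

lemma topspace_coord_wedge:
  "p \<in> topspace (coord_wedge Xs xb J) \<longleftrightarrow> (\<forall>j. p j \<in> topspace (Xs j)) \<and> (\<forall>j. j \<notin> J \<longrightarrow> p j = xb j) \<and>
     (\<forall>j k. j \<noteq> k \<longrightarrow> p j = xb j \<or> p k = xb k)"
  by (auto simp: coord_wedge_def PiE_UNIV_domain)

lemma continuous_map_coord_wedge_coordinate: "continuous_map (coord_wedge Xs xb J) (Xs j) (\<lambda>p. p j)"
  unfolding coord_wedge_def by (intro continuous_map_from_subtopology continuous_map_product_projection) simp

lemma continuous_map_coord_wedgeI:
  assumes "\<And>j. continuous_map Z (Xs j) (\<lambda>z. f z j)" "\<And>z. z \<in> topspace Z \<Longrightarrow> f z \<in> topspace (coord_wedge Xs xb J)"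
  shows "continuous_map Z (coord_wedge Xs xb J) f"
proof -
  have "continuous_map Z (product_topology Xs UNIV) f"
    using assms(1) by (simp add: continuous_map_componentwise_UNIV)
  moreover have "f z \<in> {p. (\<forall>j. j \<notin> J \<longrightarrow> p j = xb j) \<and> (\<forall>j k. j \<noteq> k \<longrightarrow> p j = xb j \<or> p k = xb k)}" if "z \<in> topspace Z" for z
    using assms(2)[OF that] unfolding topspace_coord_wedge by blast
  ultimately show ?thesis unfolding coord_wedge_def continuous_map_in_subtopology by blast
qed

lemma based_map_coord_wedgeI:
  assumes "\<And>j. based_map (Xs j) (xb j) n (\<lambda>t. f t j)" "\<And>t. t \<in> topspace (cube n) \<Longrightarrow> f t \<in> topspace (coord_wedge Xs xb J)"
  shows "based_map (coord_wedge Xs xb J) xb n f"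
  using assms by (auto simp: based_map_def intro!: continuous_map_coord_wedgeI)

lemma based_map_coord_wedge_coordinate:
  "based_map (coord_wedge Xs xb J) xb n f \<Longrightarrow> based_map (Xs j) (xb j) n (\<lambda>t. f t j)"
  using based_map_compose_left[OF _ continuous_map_coord_wedge_coordinate] by (fastforce simp: o_def)

lemma rel_htpc_coord_wedge_coordinate:
  "rel_htpc (coord_wedge Xs xb J) xb n f g \<Longrightarrow> rel_htpc (Xs j) (xb j) n (\<lambda>t. f t j) (\<lambda>t. g t j)"
  using rel_htpc_compose_left[OF _ continuous_map_coord_wedge_coordinate] by (fastforce simp: o_def)

text \<open>Coordinate \<open>j\<close> of the concatenated stages. The counter is the number of
  stages in which coordinate \<open>j\<close> still takes part: stage \<open>k\<close> is entered
  with \<open>Suc j - k\<close>, so the clause for \<open>Suc d\<close> runs stage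
  \<open>j - d\<close>, and counting down ends at the base point.\<close>

primrec telescope :: "(nat \<Rightarrow> real \<times> 'b \<Rightarrow> nat \<Rightarrow> 'a) \<Rightarrow> (nat \<Rightarrow> 'a) \<Rightarrow> nat \<Rightarrow> nat \<Rightarrow> real \<times> 'b \<Rightarrow> 'a" where
  "telescope h xb j 0 z = xb j"
| "telescope h xb j (Suc d) z = (if fst z \<le> 1/2 then h (j - d) (2 * fst z, snd z) j
                                 else telescope h xb j d (2 * fst z - 1, snd z))"

text \<open>Coordinate \<open>j\<close> is constant from stage \<open>j + 1\<close> on, so infinitely many homotopies can be
  concatenated: the limit is continuous coordinatewise.\<close>

lemma rel_htpc_coord_wedge_infinite_concat:
  assumes h: "\<And>k. rel_htpc (coord_wedge Xs xb (J \<inter> {k..})) xb n (f k) (f (Suc k))"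
  shows "rel_htpc (coord_wedge Xs xb J) xb n (f 0) (\<lambda>_. xb)"
proof -
  let ?Z = "prod_topology unit_interval (cube n)" and ?Y = "\<lambda>k. coord_wedge Xs xb (J \<inter> {k..})"
  obtain h where h: "\<And>k. continuous_map ?Z (?Y k) (h k)" "\<And>k t. t \<in> topspace (cube n) \<Longrightarrow> h k (0,t) = f k t"
    "\<And>k t. t \<in> topspace (cube n) \<Longrightarrow> h k (1,t) = f (Suc k) t" "\<And>k s t. \<lbrakk>s \<in> {0..1}; t \<in> cube_bdry n\<rbrakk> \<Longrightarrow> h k (s,t) = xb"
    using h unfolding rel_htpc_iff by metis
  \<comment> \<open>\<open>T k j\<close> is coordinate \<open>j\<close> of the concatenation of the
    stages from \<open>k\<close> on. The claims about it go by induction on the number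
    \<open>Suc j - k\<close> of stages left.\<close>
  define T where "T = (\<lambda>k j. telescope h xb j (Suc j - k))"
  have T_lt: "T k j z = xb j" if "j < k" for k j z using that by (simp add: T_def)
  have T_ge: "T k j z = (if fst z \<le> 1/2 then h k (2 * fst z, snd z) j else T (Suc k) j (2 * fst z - 1, snd z))" if "k \<le> j" for k j z
  proof -
    have "Suc j - k = Suc (j - k)" "Suc j - Suc k = j - k" "j - (j - k) = k" using that by auto
    then show ?thesis by (simp add: T_def)
  qed
  have hT: "h k z \<in> topspace (?Y k)" if "z \<in> topspace ?Z" for k z by (rule continuous_map_in_topspace[OF h(1) that])
  have fT: "f k t \<in> topspace (?Y k)" if "t \<in> topspace (cube n)" for k t
    using hT[of "(0,t)" k] h(2)[OF that, of k] that by simp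
  have half: "(2 * fst z, snd z) \<in> topspace ?Z" if "z \<in> topspace ?Z" "fst z \<le> 1/2" for z using that by auto
  have half': "(2 * fst z - 1, snd z) \<in> topspace ?Z" if "z \<in> topspace ?Z" "\<not> fst z \<le> 1/2" for z using that by auto
  have T0: "T k j (0,t) = f k t j" if t: "t \<in> topspace (cube n)" for k j t
  proof (cases "k \<le> j")
    case True then show ?thesis using T_ge[OF True] h(2)[OF t] by simp
  next
    case False
    then have "f k t j = xb j" using fT[OF t, of k] unfolding topspace_coord_wedge by simp
    then show ?thesis using T_lt False by simp
  qed
  have Tc: "continuous_map ?Z (Xs j) (T k j)" for k j
  proof (induction "Suc j - k" arbitrary: k)
    case 0
    have "xb j \<in> topspace (Xs j)"
    proof -
      obtain t where t: "t \<in> topspace (cube n)" by (auto simp: topspace_cube intro: that[of "\<lambda>i\<in>{..<n}. 0"])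
      have "f (Suc j) t j = xb j" using fT[OF t, of "Suc j"] unfolding topspace_coord_wedge by simp
      moreover have "f (Suc j) t j \<in> topspace (Xs j)" using fT[OF t, of "Suc j"] unfolding topspace_coord_wedge by blast
      ultimately show ?thesis by simp
    qed
    moreover have "T k j = (\<lambda>_. xb j)" using T_lt 0 by auto
    ultimately show ?case by simp
  next
    case (Suc d)
    then have kj: "k \<le> j" by simp
    have IH: "continuous_map ?Z (Xs j) (T (Suc k) j)" by (rule Suc.hyps(1)) (use Suc.hyps(2) in simp)
    have hk: "continuous_map ?Z (Xs j) (\<lambda>z. h k z j)"
      using continuous_map_compose[OF h(1) continuous_map_coord_wedge_coordinate] by (simp add: o_def)
    have "continuous_map ?Z (Xs j) (\<lambda>z. if fst z \<le> 1/2 then h k (2 * fst z, snd z) j else T (Suc k) j (2 * fst z - 1, snd z))"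
      by (rule continuous_map_homotopy_join[OF hk IH]) (simp add: h(3) T0)
    moreover have "T k j = (\<lambda>z. if fst z \<le> 1/2 then h k (2 * fst z, snd z) j else T (Suc k) j (2 * fst z - 1, snd z))"
      using T_ge[OF kj] by (intro ext)
    ultimately show ?case by simp
  qed
  have T1: "T k j (1,t) = xb j" for k j t
  proof (induction "Suc j - k" arbitrary: k)
    case 0 then show ?case using T_lt by simp
  next
    case (Suc d)
    then have kj: "k \<le> j" by simp
    have "T (Suc k) j (1,t) = xb j" by (rule Suc.hyps(1)) (use Suc.hyps(2) in simp)
    then show ?case using T_ge[OF kj] by simp
  qed
  have Tb: "T k j (s,t) = xb j" if "t \<in> cube_bdry n" "0 \<le> s" "s \<le> 1" for k j s t
    using that(2,3)
  proof (induction "Suc j - k" arbitrary: k s)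
    case 0 then show ?case using T_lt by simp
  next
    case (Suc d)
    then have kj: "k \<le> j" by simp
    show ?case
    proof (cases "s \<le> 1/2")
      case True then show ?thesis using T_ge[OF kj] h(4)[of "2 * s" t k] that(1) Suc.prems by simp
    next
      case False
      have "T (Suc k) j (2 * s - 1,t) = xb j" by (rule Suc.hyps(1)) (use Suc.hyps(2) Suc.prems False in auto)
      then show ?thesis using T_ge[OF kj] False by simp
    qed
  qed
  have TJ: "T k j z = xb j" if "z \<in> topspace ?Z" "j \<notin> J" for k j z
    using that(1)
  proof (induction "Suc j - k" arbitrary: k z)
    case 0 then show ?case using T_lt by simp
  next
    case (Suc d)
    then have kj: "k \<le> j" by simp
    show ?case
    proof (cases "fst z \<le> 1/2")
      case True
      then show ?thesis using T_ge[OF kj] hT[OF half[OF Suc.prems True], of k] that(2) unfolding topspace_coord_wedge by simp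
    next
      case False
      have "T (Suc k) j (2 * fst z - 1, snd z) = xb j" by (rule Suc.hyps(1)) (use Suc.hyps(2) half'[OF Suc.prems False] in auto)
      then show ?thesis using T_ge[OF kj] False by simp
    qed
  qed
  \<comment> \<open>At any time both coordinates are in the same stage, so the alternative is
    inherited from that stage; a coordinate that has finished is at the base point anyway.\<close>
  have Td: "T k j z = xb j \<or> T k l z = xb l" if "z \<in> topspace ?Z" "j \<noteq> l" for k j l z
    using that(1)
  proof (induction "Suc j - k" arbitrary: k z)
    case 0 then show ?case using T_lt by simp
  next
    case (Suc d)
    then have kj: "k \<le> j" by simp
    show ?case
    proof (cases "k \<le> l")
      case kl: True
      show ?thesis
      proof (cases "fst z \<le> 1/2")
        case True
        have "h k (2 * fst z, snd z) j = xb j \<or> h k (2 * fst z, snd z) l = xb l"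
          using hT[OF half[OF Suc.prems True], of k] that(2) unfolding topspace_coord_wedge by blast
        then show ?thesis using T_ge[OF kj] T_ge[OF kl] True by simp
      next
        case False
        have "T (Suc k) j (2 * fst z - 1, snd z) = xb j \<or> T (Suc k) l (2 * fst z - 1, snd z) = xb l"
          by (rule Suc.hyps(1)) (use Suc.hyps(2) half'[OF Suc.prems False] in auto)
        then show ?thesis using T_ge[OF kj] T_ge[OF kl] False by simp
      qed
    qed (use T_lt in simp)
  qed
  have Ttop: "T 0 j z \<in> topspace (Xs j)" if "z \<in> topspace ?Z" for j z by (rule continuous_map_in_topspace[OF Tc that])
  show ?thesis
  proof (rule rel_htpcI)
    show "continuous_map ?Z (coord_wedge Xs xb J) (\<lambda>z j. T 0 j z)"
    proof (rule continuous_map_coord_wedgeI)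
      show "(\<lambda>j. T 0 j z) \<in> topspace (coord_wedge Xs xb J)" if "z \<in> topspace ?Z" for z
        unfolding topspace_coord_wedge using Ttop[OF that] TJ[OF that] Td[OF that] by blast
    qed (rule Tc)
  qed (simp_all add: T0 T1 Tb)
qed

section \<open>Removing the coordinates one after another\<close>

locale pointed_family =
  fixes Xs :: "nat \<Rightarrow> 'a topology" and xb :: "nat \<Rightarrow> 'a"
  assumes haus: "\<And>j. Hausdorff_space (Xs j)" and wp: "\<And>j. well_pointed (Xs j) (xb j)"
begin

lemma base: "xb j \<in> topspace (Xs j)"
  using wp[of j] openin_subset unfolding well_pointed_def by blast

text \<open>Coordinate \<open>k\<close> against the rest: the wedge over
  \<open>J \<inter> {k..}\<close> is treated as a wedge of two spaces, and overwriting coordinate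
  \<open>k\<close> leads back to it.\<close>

lemma split_off:
  assumes "k \<in> J" and f: "based_map (coord_wedge Xs xb (J \<inter> {k..})) xb n f"
  shows "wedge_pair (Xs k) (xb k) (coord_wedge Xs xb (J \<inter> {Suc k..})) xb n (\<lambda>t. f t k) (\<lambda>t. (f t)(k := xb k))"
    "continuous_map (wedge2 (Xs k) (xb k) (coord_wedge Xs xb (J \<inter> {Suc k..})) xb) (coord_wedge Xs xb (J \<inter> {k..})) (\<lambda>(x,p). p(k := x))"
proof -
  have fT: "f t \<in> topspace (coord_wedge Xs xb (J \<inter> {k..}))" if "t \<in> topspace (cube n)" for t
    by (rule based_map_in_topspace[OF f that])
  have "based_map (coord_wedge Xs xb (J \<inter> {Suc k..})) xb n (\<lambda>t. (f t)(k := xb k))"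
  proof (rule based_map_coord_wedgeI)
    show "based_map (Xs j) (xb j) n (\<lambda>t. ((f t)(k := xb k)) j)" for j
      using based_map_coord_wedge_coordinate[OF f, of j] by (cases "j = k") (simp_all add: based_map_const base)
    fix t assume t: "t \<in> topspace (cube n)"
    have *: "\<And>j. f t j \<in> topspace (Xs j)" "\<And>j. j \<notin> J \<inter> {k..} \<Longrightarrow> f t j = xb j" "\<And>j l. j \<noteq> l \<Longrightarrow> f t j = xb j \<or> f t l = xb l"
      using fT[OF t] unfolding topspace_coord_wedge by blast+
    have "((f t)(k := xb k)) j = xb j" if "j \<notin> J \<inter> {Suc k..}" for j
      using that *(2)[of j] by (cases "j = k") auto
    then show "(f t)(k := xb k) \<in> topspace (coord_wedge Xs xb (J \<inter> {Suc k..}))"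
      unfolding topspace_coord_wedge using *(1,3) base by (auto simp del: Int_iff)
  qed
  moreover have "f t k = xb k \<or> (f t)(k := xb k) = xb" if t: "t \<in> topspace (cube n)" for t
  proof (cases "f t k = xb k")
    case False
    then have "f t j = xb j" if "j \<noteq> k" for j using fT[OF t] that unfolding topspace_coord_wedge by blast
    then show ?thesis by (auto simp: fun_eq_iff)
  qed simp
  ultimately show "wedge_pair (Xs k) (xb k) (coord_wedge Xs xb (J \<inter> {Suc k..})) xb n (\<lambda>t. f t k) (\<lambda>t. (f t)(k := xb k))"
    using based_map_coord_wedge_coordinate[OF f, of k] by (simp add: wedge_pair_def)
  let ?W = "wedge2 (Xs k) (xb k) (coord_wedge Xs xb (J \<inter> {Suc k..})) xb"
  have c: "continuous_map ?W (Xs k) fst" "continuous_map ?W (coord_wedge Xs xb (J \<inter> {Suc k..})) snd"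
    unfolding wedge2_def by (intro continuous_map_from_subtopology continuous_map_fst continuous_map_snd)+
  show "continuous_map ?W (coord_wedge Xs xb (J \<inter> {k..})) (\<lambda>(x,p). p(k := x))"
  proof (rule continuous_map_coord_wedgeI)
    show "continuous_map ?W (Xs j) (\<lambda>z. (case z of (x,p) \<Rightarrow> p(k := x)) j)" for j
      using c(1) continuous_map_compose[OF c(2) continuous_map_coord_wedge_coordinate[of _ _ _ j]]
      by (cases "j = k") (simp_all add: case_prod_unfold o_def)
    fix z assume z: "z \<in> topspace ?W"
    have p: "snd z \<in> topspace (coord_wedge Xs xb (J \<inter> {Suc k..}))" and x: "fst z \<in> topspace (Xs k)" and d: "fst z = xb k \<or> snd z = xb"
      using z by (auto simp: wedge2_def)
    have *: "\<And>j. snd z j \<in> topspace (Xs j)" "\<And>j. j \<notin> J \<inter> {Suc k..} \<Longrightarrow> snd z j = xb j" "\<And>j l. j \<noteq> l \<Longrightarrow> snd z j = xb j \<or> snd z l = xb l"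
      using p unfolding topspace_coord_wedge by blast+
    have "((snd z)(k := fst z)) j = xb j" if "j \<notin> J \<inter> {k..}" for j
    proof -
      have "j \<noteq> k" "j \<notin> J \<inter> {Suc k..}" using that \<open>k \<in> J\<close> by auto
      then show ?thesis using *(2) by simp
    qed
    moreover have "((snd z)(k := fst z)) j = xb j \<or> ((snd z)(k := fst z)) l = xb l" if "j \<noteq> l" for j l
      using d *(3)[OF that] that by (cases "j = k"; cases "l = k") auto
    moreover have "((snd z)(k := fst z)) j \<in> topspace (Xs j)" for j using *(1) x by simp
    ultimately show "(case z of (x,p) \<Rightarrow> p(k := x)) \<in> topspace (coord_wedge Xs xb (J \<inter> {k..}))"
      unfolding topspace_coord_wedge case_prod_unfold by blast
  qed
qed

lemma stage:
  assumes k: "k \<in> J" and f: "based_map (coord_wedge Xs xb (J \<inter> {k..})) xb n f"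
    and w: "rel_htpc (wedge2 (Xs k) (xb k) (coord_wedge Xs xb (J \<inter> {Suc k..})) xb) (xb k, xb) n
              (\<lambda>t. (f t k, (f t)(k := xb k))) (\<lambda>t. (xb k, g t))"
  shows "based_map (coord_wedge Xs xb (J \<inter> {Suc k..})) xb n g" "rel_htpc (coord_wedge Xs xb (J \<inter> {k..})) xb n f g"
proof -
  have "continuous_map (wedge2 (Xs k) (xb k) (coord_wedge Xs xb (J \<inter> {Suc k..})) xb) (coord_wedge Xs xb (J \<inter> {Suc k..})) snd"
    unfolding wedge2_def by (intro continuous_map_from_subtopology continuous_map_snd)
  from based_map_compose_left[OF rel_htpc_imp_based_map(2)[OF w] this, of xb]
  show g: "based_map (coord_wedge Xs xb (J \<inter> {Suc k..})) xb n g" by (simp add: o_def)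
  have gk: "(g t)(k := xb k) = g t" if "t \<in> topspace (cube n)" for t
    using based_map_in_topspace[OF g that] unfolding topspace_coord_wedge by (auto simp: fun_eq_iff)
  from rel_htpc_compose_left[OF w split_off(2)[OF k f], of xb]
  have "rel_htpc (coord_wedge Xs xb (J \<inter> {k..})) xb n (\<lambda>t. f t) (\<lambda>t. (g t)(k := xb k))" by (simp add: o_def)
  then show "rel_htpc (coord_wedge Xs xb (J \<inter> {k..})) xb n f g" by (rule rel_htpc_cong) (simp_all add: gk)
qed

lemma Int_atLeast_Suc: "k \<notin> J \<Longrightarrow> J \<inter> {k..} = J \<inter> {Suc k..}" for k :: nat
  by (auto simp: le_eq_less_or_eq Suc_le_eq)

text \<open>Erasing a coordinate that is connected up to dimension \<open>n\<close> leaves the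
  others untouched, so stage \<open>k\<close> starts simply from \<open>f\<close> with its first
  \<open>k\<close> coordinates replaced by base points.\<close>

lemma null_at_coord_wedge:
  assumes conn: "\<And>j m. m \<le> n \<Longrightarrow> null_at (Xs j) (xb j) m"
  shows "null_at (coord_wedge Xs xb J) xb n"
  unfolding null_at_def
proof (intro allI impI)
  fix f assume f: "based_map (coord_wedge Xs xb J) xb n f"
  let ?f = "\<lambda>k t j. if j < k then xb j else f t j"
  have fS: "(?f k t)(k := xb k) = ?f (Suc k) t" for k t by (auto simp: fun_eq_iff less_Suc_eq)
  have *: "based_map (coord_wedge Xs xb (J \<inter> {k..})) xb n (?f k)" for k
  proof (rule based_map_coord_wedgeI)
    show "based_map (Xs j) (xb j) n (\<lambda>t. ?f k t j)" for j
      using based_map_coord_wedge_coordinate[OF f, of j] by (cases "j < k") (simp_all add: based_map_const base)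
    show "?f k t \<in> topspace (coord_wedge Xs xb (J \<inter> {k..}))" if "t \<in> topspace (cube n)" for t
      using based_map_in_topspace[OF f that] base unfolding topspace_coord_wedge by (auto simp: not_less)
  qed
  have "rel_htpc (coord_wedge Xs xb (J \<inter> {k..})) xb n (?f k) (?f (Suc k))" for k
  proof (cases "k \<in> J")
    case True
    have "rel_htpc (wedge2 (Xs k) (xb k) (coord_wedge Xs xb (J \<inter> {Suc k..})) xb) (xb k, xb) n
              (\<lambda>t. (?f k t k, (?f k t)(k := xb k))) (\<lambda>t. (xb k, (?f k t)(k := xb k)))"
      by (rule wedge_pair_kill_connected_summand[OF haus wp conn split_off(1)[OF True *]])
    from stage(2)[OF True * this] show ?thesis unfolding fS .
  next
    case False
    have "based_map (coord_wedge Xs xb (J \<inter> {k..})) xb n (?f k)" by (rule *)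
    moreover have "?f k t = ?f (Suc k) t" if t: "t \<in> topspace (cube n)" for t
      using based_map_in_topspace[OF f t] False unfolding topspace_coord_wedge by (auto simp: fun_eq_iff less_Suc_eq)
    ultimately show ?thesis by (rule rel_htpc_equal)
  qed
  from rel_htpc_coord_wedge_infinite_concat[of Xs xb J n ?f, OF this]
  show "rel_htpc (coord_wedge Xs xb J) xb n f (\<lambda>_. xb)" by simp
qed

text \<open>Here erasing coordinate \<open>k\<close> deforms the remaining ones, so the stages are
  chosen recursively, with the invariant that all coordinates remain null homotopic.
  \<open>null_at_coord_wedge\<close>, applied below dimension \<open>n\<close>, gives the
  connectivity of the tail.\<close>

lemma coord_wedge_null_if_coordinates_null:
  assumes n: "1 < n" and conn: "\<And>j m. m < n \<Longrightarrow> null_at (Xs j) (xb j) m"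
    and f: "based_map (coord_wedge Xs xb J) xb n f" and null: "\<And>j. rel_htpc (Xs j) (xb j) n (\<lambda>t. f t j) (\<lambda>_. xb j)"
  shows "rel_htpc (coord_wedge Xs xb J) xb n f (\<lambda>_. xb)"
proof -
  let ?P = "\<lambda>k g. based_map (coord_wedge Xs xb (J \<inter> {k..})) xb n g \<and> (\<forall>j. rel_htpc (Xs j) (xb j) n (\<lambda>t. g t j) (\<lambda>_. xb j))"
  have conn': "null_at (coord_wedge Xs xb K) xb m" if "m < n" for m K
    by (rule null_at_coord_wedge) (use conn that in auto)
  have step: "\<exists>g'. ?P (Suc k) g' \<and> rel_htpc (coord_wedge Xs xb (J \<inter> {k..})) xb n g g'" if g: "?P k g" for k g
  proof (cases "k \<in> J")
    case True
    have gb: "based_map (coord_wedge Xs xb (J \<inter> {k..})) xb n g" using g by blast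
    obtain g' where w: "rel_htpc (wedge2 (Xs k) (xb k) (coord_wedge Xs xb (J \<inter> {Suc k..})) xb) (xb k, xb) n
              (\<lambda>t. (g t k, (g t)(k := xb k))) (\<lambda>t. (xb k, g' t))"
      by (rule exE[OF wedge_pair_kill_null_summand[OF n haus wp _ _ split_off(1)[OF True gb]]],
          erule conn, erule conn', use g in blast, rule that)
    note s = stage[OF True gb w]
    have "rel_htpc (Xs j) (xb j) n (\<lambda>t. g' t j) (\<lambda>_. xb j)" for j
      using rel_htpc_trans[OF rel_htpc_sym[OF rel_htpc_coord_wedge_coordinate[OF s(2)]]] g by blast
    then show ?thesis using s by blast
  next
    case False
    then show ?thesis using g rel_htpc_refl by (metis Int_atLeast_Suc)
  qed
  have "\<exists>F. \<forall>k. ?P k (F k) \<and> rel_htpc (coord_wedge Xs xb (J \<inter> {k..})) xb n (F k) (F (Suc k)) \<and> (k = 0 \<longrightarrow> F k = f)"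
  proof -
    obtain s where s: "\<And>k g. ?P k g \<Longrightarrow> ?P (Suc k) (s k g) \<and> rel_htpc (coord_wedge Xs xb (J \<inter> {k..})) xb n g (s k g)"
      using step by metis
    let ?F = "rec_nat f s"
    have P: "?P k (?F k)" for k
      by (induction k) (use f null s in auto)
    then show ?thesis using s[OF P] by (intro exI[of _ ?F]) auto
  qed
  then obtain F where F: "\<And>k. rel_htpc (coord_wedge Xs xb (J \<inter> {k..})) xb n (F k) (F (Suc k))" "F 0 = f" by blast
  from rel_htpc_coord_wedge_infinite_concat[of Xs xb J n F, OF F(1)] F(2) show ?thesis by simp
qed

theorem rel_htpc_coord_wedge_iff:
  assumes n: "1 < n" and conn: "\<And>j m. m < n \<Longrightarrow> null_at (Xs j) (xb j) m"
    and f: "based_map (coord_wedge Xs xb J) xb n f" and g: "based_map (coord_wedge Xs xb J) xb n g"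
  shows "rel_htpc (coord_wedge Xs xb J) xb n f g \<longleftrightarrow> (\<forall>j. rel_htpc (Xs j) (xb j) n (\<lambda>t. f t j) (\<lambda>t. g t j))"
proof
  assume "rel_htpc (coord_wedge Xs xb J) xb n f g"
  then show "\<forall>j. rel_htpc (Xs j) (xb j) n (\<lambda>t. f t j) (\<lambda>t. g t j)" using rel_htpc_coord_wedge_coordinate by blast
next
  assume fg: "\<forall>j. rel_htpc (Xs j) (xb j) n (\<lambda>t. f t j) (\<lambda>t. g t j)"
  have n0: "0 < n" using n by simp
  have b: "based_map (coord_wedge Xs xb J) xb n (concat (reverse f) g)"
    by (rule based_map_concat[OF based_map_reverse[OF f n0] g n0])
  have "rel_htpc (Xs j) (xb j) n (\<lambda>t. concat (reverse f) g t j) (\<lambda>_. xb j)" for j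
  proof -
    have gj: "based_map (Xs j) (xb j) n (\<lambda>t. g t j)" by (rule based_map_coord_wedge_coordinate[OF g])
    have "rel_htpc (Xs j) (xb j) n (concat (reverse (\<lambda>t. f t j)) (\<lambda>t. g t j)) (concat (reverse (\<lambda>t. g t j)) (\<lambda>t. g t j))"
      by (rule rel_htpc_concat[OF rel_htpc_reverse[OF spec[OF fg] n0] rel_htpc_refl[OF gj] n0])
    from rel_htpc_trans[OF this rel_htpc_concat_reverse_left[OF gj n0]]
    show ?thesis by (rule rel_htpc_cong) (auto simp: concat_def reverse_def)
  qed
  from rel_htpc_if_concat_reverse[OF f g n0 coord_wedge_null_if_coordinates_null[OF n conn b this]]
  show "rel_htpc (coord_wedge Xs xb J) xb n f g" .
qed

end

section \<open>Nearby maps are homotopic\<close>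

definition contracts :: "'a topology \<Rightarrow> 'a set \<Rightarrow> 'a set \<Rightarrow> bool" where
  "contracts T V U \<longleftrightarrow> V \<subseteq> U \<and> (\<exists>h c. continuous_map (prod_topology unit_interval (subtopology T V)) T h \<and>
     (\<forall>s\<in>{0..1}. \<forall>v\<in>V. h (s,v) \<in> U) \<and> (\<forall>v\<in>V. h (0,v) = v) \<and> (\<forall>v\<in>V. h (1,v) = c))"

text \<open>The homotopy fixes \<open>z\<close>, so by the tube lemma it keeps a whole neighbourhood
  of \<open>z\<close> inside \<open>U\<close> at all times.\<close>

lemma well_pointed_contracts:
  assumes wp: "well_pointed T z" and U: "openin T U" "z \<in> U"
  shows "\<exists>V. openin T V \<and> z \<in> V \<and> contracts T V U"
proof -
  obtain h V where h: "continuous_map (prod_topology unit_interval T) T h" "\<And>x. x \<in> topspace T \<Longrightarrow> h (0,x) = x"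
    "\<And>s. s \<in> {0..1} \<Longrightarrow> h (s,z) = z" and V: "openin T V" "z \<in> V" "\<And>x. x \<in> V \<Longrightarrow> h (1,x) = z"
    using wp unfolding well_pointed_def by blast
  let ?O = "{p \<in> topspace (prod_topology unit_interval T). h p \<in> U}"
  have zT: "z \<in> topspace T" using openin_subset[OF U(1)] U(2) by blast
  have O: "openin (prod_topology unit_interval T) ?O" by (rule openin_continuous_map_preimage[OF h(1) U(1)])
  have C: "compactin unit_interval {0..1}"
    using compact_space_def[of unit_interval] by (simp add: compact_space_subtopology)
  have "{0..1} \<times> {z} \<subseteq> ?O" using h(3) zT U(2) by auto
  from tube_lemma_left[OF O C zT this]
  obtain A W where W: "openin unit_interval A" "openin T W" "{0..1} \<subseteq> A" "z \<in> W" "A \<times> W \<subseteq> ?O" by blast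
  have hU: "h (s,v) \<in> U" if "s \<in> {0..1}" "v \<in> W" for s v using W(3,5) that by blast
  have WT: "W \<subseteq> topspace T" by (rule openin_subset[OF W(2)])
  have "W \<subseteq> U" using hU[of 0] h(2) WT by force
  moreover have "continuous_map (prod_topology unit_interval (subtopology T (V \<inter> W))) T h"
    using continuous_map_from_subtopology[OF h(1), of "UNIV \<times> (V \<inter> W)"]
    by (simp add: subtopology_Times)
  ultimately have "contracts T (V \<inter> W) U"
    unfolding contracts_def using hU h(2) V(3) WT by (intro conjI exI[of _ h] exI[of _ z]) auto
  then show ?thesis using V W by (intro exI[of _ "V \<inter> W"]) auto
qed

text \<open>Twice the sup-norm distance from the centre of \<open>I \<times> I^m\<close>; the
  boundary of the box is the level 1.\<close>

primrec suprad :: "nat \<Rightarrow> real \<times> (nat \<Rightarrow> real) \<Rightarrow> real" where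
  "suprad 0 z = \<bar>2 * fst z - 1\<bar>"
| "suprad (Suc m) z = max (suprad m z) \<bar>2 * snd z m - 1\<bar>"

lemma suprad_ge: "\<bar>2 * fst z - 1\<bar> \<le> suprad m z" "i < m \<Longrightarrow> \<bar>2 * snd z i - 1\<bar> \<le> suprad m z"
  by (induction m) (auto simp: less_Suc_eq le_max_iff_disj)

lemma suprad_attained: "suprad m z = \<bar>2 * fst z - 1\<bar> \<or> (\<exists>i<m. suprad m z = \<bar>2 * snd z i - 1\<bar>)"
  by (induction m) (auto simp: max_def less_Suc_eq)

lemma suprad_le_1:
  assumes "0 \<le> s" "s \<le> 1" "y \<in> topspace (cube m)" shows "suprad m (s,y) \<le> 1"
proof -
  have "\<bar>2 * s - 1\<bar> \<le> 1" using assms(1,2) by (simp add: abs_le_iff)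
  moreover have "\<bar>2 * y i - 1\<bar> \<le> 1" if "i < m" for i using cube_coordD[OF assms(3) that] by (simp add: abs_le_iff)
  ultimately show ?thesis using suprad_attained[of m "(s,y)"] by auto
qed

lemma continuous_map_suprad:
  assumes "m \<le> n" shows "continuous_map (prod_topology unit_interval (cube n)) euclideanreal (suprad m)"
  using assms
proof (induction m)
  case 0
  have "continuous_map (prod_topology unit_interval (cube n)) euclideanreal (\<lambda>z. \<bar>2 * fst z - 1\<bar>)"
    by (intro continuous_intros continuous_map_fst_real)
  then show ?case by (rule continuous_map_eq) simp
next
  case (Suc m)
  have "continuous_map (prod_topology unit_interval (cube n)) euclideanreal (\<lambda>z. max (suprad m z) \<bar>2 * snd z m - 1\<bar>)"
    using Suc by (intro continuous_intros continuous_map_snd_compose[OF continuous_map_cube_coordinate]) auto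
  then show ?case by (rule continuous_map_eq) simp
qed

text \<open>Two maps into \<open>V\<close> that agree on the boundary of the cube form a map of \<open>\<partial>(I \<times> I\<^sup>m)\<close> into \<open>V\<close>;
  the contraction of \<open>V\<close> extends it over the cone \<open>I \<times> I\<^sup>m\<close>.\<close>

lemma contracts_homotopy:
  assumes c: "contracts T V U" and f: "continuous_map (cube m) T f" "\<And>y. y \<in> topspace (cube m) \<Longrightarrow> f y \<in> V"
    and g: "continuous_map (cube m) T g" "\<And>y. y \<in> topspace (cube m) \<Longrightarrow> g y \<in> V"
    and fg: "\<And>y. y \<in> cube_bdry m \<Longrightarrow> f y = g y"
  shows "\<exists>H. continuous_map (prod_topology unit_interval (cube m)) T H \<and> (\<forall>y\<in>topspace (cube m). H (0,y) = f y) \<and>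
    (\<forall>y\<in>topspace (cube m). H (1,y) = g y) \<and> (\<forall>s\<in>{0..1}. \<forall>y\<in>cube_bdry m. H (s,y) = f y) \<and>
    (\<forall>s\<in>{0..1}. \<forall>y\<in>topspace (cube m). H (s,y) \<in> U)"
proof -
  obtain h c where h: "continuous_map (prod_topology unit_interval (subtopology T V)) T h"
     "\<And>s v. s \<in> {0..1} \<Longrightarrow> v \<in> V \<Longrightarrow> h (s,v) \<in> U" "\<And>v. v \<in> V \<Longrightarrow> h (0,v) = v" "\<And>v. v \<in> V \<Longrightarrow> h (1,v) = c"
    using c unfolding contracts_def by blast
  let ?Z = "prod_topology unit_interval (cube m)"
  \<comment> \<open>The lower bound \<open>1/2\<close> prevents division by zero near the centre,
    where the cone is already at its tip.\<close>
  let ?r = "\<lambda>z. max (suprad m z) (1/2)"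
  \<comment> \<open>The cone parameter: 0 on the boundary of the box and 1 on the concentric box of
    half the size. Outside that core, \<open>Y\<close> is the cube component of the radial
    projection onto the boundary.\<close>
  define u where "u = (\<lambda>z. min 1 (2 - 2 * suprad m z))"
  define Y where "Y = (\<lambda>z. \<lambda>i\<in>{..<m}. (1 + (2 * snd z i - 1) / ?r z) / 2)"
  have cr: "continuous_map ?Z euclideanreal (suprad m)" by (rule continuous_map_suprad) simp
  have z1: "suprad m z \<le> 1" if "z \<in> topspace ?Z" for z using suprad_le_1[of "fst z" "snd z" m] that by auto
  have z0: "0 \<le> suprad m z" for z using order_trans[OF abs_ge_zero suprad_ge(1)] .
  have yb: "0 \<le> (1 + (2 * snd z i - 1) / ?r z) / 2 \<and> (1 + (2 * snd z i - 1) / ?r z) / 2 \<le> 1" if "i < m" for i z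
  proof -
    have "\<bar>2 * snd z i - 1\<bar> \<le> ?r z" using suprad_ge(2)[OF that, of z] by simp
    moreover have "0 < ?r z" by (simp add: less_max_iff_disj)
    ultimately have "\<bar>(2 * snd z i - 1) / ?r z\<bar> \<le> 1" by (simp only: abs_divide abs_of_pos divide_le_eq_1_pos)
    then have "(2 * snd z i - 1) / ?r z \<le> 1" "- ((2 * snd z i - 1) / ?r z) \<le> 1" by (rule abs_le_D1, rule abs_le_D2)
    moreover have "0 \<le> (1 + q) / 2 \<and> (1 + q) / 2 \<le> 1" if "q \<le> 1" "- q \<le> 1" for q :: real using that by simp
    ultimately show ?thesis by blast
  qed
  have cy: "continuous_map ?Z (cube m) Y"
  proof (rule continuous_map_cubeI)
    show "Y z \<in> topspace (cube m)" for z using yb by (auto simp: topspace_cube Y_def)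
    fix i assume i: "i < m"
    have "continuous_map ?Z euclideanreal (\<lambda>z. (1 + (2 * snd z i - 1) / ?r z) / 2)"
      by (intro continuous_intros continuous_map_snd_compose[OF continuous_map_cube_coordinate[OF i]] cr) auto
    then show "continuous_map ?Z euclideanreal (\<lambda>z. Y z i)" using i by (simp add: Y_def)
  qed
  have yT: "Y z \<in> topspace (cube m)" for z using yb by (auto simp: topspace_cube Y_def)
  have cu: "continuous_map ?Z euclideanreal u" unfolding u_def by (intro continuous_intros cr)
  have ub: "0 \<le> u z \<and> u z \<le> 1" if "z \<in> topspace ?Z" for z using z1[OF that] by (auto simp: u_def)
  have F: "continuous_map ?Z T (\<lambda>z. h (u z, k (Y z)))"
    if k: "continuous_map (cube m) T k" "\<And>y. y \<in> topspace (cube m) \<Longrightarrow> k y \<in> V" for k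
  proof (rule continuous_map_compose_pair[OF h(1) cu ub])
    have "continuous_map ?Z T (\<lambda>z. k (Y z))" using continuous_map_compose[OF cy k(1)] by (simp only: o_def)
    then show "continuous_map ?Z (subtopology T V) (\<lambda>z. k (Y z))"
      using k(2)[OF yT] by (simp add: continuous_map_in_subtopology image_subset_iff Pi_iff)
  qed
  \<comment> \<open>On the middle slice outside the core the projection hits a side face over the
    boundary of the cube, where \<open>f\<close> and \<open>g\<close> agree; inside the core both
    branches equal the tip \<open>c\<close>.\<close>
  let ?H = "\<lambda>z. if fst z \<le> 1/2 then h (u z, f (Y z)) else h (u z, g (Y z))"
  have H: "continuous_map ?Z T ?H"
  proof (rule continuous_map_cases_le)
    fix z assume z: "z \<in> topspace ?Z" "fst z = 1/2"
    show "h (u z, f (Y z)) = h (u z, g (Y z))"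
    proof (cases "suprad m z \<le> 1/2")
      case True
      then have "u z = 1" by (simp add: u_def)
      then show ?thesis using h(4) f(2)[OF yT] g(2)[OF yT] by simp
    next
      case False
      have "\<bar>2 * fst z - 1\<bar> = 0" using z(2) by simp
      then obtain i where i: "i < m" "suprad m z = \<bar>2 * snd z i - 1\<bar>" using suprad_attained[of m z] False by auto
      have r: "?r z = \<bar>2 * snd z i - 1\<bar>" using False i by simp
      have "(2 * snd z i - 1) / ?r z = 1 \<or> (2 * snd z i - 1) / ?r z = -1"
      proof -
        have "q / \<bar>q\<bar> = 1 \<or> q / \<bar>q\<bar> = -1" if "q \<noteq> 0" for q :: real using that by (simp add: abs_if)
        moreover have "2 * snd z i - 1 \<noteq> 0" using False i by auto
        ultimately show ?thesis unfolding r by blast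
      qed
      then have "Y z i = 0 \<or> Y z i = 1" using i(1) unfolding Y_def by auto
      then have "Y z \<in> cube_bdry m" using i(1) yT by (auto simp: cube_bdry_iff)
      then show ?thesis using fg by simp
    qed
  qed (auto intro: continuous_map_fst_real continuous_map_from_subtopology F[OF f] F[OF g])
  have full: "Y z = snd z \<and> u z = 0" if "z \<in> topspace ?Z" "suprad m z = 1" for z
    using that by (auto simp: topspace_cube fun_eq_iff PiE_def extensional_def Y_def u_def)
  have e0: "suprad m (s,y) = 1" if "y \<in> topspace (cube m)" "s = 0 \<or> s = 1" for s y
  proof -
    have "1 \<le> suprad m (s,y)" using suprad_ge(1)[of "(s,y)" m] that(2) by auto
    then show ?thesis using z1[of "(s,y)"] that by auto
  qed
  have eb: "suprad m (s,y) = 1" if y: "y \<in> cube_bdry m" "0 \<le> s" "s \<le> 1" for s y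
  proof -
    obtain i where "i < m" "y i = 0 \<or> y i = 1" using y(1) by (auto simp: cube_bdry_iff)
    then have "1 \<le> suprad m (s,y)" using suprad_ge(2)[of i m "(s,y)"] by auto
    then show ?thesis using z1[of "(s,y)"] y cube_bdry_topspace[OF y(1)] by simp
  qed
  show ?thesis
  proof (intro exI[of _ ?H] conjI ballI)
    show "?H (0,y) = f y" if y: "y \<in> topspace (cube m)" for y
    proof -
      have "Y (0,y) = snd (0::real,y) \<and> u (0,y) = 0" by (rule full) (use y e0[OF y, of 0] in auto)
      then show ?thesis using h(3)[OF f(2)[OF y]] by simp
    qed
    show "?H (1,y) = g y" if y: "y \<in> topspace (cube m)" for y
    proof -
      have "Y (1,y) = snd (1::real,y) \<and> u (1,y) = 0" by (rule full) (use y e0[OF y, of 1] in auto)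
      then show ?thesis using h(3)[OF g(2)[OF y]] by simp
    qed
    show "?H (s,y) = f y" if s: "s \<in> {0..1}" and y: "y \<in> cube_bdry m" for s y
    proof -
      have yt: "y \<in> topspace (cube m)" by (rule cube_bdry_topspace[OF y])
      have "Y (s,y) = snd (s,y) \<and> u (s,y) = 0" by (rule full) (use yt s eb[OF y, of s] in auto)
      then show ?thesis using h(3)[OF f(2)[OF yt]] fg[OF y] by simp
    qed
    show "?H (s,y) \<in> U" if s: "s \<in> {0..1}" and y: "y \<in> topspace (cube m)" for s y
    proof -
      have "u (s,y) \<in> {0..1}" using ub[of "(s,y)"] s y by auto
      then show ?thesis using h(2) f(2)[OF yT] g(2)[OF yT] by simp
    qed
  qed (rule H)
qed

section \<open>Star refinements of open covers\<close>

definition open_cover :: "'a topology \<Rightarrow> 'a set set \<Rightarrow> bool" where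
  "open_cover T \<U> \<longleftrightarrow> (\<forall>U\<in>\<U>. openin T U) \<and> topspace T \<subseteq> \<Union>\<U>"

text \<open>Finitely many closed sets \<open>C i\<close> inside \<open>U i\<close> are chosen, with
  open sets \<open>W i\<close> inside \<open>C i\<close> covering the space. A member
  \<open>?N x\<close> of the refinement selects for each \<open>i\<close> either \<open>U i\<close>
  or the complement of \<open>C i\<close>; if it contains a point of \<open>W i\<close>, it must
  have selected \<open>U i\<close>.\<close>

lemma point_star_refinement:
  assumes T: "compact_space T" "Hausdorff_space T" and U: "open_cover T \<U>"
  shows "\<exists>\<V>. open_cover T \<V> \<and> (\<forall>p\<in>topspace T. \<exists>U\<in>\<U>. \<forall>V\<in>\<V>. p \<in> V \<longrightarrow> V \<subseteq> U)"
proof -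
  have "\<exists>U C W. U \<in> \<U> \<and> openin T W \<and> closedin T C \<and> x \<in> W \<and> W \<subseteq> C \<and> C \<subseteq> U" if x: "x \<in> topspace T" for x
  proof -
    obtain U where "U \<in> \<U>" "x \<in> U" "openin T U" using U x unfolding open_cover_def by blast
    then show ?thesis
      using compact_Hausdorff_imp_regular_space[OF T] unfolding neighbourhood_base_of_closedin[symmetric] neighbourhood_base_of
      by meson
  qed
  then obtain U C W where UCW: "\<And>x. x \<in> topspace T \<Longrightarrow> U x \<in> \<U> \<and> openin T (W x) \<and> closedin T (C x) \<and> x \<in> W x \<and> W x \<subseteq> C x \<and> C x \<subseteq> U x"
    by metis
  have "\<forall>V\<in>W ` topspace T. openin T V" using UCW by blast
  moreover have "topspace T \<subseteq> \<Union>(W ` topspace T)" using UCW by blast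
  ultimately have "\<exists>\<F>. finite \<F> \<and> \<F> \<subseteq> W ` topspace T \<and> topspace T \<subseteq> \<Union>\<F>"
    using spec[OF T(1)[unfolded compact_space_alt], of "W ` topspace T"] by (simp only: simp_thms)
  then obtain \<F> where \<F>: "finite \<F>" "\<F> \<subseteq> W ` topspace T" "topspace T \<subseteq> \<Union>\<F>" by blast
  obtain F where F: "finite F" "F \<subseteq> topspace T" "\<F> = W ` F" using finite_subset_image[OF \<F>(1,2)] by blast
  let ?N = "\<lambda>x. topspace T \<inter> \<Inter>((\<lambda>i. if x \<in> C i then U i else topspace T - C i) ` F)"
  have oU: "openin T (U i)" if "i \<in> F" for i using UCW F(2) U that unfolding open_cover_def by blast
  have "openin T (?N x)" for x
  proof (cases "F = {}")
    case False
    then show ?thesis using F UCW oU by (intro openin_Int openin_INT2) (auto intro!: openin_diff)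
  qed simp
  moreover have "x \<in> ?N x" if x: "x \<in> topspace T" for x
    using UCW F(2) x by auto
  ultimately have "open_cover T (?N ` topspace T)" unfolding open_cover_def by blast
  moreover have "\<exists>V\<in>\<U>. \<forall>N\<in>?N ` topspace T. p \<in> N \<longrightarrow> N \<subseteq> V" if p: "p \<in> topspace T" for p
  proof -
    obtain i where i: "i \<in> F" "p \<in> W i" using \<F>(3) F(3) p by blast
    have iT: "i \<in> topspace T" using i F(2) by blast
    have pC: "p \<in> C i" using UCW[OF iT] i(2) by blast
    have "?N x \<subseteq> U i" if "p \<in> ?N x" for x
    proof (cases "x \<in> C i")
      case True then show ?thesis using i(1) by auto
    next
      case False
      have "p \<in> (if x \<in> C i then U i else topspace T - C i)" using INT_D[OF IntD2[OF that] i(1)] .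
      then show ?thesis using pC False by simp
    qed
    then show ?thesis using UCW[OF iT] by blast
  qed
  ultimately show ?thesis by blast
qed

text \<open>Two point-star refinements in succession. The bound over \<open>p \<in> V\<close>
  restricts the claim to nonempty members.\<close>

lemma star_refinement:
  assumes T: "compact_space T" "Hausdorff_space T" and U: "open_cover T \<W>"
  shows "\<exists>\<V>. open_cover T \<V> \<and> (\<forall>V\<in>\<V>. \<forall>p\<in>V. \<exists>W\<in>\<W>. \<forall>V'\<in>\<V>. V' \<inter> V \<noteq> {} \<longrightarrow> V' \<subseteq> W)"
proof -
  obtain \<U> where \<U>: "open_cover T \<U>" "\<forall>p\<in>topspace T. \<exists>W\<in>\<W>. \<forall>U\<in>\<U>. p \<in> U \<longrightarrow> U \<subseteq> W"
    using point_star_refinement[OF assms] by (elim exE conjE) (rule that)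
  obtain \<V> where \<V>: "open_cover T \<V>" "\<forall>p\<in>topspace T. \<exists>U\<in>\<U>. \<forall>V\<in>\<V>. p \<in> V \<longrightarrow> V \<subseteq> U"
    using point_star_refinement[OF T \<U>(1)] by (elim exE conjE) (rule that)
  have "\<exists>W\<in>\<W>. \<forall>V'\<in>\<V>. V' \<inter> V \<noteq> {} \<longrightarrow> V' \<subseteq> W" if V: "V \<in> \<V>" "p \<in> V" for V p
  proof -
    have VT: "V' \<subseteq> topspace T" if "V' \<in> \<V>" for V' using \<V>(1) that openin_subset unfolding open_cover_def by blast
    obtain W where W: "W \<in> \<W>" "\<forall>U\<in>\<U>. p \<in> U \<longrightarrow> U \<subseteq> W" using bspec[OF \<U>(2) subsetD[OF VT[OF V(1)] V(2)]] by (rule bexE) (rule that)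
    have "V' \<subseteq> W" if V': "V' \<in> \<V>" "V' \<inter> V \<noteq> {}" for V'
    proof -
      obtain q where q: "q \<in> V'" "q \<in> V" using V'(2) by blast
      obtain U where U: "U \<in> \<U>" "\<forall>V\<in>\<V>. q \<in> V \<longrightarrow> V \<subseteq> U" using bspec[OF \<V>(2) subsetD[OF VT[OF V(1)] q(2)]] by (rule bexE) (rule that)
      have "V \<subseteq> U" "V' \<subseteq> U" using U(2) V(1) V'(1) q by blast+
      then show ?thesis using W(2) U(1) V(2) by blast
    qed
    then show ?thesis using W(1) by blast
  qed
  then show ?thesis using \<V>(1) by blast
qed

lemma cell_in_some_gcube:
  assumes c: "(b,S) \<in> cells n N k" and N: "0 < N"
  shows "\<exists>a\<in>PiE {..<n} (\<lambda>_. {..<N}). cell n N b S \<subseteq> gcube n N a"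
proof
  \<comment> \<open>A frozen coordinate at \<open>N\<close> is put into the last interval; a free
    one is below \<open>N\<close> already.\<close>
  let ?a = "\<lambda>i\<in>{..<n}. min (b i) (N - 1)"
  show "?a \<in> PiE {..<n} (\<lambda>_. {..<N})" using N by auto
  show "cell n N b S \<subseteq> gcube n N ?a"
  proof
    fix t assume t: "t \<in> cell n N b S"
    have "real (?a i) \<le> N * t i \<and> N * t i \<le> real (Suc (?a i))" if i: "i < n" for i
    proof (cases "i \<in> S")
      case True
      then have "min (b i) (N - 1) = b i" using cellsD(5)[OF c True] by simp
      then show ?thesis using t i True by (simp add: cell_def del: of_nat_Suc)
    next
      case False
      then have e: "N * t i = real (b i)" using t i by (simp add: cell_def)
      have "b i \<le> Suc (min (b i) (N - 1))" using cellsD(4)[OF c i] by auto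
      then have "real (b i) \<le> real (Suc (min (b i) (N - 1)))" by (simp only: of_nat_le_iff)
      then show ?thesis using e i by (simp del: of_nat_Suc)
    qed
    then show "t \<in> gcube n N ?a" using t by (simp add: cell_def del: of_nat_Suc)
  qed
qed

definition grid_close :: "nat \<Rightarrow> nat \<Rightarrow> 'a set set \<Rightarrow> ((nat \<Rightarrow> real) \<Rightarrow> 'a) \<Rightarrow> ((nat \<Rightarrow> real) \<Rightarrow> 'a) \<Rightarrow> bool" where
  "grid_close n N \<V> f g \<longleftrightarrow> (\<forall>a\<in>PiE {..<n} (\<lambda>_. {..<N}). \<exists>V\<in>\<V>. \<forall>t\<in>gcube n N a. f t \<in> V \<and> g t \<in> V)"

text \<open>On each \<open>k\<close>-cell \<open>g\<close> is moved to \<open>f\<close> by the cone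
  construction inside a set of \<open>\<U>\<close>, and the extension to the cube makes the maps
  agree on the next skeleton. The set chosen for a cell may come from another grid cube containing
  it, but it meets the set \<open>Ua\<close> of the present cube, so the star condition puts all of
  them into one set of \<open>\<W>\<close>.\<close>

lemma grid_close_step:
  assumes star: "\<And>U p. \<lbrakk>U \<in> \<U>; p \<in> U\<rbrakk> \<Longrightarrow> \<exists>W\<in>\<W>. \<forall>U'\<in>\<U>. U' \<inter> U \<noteq> {} \<longrightarrow> U' \<subseteq> W"
    and contr: "\<And>V. V \<in> \<V> \<Longrightarrow> \<exists>U\<in>\<U>. contracts T V U"
    and N: "0 < N" and k: "k \<le> n" and f: "based_map T x n f" and g: "based_map T x n g"
    and eq: "\<And>t. t \<in> skel n N k \<Longrightarrow> f t = g t" and close: "grid_close n N \<V> f g"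
  shows "\<exists>f' g'. rel_htpc T x n f f' \<and> rel_htpc T x n g g' \<and> (\<forall>t\<in>skel n N (Suc k). f' t = g' t) \<and> grid_close n N \<W> f' g'"
proof -
  let ?Z = "prod_topology unit_interval (cube n)"
  have cf: "continuous_map (cube n) T f" and cg: "continuous_map (cube n) T g" using f g by (auto simp: based_map_def)
  let ?P = "\<lambda>c U h. U \<in> \<U> \<and> continuous_map (prod_topology unit_interval (cube k)) T h \<and>
      (\<forall>y\<in>topspace (cube k). h (0,y) = g (chart n N (fst c) (snd c) y)) \<and>
      (\<forall>y\<in>topspace (cube k). h (1,y) = f (chart n N (fst c) (snd c) y)) \<and>
      (\<forall>s\<in>{0..1}. \<forall>y\<in>cube_bdry k. h (s,y) = g (chart n N (fst c) (snd c) y)) \<and>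
      (\<forall>s\<in>{0..1}. \<forall>y\<in>topspace (cube k). h (s,y) \<in> U) \<and> (\<forall>t\<in>cell n N (fst c) (snd c). f t \<in> U) \<and>
      ((\<forall>t\<in>cell n N (fst c) (snd c). f t = g t) \<longrightarrow> (\<forall>s\<in>{0..1}. \<forall>y\<in>topspace (cube k). h (s,y) = g (chart n N (fst c) (snd c) y)))"
  have "\<forall>c\<in>cells n N k. \<exists>U h. ?P c U h"
  proof
    fix c assume "c \<in> cells n N k"
    then obtain b S where c: "c = (b,S)" "(b,S) \<in> cells n N k" by (cases c) auto
    obtain a where a: "a \<in> PiE {..<n} (\<lambda>_. {..<N})" "cell n N b S \<subseteq> gcube n N a" using cell_in_some_gcube[OF c(2) N] by blast
    obtain V where V: "V \<in> \<V>" "\<forall>t\<in>gcube n N a. f t \<in> V \<and> g t \<in> V" using bspec[OF close[unfolded grid_close_def] a(1)] by blast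
    obtain U where U: "U \<in> \<U>" "contracts T V U" using contr[OF V(1)] by blast
    have VU: "V \<subseteq> U" using U(2) by (simp add: contracts_def)
    have cellV: "f t \<in> V" "g t \<in> V" if "t \<in> cell n N b S" for t using V(2) a(2) that by blast+
    have ch: "chart n N b S y \<in> cell n N b S" if "y \<in> topspace (cube k)" for y by (rule chart_in_cell[OF c(2) N that])
    have cgc: "continuous_map (cube k) T (\<lambda>y. g (chart n N b S y))" and cfc: "continuous_map (cube k) T (\<lambda>y. f (chart n N b S y))"
      using continuous_map_compose[OF continuous_map_chart[OF c(2) N] cg] continuous_map_compose[OF continuous_map_chart[OF c(2) N] cf]
      by (simp_all only: o_def)
    show "\<exists>U h. ?P c U h"
    proof (cases "\<forall>t\<in>cell n N b S. f t = g t")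
      case True
      then have "?P c U (\<lambda>z. g (chart n N b S (snd z)))"
        using U(1) continuous_map_snd_compose[OF cgc] ch cellV VU cube_bdry_topspace unfolding c(1) by auto
      then show ?thesis by blast
    next
      case False
      have "\<exists>H. continuous_map (prod_topology unit_interval (cube k)) T H \<and> (\<forall>y\<in>topspace (cube k). H (0,y) = g (chart n N b S y)) \<and>
    (\<forall>y\<in>topspace (cube k). H (1,y) = f (chart n N b S y)) \<and> (\<forall>s\<in>{0..1}. \<forall>y\<in>cube_bdry k. H (s,y) = g (chart n N b S y)) \<and>
    (\<forall>s\<in>{0..1}. \<forall>y\<in>topspace (cube k). H (s,y) \<in> U)"
        by (rule contracts_homotopy[OF U(2) cgc _ cfc]) (use ch cellV eq[OF chart_bdry_skel[OF c(2) N]] in auto)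
      then obtain H where "continuous_map (prod_topology unit_interval (cube k)) T H" "\<forall>y\<in>topspace (cube k). H (0,y) = g (chart n N b S y)"
        "\<forall>y\<in>topspace (cube k). H (1,y) = f (chart n N b S y)" "\<forall>s\<in>{0..1}. \<forall>y\<in>cube_bdry k. H (s,y) = g (chart n N b S y)"
        "\<forall>s\<in>{0..1}. \<forall>y\<in>topspace (cube k). H (s,y) \<in> U" by (elim exE conjE) (rule that)
      moreover have "\<forall>t\<in>cell n N b S. f t \<in> U" using cellV VU by blast
      ultimately have "?P c U H" using U(1) False unfolding c(1) by auto
      then show ?thesis by blast
    qed
  qed
  from bchoice[OF this] obtain U where "\<forall>c\<in>cells n N k. \<exists>h. ?P c (U c) h" by (rule exE) (rule that)
  from bchoice[OF this] obtain h where Uh: "\<forall>c\<in>cells n N k. ?P c (U c) (h c)" by (rule exE) (rule that)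
  have hD: "U (b,S) \<in> \<U>" "continuous_map (prod_topology unit_interval (cube k)) T (h (b,S))"
    "\<And>y. y \<in> topspace (cube k) \<Longrightarrow> h (b,S) (0,y) = g (chart n N b S y)"
    "\<And>y. y \<in> topspace (cube k) \<Longrightarrow> h (b,S) (1,y) = f (chart n N b S y)"
    "\<And>s y. \<lbrakk>0 \<le> s; s \<le> 1; y \<in> cube_bdry k\<rbrakk> \<Longrightarrow> h (b,S) (s,y) = g (chart n N b S y)"
    "\<And>s y. \<lbrakk>0 \<le> s; s \<le> 1; y \<in> topspace (cube k)\<rbrakk> \<Longrightarrow> h (b,S) (s,y) \<in> U (b,S)"
    "\<And>t. t \<in> cell n N b S \<Longrightarrow> f t \<in> U (b,S)"
    "\<And>s y. \<lbrakk>\<And>t. t \<in> cell n N b S \<Longrightarrow> f t = g t; 0 \<le> s; s \<le> 1; y \<in> topspace (cube k)\<rbrakk> \<Longrightarrow> h (b,S) (s,y) = g (chart n N b S y)"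
    if "(b,S) \<in> cells n N k" for b S
    using bspec[OF Uh that] by auto
  obtain G where G: "continuous_map (prod_topology unit_interval (subtopology (cube n) (skel n N (Suc k)))) T G"
    and Gc: "\<And>b S s t. \<lbrakk>(b,S) \<in> cells n N k; t \<in> cell n N b S; 0 \<le> s; s \<le> 1\<rbrakk> \<Longrightarrow> G (s,t) = h (b,S) (s, unchart N b S t)"
  proof (rule cell_homotopies_paste[OF N k, where Y = T and H = "\<lambda>b S. h (b,S)" and f = g])
    show "continuous_map (prod_topology unit_interval (cube k)) T (h (b,S))" if "(b,S) \<in> cells n N k" for b S
      by (rule hD(2)[OF that])
    show "h (b,S) (s,y) = g (chart n N b S y)"
      if "(b,S) \<in> cells n N k" "0 \<le> s" "s \<le> 1" "y \<in> cube_bdry k" for b S s y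
      by (rule hD(5)[OF that])
  qed (rule that)
  have cover: "\<exists>b S. (b,S) \<in> cells n N k \<and> t \<in> cell n N b S" if "t \<in> skel n N (Suc k)" for t
    using that unfolding skel_Suc_eq[OF k N] by blast
  have G0: "G (0,t) = g t" if t: "t \<in> skel n N (Suc k)" for t
  proof -
    obtain b S where c: "(b,S) \<in> cells n N k" "t \<in> cell n N b S" using cover[OF t] by blast
    show ?thesis using Gc[OF c, of 0] hD(3)[OF c(1) unchart_in_cube[OF c]] chart_unchart[OF c(1) N c(2)] by simp
  qed
  let ?\<psi> = "collapse_grid n N"
  obtain F where F: "continuous_map ?Z T F"
    "\<And>t. t \<in> topspace (cube n) \<Longrightarrow> F (0,t) = g t"
    "\<And>t. t \<in> skel n N (Suc k) \<Longrightarrow> F (1,t) = G (1, ?\<psi> t)"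
    "\<And>s t. \<lbrakk>0 \<le> s; s \<le> 1; t \<in> topspace (cube n)\<rbrakk> \<Longrightarrow> \<exists>t'. near n N t t' \<and>
       (F (s,t) = g t' \<or> t' \<in> skel n N (Suc k) \<and> (\<exists>s'. 0 \<le> s' \<and> s' \<le> 1 \<and> F (s,t) = G (s',t')))"
    by (rule skel_homotopy_extension[OF N cg G], erule G0, rule that)
  have n\<psi>: "near n N t (?\<psi> t)" if "t \<in> topspace (cube n)" for t by (rule gridmap_near[OF stepfun_collapse N that])
  have c\<psi>: "continuous_map (cube n) (cube n) ?\<psi>" by (rule continuous_map_gridmap[OF stepfun_collapse N])
  \<comment> \<open>On the skeleton the extension ends at \<open>f\<close> after the collapse. So
    \<open>f\<close> has to be collapsed as well, which changes it by a relative homotopy.\<close>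
  have 1: "rel_htpc T x n f (\<lambda>t. f (?\<psi> t))"
  proof -
    have "f (\<lambda>i\<in>{..<n}. (1 - s) * id t i + s * ?\<psi> t i) = x" if "0 \<le> s" "s \<le> 1" "t \<in> cube_bdry n" for s t
    proof -
      have tt: "t \<in> topspace (cube n)" by (rule cube_bdry_topspace[OF that(3)])
      show ?thesis unfolding id_apply
        by (rule based_map_bdry[OF f near_bdry[OF near_convex[OF near_refl[OF tt] n\<psi>[OF tt] that(1,2)] that(3) N]])
    qed
    with rel_htpc_reparam[OF f continuous_map_id c\<psi>] have "rel_htpc T x n (f \<circ> id) (f \<circ> ?\<psi>)" by blast
    then show ?thesis by (simp add: o_def)
  qed
  have Fbd: "F (s,t) = x" if s: "0 \<le> s" "s \<le> 1" and t: "t \<in> cube_bdry n" for s t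
  proof -
    obtain t' where t': "near n N t t'"
      "F (s,t) = g t' \<or> t' \<in> skel n N (Suc k) \<and> (\<exists>s'. 0 \<le> s' \<and> s' \<le> 1 \<and> F (s,t) = G (s',t'))"
      using F(4)[OF s cube_bdry_topspace[OF t]] by blast
    have tb: "t' \<in> cube_bdry n" by (rule near_bdry[OF t'(1) t N])
    have gx: "g t' = x" by (rule based_map_bdry[OF g tb])
    show ?thesis using t'(2)
    proof (elim disjE conjE exE)
      assume "F (s,t) = g t'" then show ?thesis using gx by simp
    next
      fix s' assume *: "t' \<in> skel n N (Suc k)" "0 \<le> s'" "s' \<le> 1" "F (s,t) = G (s',t')"
      obtain b S where c: "(b,S) \<in> cells n N k" "t' \<in> cell n N b S" using cover[OF *(1)] by blast
      have e: "F (s,t) = h (b,S) (s', unchart N b S t')" using *(4) Gc[OF c *(2,3)] by simp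
      \<comment> \<open>In the lower skeleton the cell homotopy is stationary; otherwise the whole
        cell lies in the boundary of the cube, where \<open>f\<close> and \<open>g\<close> coincide
        and the stationary homotopy was chosen.\<close>
      have "h (b,S) (s', unchart N b S t') = g (chart n N b S (unchart N b S t'))"
      proof (cases "t' \<in> skel n N k")
        case True
        show ?thesis by (rule hD(5)[OF c(1) *(2,3) unchart_skel_bdry[OF c True]])
      next
        case False
        have "f u = g u" if "u \<in> cell n N b S" for u
        proof -
          have "u \<in> cube_bdry n" using cell_subset_bdry[OF c(1) N c(2) tb False] that by blast
          then show ?thesis using based_map_bdry[OF f] based_map_bdry[OF g] by simp
        qed
        from hD(8)[OF c(1) this *(2,3) unchart_in_cube[OF c]] show ?thesis .
      qed
      then show ?thesis using e gx chart_unchart[OF c(1) N c(2)] by simp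
    qed
  qed
  have 2: "rel_htpc T x n g (\<lambda>t. F (1,t))" by (rule rel_htpcI[OF F(1,2) refl Fbd])
  have 3: "f (?\<psi> t) = F (1,t)" if t: "t \<in> skel n N (Suc k)" for t
  proof -
    have "t \<in> topspace (cube n)" using t by (simp add: skel_def)
    then have "?\<psi> t \<in> skel n N (Suc k)" using near_skel[OF n\<psi> t] by blast
    then obtain b S where c: "(b,S) \<in> cells n N k" "?\<psi> t \<in> cell n N b S" using cover by blast
    show ?thesis using F(3)[OF t] Gc[OF c, of 1] hD(4)[OF c(1) unchart_in_cube[OF c]] chart_unchart[OF c(1) N c(2)] by simp
  qed
  have "grid_close n N \<W> (\<lambda>t. f (?\<psi> t)) (\<lambda>t. F (1,t))"
    unfolding grid_close_def
  proof
    fix a assume a: "a \<in> PiE {..<n} (\<lambda>_. {..<N})"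
    obtain V where V: "V \<in> \<V>" "\<forall>t\<in>gcube n N a. f t \<in> V \<and> g t \<in> V" using bspec[OF close[unfolded grid_close_def] a] by blast
    obtain Ua where Ua: "Ua \<in> \<U>" "contracts T V Ua" using contr[OF V(1)] by blast
    have VU: "V \<subseteq> Ua" using Ua(2) by (simp add: contracts_def)
    \<comment> \<open>The least corner of the grid cube: it witnesses that \<open>Ua\<close> is
      nonempty, as the star condition asks.\<close>
    let ?t0 = "\<lambda>i\<in>{..<n}. real (a i) / N"
    have "real (a i) < real N" if "i < n" for i using a that by auto
    then have "?t0 \<in> gcube n N a" using N by (auto simp: cell_def topspace_cube less_imp_le)
    then have f0: "f ?t0 \<in> Ua" using V(2) VU by blast
    obtain W where W: "W \<in> \<W>" "\<forall>U'\<in>\<U>. U' \<inter> Ua \<noteq> {} \<longrightarrow> U' \<subseteq> W" using star[OF Ua(1) f0] by (rule bexE) (rule that)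
    have UaW: "Ua \<subseteq> W" using W(2) Ua(1) f0 by blast
    have "f (?\<psi> t) \<in> W \<and> F (1,t) \<in> W" if t: "t \<in> gcube n N a" for t
    proof
      have tt: "t \<in> topspace (cube n)" using t by (simp add: cell_def)
      show "f (?\<psi> t) \<in> W" using near_cell[OF n\<psi>[OF tt] t] V(2) VU UaW by blast
      obtain t' where t': "near n N t t'"
        "F (1,t) = g t' \<or> t' \<in> skel n N (Suc k) \<and> (\<exists>s'. 0 \<le> s' \<and> s' \<le> 1 \<and> F (1,t) = G (s',t'))"
        using F(4)[OF zero_le_one order_refl tt] by blast
      have tg: "t' \<in> gcube n N a" by (rule near_cell[OF t'(1) t])
      show "F (1,t) \<in> W" using t'(2)
      proof (elim disjE conjE exE)
        assume "F (1,t) = g t'" then show ?thesis using tg V(2) VU UaW by auto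
      next
        fix s' assume *: "t' \<in> skel n N (Suc k)" "0 \<le> s'" "s' \<le> 1" "F (1,t) = G (s',t')"
        obtain b S where c: "(b,S) \<in> cells n N k" "t' \<in> cell n N b S" and sub: "cell n N b S \<subseteq> gcube n N a"
          using skel_cell_in_gcube[OF tg *(1) k a] by blast
        have "F (1,t) \<in> U (b,S)" using *(4) Gc[OF c *(2,3)] hD(6)[OF c(1) *(2,3) unchart_in_cube[OF c]] by simp
        moreover have "U (b,S) \<inter> Ua \<noteq> {}" using hD(7)[OF c] V(2) tg VU by blast
        ultimately show ?thesis using bspec[OF W(2) hD(1)[OF c(1)]] by blast
      qed
    qed
    then show "\<exists>V\<in>\<W>. \<forall>t\<in>gcube n N a. f (?\<psi> t) \<in> V \<and> F (1,t) \<in> V" using W(1) by blast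
  qed
  then show ?thesis using 1 2 3
    by (intro exI[of _ "\<lambda>t. f (?\<psi> t)"] exI[of _ "\<lambda>t. F (1,t)"] conjI ballI)
qed

text \<open>Downward induction on \<open>k\<close>, starting where the two maps agree on the whole
  cube. The cover is fixed before the grid and the maps; it has to be so fine that one
  \<open>grid_close_step\<close> leads to closeness with respect to the cover for
  \<open>Suc k\<close>.\<close>

lemma grid_close_rel_htpc:
  assumes T: "compact_space T" "Hausdorff_space T" and wp: "\<And>z. z \<in> topspace T \<Longrightarrow> well_pointed T z" and k: "k \<le> Suc n"
  shows "\<exists>\<V>. open_cover T \<V> \<and> (\<forall>N f g. 0 < N \<and> based_map T x n f \<and> based_map T x n g \<and>
      (\<forall>t\<in>skel n N k. f t = g t) \<and> grid_close n N \<V> f g \<longrightarrow> rel_htpc T x n f g)"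
  using k
proof (induction k rule: inc_induct)
  case base
  have "rel_htpc T x n f g" if "based_map T x n f" "\<forall>t\<in>skel n N (Suc n). f t = g t" for N f g
    by (rule rel_htpc_equal[OF that(1)]) (use that(2) skel_full[of n "Suc n" N] in simp)
  moreover have "open_cover T {topspace T}" by (simp add: open_cover_def)
  ultimately show ?case by blast
next
  case (step k)
  obtain \<W> where W: "open_cover T \<W>" "\<And>N f g. \<lbrakk>0 < N; based_map T x n f; based_map T x n g;
      \<forall>t\<in>skel n N (Suc k). f t = g t; grid_close n N \<W> f g\<rbrakk> \<Longrightarrow> rel_htpc T x n f g"
    using step.IH by (elim exE conjE) (rule that, assumption, blast)
  obtain \<U> where U: "open_cover T \<U>" "\<And>U p. \<lbrakk>U \<in> \<U>; p \<in> U\<rbrakk> \<Longrightarrow> \<exists>W\<in>\<W>. \<forall>U'\<in>\<U>. U' \<inter> U \<noteq> {} \<longrightarrow> U' \<subseteq> W"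
    using star_refinement[OF T W(1)] by (elim exE conjE) (rule that, assumption, blast)
  let ?V = "{V. openin T V \<and> (\<exists>U\<in>\<U>. contracts T V U)}"
  have "\<exists>V\<in>?V. z \<in> V" if z: "z \<in> topspace T" for z
  proof -
    obtain U where "U \<in> \<U>" "z \<in> U" "openin T U" using U(1) z unfolding open_cover_def by blast
    then show ?thesis using well_pointed_contracts[OF wp[OF z]] by blast
  qed
  then have "open_cover T ?V" unfolding open_cover_def by blast
  moreover have "rel_htpc T x n f g" if *: "0 < N" "based_map T x n f" "based_map T x n g"
    "\<forall>t\<in>skel n N k. f t = g t" "grid_close n N ?V f g" for N f g
  proof -
    have "\<exists>f' g'. rel_htpc T x n f f' \<and> rel_htpc T x n g g' \<and> (\<forall>t\<in>skel n N (Suc k). f' t = g' t) \<and> grid_close n N \<W> f' g'"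
      by (rule grid_close_step[OF U(2) _ *(1) _ *(2,3) _ *(5)]) (use step.hyps *(4) in auto)
    then obtain f' g' where fg: "rel_htpc T x n f f'" "rel_htpc T x n g g'" "\<forall>t\<in>skel n N (Suc k). f' t = g' t" "grid_close n N \<W> f' g'"
      by blast
    have e: "rel_htpc T x n f' g'"
      by (rule W(2)[OF *(1) rel_htpc_imp_based_map(2)[OF fg(1)] rel_htpc_imp_based_map(2)[OF fg(2)] fg(3,4)])
    show ?thesis by (rule rel_htpc_trans[OF fg(1) rel_htpc_trans[OF e rel_htpc_sym[OF fg(2)]]])
  qed
  ultimately show ?case by (intro exI[of _ ?V]) blast
qed

text \<open>Closeness takes the form of finitely many inclusions of images of compact sets in open
  sets, so it describes a neighbourhood of \<open>f\<close> in the compact-open topology.\<close>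

theorem rel_htpc_if_close:
  assumes T: "compact_space T" "Hausdorff_space T" and wp: "\<And>z. z \<in> topspace T \<Longrightarrow> well_pointed T z"
    and f: "based_map T x n f"
  shows "\<exists>N V. (\<forall>a\<in>PiE {..<n} (\<lambda>_. {..<N}). openin T (V a) \<and> f ` gcube n N a \<subseteq> V a) \<and>
    (\<forall>g. based_map T x n g \<and> (\<forall>a\<in>PiE {..<n} (\<lambda>_. {..<N}). g ` gcube n N a \<subseteq> V a) \<longrightarrow> rel_htpc T x n f g)"
proof -
  have "\<exists>\<V>. open_cover T \<V> \<and> (\<forall>N f g. 0 < N \<and> based_map T x n f \<and> based_map T x n g \<and>
      (\<forall>t\<in>skel n N 0. f t = g t) \<and> grid_close n N \<V> f g \<longrightarrow> rel_htpc T x n f g)"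
    by (rule grid_close_rel_htpc[OF T]) (simp_all add: wp)
  then obtain \<V> where V: "open_cover T \<V>" "\<And>N f g. \<lbrakk>0 < N; based_map T x n f; based_map T x n g;
      \<forall>t\<in>skel n N 0. f t = g t; grid_close n N \<V> f g\<rbrakk> \<Longrightarrow> rel_htpc T x n f g"
    by (elim exE conjE) (rule that, assumption, blast)
  have cf: "continuous_map (cube n) T f" using f by (simp add: based_map_def)
  let ?C = "(\<lambda>V. {t \<in> topspace (cube n). f t \<in> V}) ` \<V>"
  have "openin (cube n) C" if "C \<in> ?C" for C
    using that V(1) openin_continuous_map_preimage[OF cf] unfolding open_cover_def by blast
  moreover have "topspace (cube n) \<subseteq> \<Union>?C"
  proof
    fix t assume t: "t \<in> topspace (cube n)"
    then obtain V where "V \<in> \<V>" "f t \<in> V"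
      using V(1) continuous_map_in_topspace[OF cf t] unfolding open_cover_def by blast
    then show "t \<in> \<Union>?C" using t by blast
  qed
  ultimately have "\<exists>N>0. \<forall>a. \<exists>C\<in>?C. gcube n N a \<subseteq> C" by (rule Lebesgue_grid)
  then obtain N where N: "0 < N" "\<forall>a. \<exists>C\<in>?C. gcube n N a \<subseteq> C" by (elim exE conjE) (rule that)
  have "\<forall>a. \<exists>V\<in>\<V>. f ` gcube n N a \<subseteq> V"
  proof
    fix a
    obtain V where "V \<in> \<V>" "gcube n N a \<subseteq> {t \<in> topspace (cube n). f t \<in> V}" using spec[OF N(2), of a] by blast
    then show "\<exists>V\<in>\<V>. f ` gcube n N a \<subseteq> V" by blast
  qed
  then obtain Va where Va: "\<And>a. Va a \<in> \<V>" "\<And>a. f ` gcube n N a \<subseteq> Va a" by metis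
  have "rel_htpc T x n f g" if g: "based_map T x n g" "\<forall>a\<in>PiE {..<n} (\<lambda>_. {..<N}). g ` gcube n N a \<subseteq> Va a" for g
  proof (rule V(2)[OF N(1) f g(1)])
    show "\<forall>t\<in>skel n N 0. f t = g t" by (simp add: skel_def)
    show "grid_close n N \<V> f g" unfolding grid_close_def
    proof
      fix a assume a: "a \<in> PiE {..<n} (\<lambda>_. {..<N})"
      have "\<forall>t\<in>gcube n N a. f t \<in> Va a \<and> g t \<in> Va a" using Va(2)[of a] bspec[OF g(2) a] by blast
      then show "\<exists>V\<in>\<V>. \<forall>t\<in>gcube n N a. f t \<in> V \<and> g t \<in> V" by (rule bexI[OF _ Va(1)])
    qed
  qed
  moreover have "openin T (Va a)" for a using Va(1) V(1) unfolding open_cover_def by blast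
  ultimately show ?thesis by (intro exI[of _ N] exI[of _ Va] conjI ballI allI impI) (simp_all add: Va(2))
qed

section \<open>Homotopy groups and their topology\<close>

lemma openin_quotient_top:
  "openin (quotient_top T B q) U \<longleftrightarrow> U \<subseteq> B \<and> openin T {p \<in> topspace T. q p \<in> U}"
proof -
  have "istopology (\<lambda>U. U \<subseteq> B \<and> openin T {p \<in> topspace T. q p \<in> U})"
    unfolding istopology_def
  proof (intro conjI allI impI)
    fix U V assume UV: "U \<subseteq> B \<and> openin T {p \<in> topspace T. q p \<in> U}" "V \<subseteq> B \<and> openin T {p \<in> topspace T. q p \<in> V}"
    have "{p \<in> topspace T. q p \<in> U \<inter> V} = {p \<in> topspace T. q p \<in> U} \<inter> {p \<in> topspace T. q p \<in> V}" by auto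
    then show "U \<inter> V \<subseteq> B" "openin T {p \<in> topspace T. q p \<in> U \<inter> V}" using UV by auto
  next
    fix \<K> assume K: "\<forall>K\<in>\<K>. K \<subseteq> B \<and> openin T {p \<in> topspace T. q p \<in> K}"
    have "{p \<in> topspace T. q p \<in> \<Union>\<K>} = (\<Union>K\<in>\<K>. {p \<in> topspace T. q p \<in> K})" by auto
    then show "openin T {p \<in> topspace T. q p \<in> \<Union>\<K>}" using K by auto
    show "\<Union>\<K> \<subseteq> B" using K by blast
  qed
  then show ?thesis by (simp add: quotient_top_def)
qed

lemma topspace_quotient_top:
  assumes "q ` topspace T \<subseteq> B" shows "topspace (quotient_top T B q) = B"
proof (rule antisym)
  show "topspace (quotient_top T B q) \<subseteq> B" using openin_quotient_top[of T B q] openin_topspace by blast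
  have "{p \<in> topspace T. q p \<in> B} = topspace T" using assms by auto
  then have "openin (quotient_top T B q) B" by (simp add: openin_quotient_top)
  then show "B \<subseteq> topspace (quotient_top T B q)" by (rule openin_subset)
qed

lemma Omega_based_map: "f \<in> Omega T x n \<Longrightarrow> based_map T x n f"
  by (simp add: Omega_def based_map_def)

lemma restrict_Omega: "based_map T x n f \<Longrightarrow> restrict f (topspace (cube n)) \<in> Omega T x n"
  using based_map_eq[of T x n f "restrict f (topspace (cube n))"] by (simp add: Omega_def based_map_def)

lemma rel_htpc_restrict: "based_map T x n f \<Longrightarrow> rel_htpc T x n f (restrict f (topspace (cube n)))"
  by (rule rel_htpc_equal) auto

lemma hclass_cong: "rel_htpc T x n f g \<Longrightarrow> hclass T x n f = hclass T x n g"
  unfolding hclass_def by (blast intro: rel_htpc_trans rel_htpc_sym)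

lemma hclass_eq_iff:
  assumes "based_map T x n f" "based_map T x n g"
  shows "hclass T x n f = hclass T x n g \<longleftrightarrow> rel_htpc T x n f g"
proof
  assume e: "hclass T x n f = hclass T x n g"
  have "restrict f (topspace (cube n)) \<in> hclass T x n f"
    using restrict_Omega[OF assms(1)] rel_htpc_restrict[OF assms(1)] by (simp add: hclass_def)
  then have "rel_htpc T x n g (restrict f (topspace (cube n)))" unfolding e by (simp add: hclass_def)
  then show "rel_htpc T x n f g" by (rule rel_htpc_trans[OF rel_htpc_restrict[OF assms(1)] rel_htpc_sym])
qed (rule hclass_cong)

lemma hclass_in_pi_set: "based_map T x n f \<Longrightarrow> hclass T x n f \<in> pi_set T x n"
  unfolding pi_set_def
  by (rule image_eqI[where f = "hclass T x n" and x = "restrict f (topspace (cube n))"])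
     (simp_all add: hclass_cong[OF rel_htpc_restrict] restrict_Omega)

lemma pi_setE:
  assumes "a \<in> pi_set T x n" obtains f where "f \<in> Omega T x n" "a = hclass T x n f"
  using assms by (auto simp: pi_set_def)

lemma representative:
  assumes "a \<in> pi_set T x n"
  shows "based_map T x n (SOME f. f \<in> a)" "hclass T x n (SOME f. f \<in> a) = a"
proof -
  obtain f where f: "f \<in> Omega T x n" "a = hclass T x n f" using assms by (rule pi_setE)
  then have "f \<in> a" using rel_htpc_refl[OF Omega_based_map] by (simp add: hclass_def)
  then have "(SOME f. f \<in> a) \<in> a" by (rule someI[of "\<lambda>f. f \<in> a"])
  then have g: "(SOME f. f \<in> a) \<in> Omega T x n" "rel_htpc T x n f (SOME f. f \<in> a)" unfolding f(2) by (auto simp: hclass_def)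
  show "based_map T x n (SOME f. f \<in> a)" by (rule Omega_based_map[OF g(1)])
  show "hclass T x n (SOME f. f \<in> a) = a" using hclass_cong[OF g(2)] f(2) by simp
qed

lemma representative_hclass:
  assumes "based_map T x n f" shows "rel_htpc T x n (SOME g. g \<in> hclass T x n f) f"
  using hclass_eq_iff[OF representative(1)[OF hclass_in_pi_set[OF assms]] assms] representative(2)[OF hclass_in_pi_set[OF assms]] by simp

lemma pi_mult_hclass:
  assumes "based_map T x n f" "based_map T x n g" "0 < n"
  shows "pi_mult T x n (hclass T x n f) (hclass T x n g) = hclass T x n (concat f g)"
  unfolding pi_mult_def by (intro hclass_cong rel_htpc_concat representative_hclass assms)

lemma pi_inv_hclass:
  assumes "based_map T x n f" "0 < n"
  shows "pi_inv T x n (hclass T x n f) = hclass T x n (reverse f)"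
  unfolding pi_inv_def by (intro hclass_cong rel_htpc_reverse representative_hclass assms)

lemma induced_hclass:
  assumes "based_map T x n f" "continuous_map T S h" "h x = y"
  shows "induced S y n h (hclass T x n f) = hclass S y n (h \<circ> f)"
  unfolding induced_def by (intro hclass_cong rel_htpc_compose_left[OF representative_hclass[OF assms(1)] assms(2,3)])

lemma induced_pi_mult:
  assumes "a \<in> pi_set T x n" "b \<in> pi_set T x n" "0 < n" "continuous_map T S h" "h x = y"
  shows "induced S y n h (pi_mult T x n a b) = pi_mult S y n (induced S y n h a) (induced S y n h b)"
proof -
  obtain f where f: "f \<in> Omega T x n" "a = hclass T x n f" using assms(1) by (rule pi_setE)
  obtain g where g: "g \<in> Omega T x n" "b = hclass T x n g" using assms(2) by (rule pi_setE)
  note bf = Omega_based_map[OF f(1)] and bg = Omega_based_map[OF g(1)]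
  have "h \<circ> concat f g = concat (h \<circ> f) (h \<circ> g)" by (auto simp: concat_def fun_eq_iff)
  then show ?thesis
    using bf bg assms(3)
    by (simp add: f g pi_mult_hclass induced_hclass[OF _ assms(4,5)] based_map_concat based_map_compose_left[OF _ assms(4,5)])
qed

lemma induced_pi_inv:
  assumes "a \<in> pi_set T x n" "0 < n" "continuous_map T S h" "h x = y"
  shows "induced S y n h (pi_inv T x n a) = pi_inv S y n (induced S y n h a)"
proof -
  obtain f where f: "f \<in> Omega T x n" "a = hclass T x n f" using assms(1) by (rule pi_setE)
  note bf = Omega_based_map[OF f(1)]
  have "h \<circ> reverse f = reverse (h \<circ> f)" by (auto simp: reverse_def fun_eq_iff)
  then show ?thesis
    using bf assms(2)
    by (simp add: f pi_inv_hclass induced_hclass[OF _ assms(3,4)] based_map_reverse based_map_compose_left[OF _ assms(3,4)])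
qed

lemma pi_set_group:
  assumes n: "0 < n" and x: "x \<in> topspace T"
  shows "pi_one T x n \<in> pi_set T x n"
    "\<And>a b. \<lbrakk>a \<in> pi_set T x n; b \<in> pi_set T x n\<rbrakk> \<Longrightarrow> pi_mult T x n a b \<in> pi_set T x n"
    "\<And>a. a \<in> pi_set T x n \<Longrightarrow> pi_inv T x n a \<in> pi_set T x n"
    "\<And>a b c. \<lbrakk>a \<in> pi_set T x n; b \<in> pi_set T x n; c \<in> pi_set T x n\<rbrakk> \<Longrightarrow>
       pi_mult T x n (pi_mult T x n a b) c = pi_mult T x n a (pi_mult T x n b c)"
    "\<And>a. a \<in> pi_set T x n \<Longrightarrow> pi_mult T x n (pi_one T x n) a = a \<and> pi_mult T x n a (pi_one T x n) = a"
    "\<And>a. a \<in> pi_set T x n \<Longrightarrow> pi_mult T x n (pi_inv T x n a) a = pi_one T x n \<and> pi_mult T x n a (pi_inv T x n a) = pi_one T x n"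
proof -
  have c: "based_map T x n (\<lambda>_. x)" by (rule based_map_const[OF x])
  show "pi_one T x n \<in> pi_set T x n" unfolding pi_one_def by (rule hclass_in_pi_set[OF c])
  fix a assume "a \<in> pi_set T x n"
  then obtain f where "f \<in> Omega T x n" and a: "a = hclass T x n f" by (rule pi_setE)
  then have f: "based_map T x n f" by (simp add: Omega_based_map)
  show "pi_inv T x n a \<in> pi_set T x n"
    unfolding a pi_inv_hclass[OF f n] by (rule hclass_in_pi_set[OF based_map_reverse[OF f n]])
  show "pi_mult T x n (pi_one T x n) a = a \<and> pi_mult T x n a (pi_one T x n) = a"
    unfolding a pi_one_def pi_mult_hclass[OF f c n] pi_mult_hclass[OF c f n]
    by (simp only: hclass_cong[OF rel_htpc_concat_const(1)[OF f n]] hclass_cong[OF rel_htpc_concat_const(2)[OF f n]] simp_thms)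
  show "pi_mult T x n (pi_inv T x n a) a = pi_one T x n \<and> pi_mult T x n a (pi_inv T x n a) = pi_one T x n"
    unfolding a pi_one_def pi_inv_hclass[OF f n] pi_mult_hclass[OF f based_map_reverse[OF f n] n] pi_mult_hclass[OF based_map_reverse[OF f n] f n]
    by (simp only: hclass_cong[OF rel_htpc_concat_reverse_left[OF f n]] hclass_cong[OF rel_htpc_concat_reverse_right[OF f n]] simp_thms)
  fix b assume "b \<in> pi_set T x n"
  then obtain g where "g \<in> Omega T x n" and b: "b = hclass T x n g" by (rule pi_setE)
  then have g: "based_map T x n g" by (simp add: Omega_based_map)
  show "pi_mult T x n a b \<in> pi_set T x n"
    unfolding a b pi_mult_hclass[OF f g n] by (rule hclass_in_pi_set[OF based_map_concat[OF f g n]])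
  fix c assume "c \<in> pi_set T x n"
  then obtain h where "h \<in> Omega T x n" and c: "c = hclass T x n h" by (rule pi_setE)
  then have h: "based_map T x n h" by (simp add: Omega_based_map)
  show "pi_mult T x n (pi_mult T x n a b) c = pi_mult T x n a (pi_mult T x n b c)"
    unfolding a b c pi_mult_hclass[OF f g n] pi_mult_hclass[OF g h n]
      pi_mult_hclass[OF based_map_concat[OF f g n] h n] pi_mult_hclass[OF f based_map_concat[OF g h n] n]
    by (rule hclass_cong[OF rel_htpc_concat_assoc[OF f g h n]])
qed

section \<open>The compact-open topology and its quotient\<close>

lemma topspace_compact_open: "topspace (compact_open S T) = {f. f \<in> extensional (topspace S) \<and> continuous_map S T f}"
proof -
  have "{f. f \<in> extensional (topspace S) \<and> continuous_map S T f} \<in> {{f. f \<in> extensional (topspace S) \<and> continuous_map S T f \<and> f ` K \<subseteq> U} | K U.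
         compactin S K \<and> openin T U}"
    \<comment> \<open>With \<open>K\<close> and \<open>U\<close> empty the subbasic set is the whole
      function space.\<close>
    by (rule CollectI, intro exI[of _ "{}"] exI[of _ "{}"]) auto
  then show ?thesis unfolding compact_open_def topspace_subtopology topology_generated_by_topspace by blast
qed

lemma topspace_Omega: "topspace (subtopology (compact_open (cube n) T) (Omega T x n)) = Omega T x n"
  by (auto simp: topspace_compact_open Omega_def)

lemma openin_Omega_subbasis:
  assumes "compactin (cube n) K" "openin T U"
  shows "openin (subtopology (compact_open (cube n) T) (Omega T x n)) {f \<in> Omega T x n. f ` K \<subseteq> U}"
proof -
  let ?S = "{f. f \<in> extensional (topspace (cube n)) \<and> continuous_map (cube n) T f \<and> f ` K \<subseteq> U}"
  let ?\<S> = "{{f. f \<in> extensional (topspace (cube n)) \<and> continuous_map (cube n) T f \<and> f ` K \<subseteq> U} | K U.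
         compactin (cube n) K \<and> openin T U}"
  have "?S \<in> ?\<S>" using assms by blast
  from topology_generated_by_Basis[OF this]
  have "openin (compact_open (cube n) T) ({f. f \<in> extensional (topspace (cube n)) \<and> continuous_map (cube n) T f} \<inter> ?S)"
    unfolding compact_open_def by (rule openin_subtopology_Int2)
  then have "openin (subtopology (compact_open (cube n) T) (Omega T x n)) (Omega T x n \<inter> ({f. f \<in> extensional (topspace (cube n)) \<and> continuous_map (cube n) T f} \<inter> ?S))"
    by (rule openin_subtopology_Int2)
  moreover have "Omega T x n \<inter> ({f. f \<in> extensional (topspace (cube n)) \<and> continuous_map (cube n) T f} \<inter> ?S) = {f \<in> Omega T x n. f ` K \<subseteq> U}"
    by (auto simp: Omega_def)
  ultimately show ?thesis by simp
qed

lemma topspace_pi_top: "topspace (pi_top T x n) = pi_set T x n"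
  unfolding pi_top_def by (rule topspace_quotient_top) (simp only: topspace_Omega pi_set_def order_refl)

lemma openin_pi_top:
  "openin (pi_top T x n) U \<longleftrightarrow> U \<subseteq> pi_set T x n \<and>
     openin (subtopology (compact_open (cube n) T) (Omega T x n)) {f \<in> Omega T x n. hclass T x n f \<in> U}"
  unfolding pi_top_def openin_quotient_top topspace_Omega ..

context pointed_family
begin

lemma Hausdorff_coord_wedge: "Hausdorff_space (coord_wedge Xs xb J)"
  unfolding coord_wedge_def by (intro Hausdorff_space_subtopology) (simp add: Hausdorff_space_product_topology haus)

lemma wedge_set_eq: "wedge_set Xs xb i = topspace (coord_wedge Xs xb {..i})"
proof (rule set_eqI)
  fix p
  have "p j \<in> topspace (Xs j)" if "\<forall>j\<le>i. p j \<in> topspace (Xs j)" "\<forall>j>i. p j = xb j" for j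
    using that base[of j] by (cases "j \<le> i") auto
  then show "p \<in> wedge_set Xs xb i \<longleftrightarrow> p \<in> topspace (coord_wedge Xs xb {..i})"
    unfolding wedge_set_def topspace_coord_wedge mem_Collect_eq atMost_iff not_le by blast
qed

text \<open>The quotient topology on the finite wedge is the subspace topology of the product, because a continuous
  bijection from a compact space to a Hausdorff space is a homeomorphism.\<close>

lemma wedge_eq_coord_wedge:
  assumes comp: "\<And>j. compact_space (Xs j)"
  shows "wedge Xs xb i = coord_wedge Xs xb {..i}"
proof -
  let ?S = "sum_topology Xs {..i}" and ?Y = "coord_wedge Xs xb {..i}"
  have inY: "wedge_incl xb (k,y) \<in> topspace ?Y" if "k \<le> i" "y \<in> topspace (Xs k)" for k y
    unfolding topspace_coord_wedge wedge_incl_def using that base by auto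
  have c: "continuous_map (Xs k) ?Y (\<lambda>y. wedge_incl xb (k,y))" if "k \<le> i" for k
  proof (rule continuous_map_coord_wedgeI[OF _ inY[OF that]])
    show "continuous_map (Xs k) (Xs j) (\<lambda>y. wedge_incl xb (k,y) j)" for j
      using base by (cases "j = k") (simp_all add: wedge_incl_def)
  qed
  have cont: "continuous_map ?S ?Y (wedge_incl xb)"
    unfolding continuous_map_def
  proof (intro conjI allI impI)
    show "wedge_incl xb \<in> topspace ?S \<rightarrow> topspace ?Y" using inY by auto
    fix U assume U: "openin ?Y U"
    have "openin (Xs k) {y. (k,y) \<in> {z \<in> topspace ?S. wedge_incl xb z \<in> U}}" if k: "k \<in> {..i}" for k
      using openin_continuous_map_preimage[OF c U, of k] k by simp
    then show "openin ?S {z \<in> topspace ?S. wedge_incl xb z \<in> U}" unfolding openin_sum_topology by auto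
  qed
  have "compactin ?S (\<Union>k\<in>{..i}. Pair k ` topspace (Xs k))"
  proof (rule compactin_Union)
    fix K assume "K \<in> (\<lambda>k. Pair k ` topspace (Xs k)) ` {..i}"
    then obtain k where k: "k \<in> {..i}" "K = Pair k ` topspace (Xs k)" by blast
    show "compactin ?S K" unfolding k(2)
      by (rule image_compactin[OF comp[unfolded compact_space_def] continuous_map_component_injection[OF k(1)]])
  qed simp
  moreover have "(\<Union>k\<in>{..i}. Pair k ` topspace (Xs k)) = topspace ?S" by auto
  ultimately have comp': "compact_space ?S" by (simp add: compact_space_def)
  have surj: "wedge_incl xb ` topspace ?S = topspace ?Y"
  proof (rule antisym)
    show "wedge_incl xb ` topspace ?S \<subseteq> topspace ?Y" using inY by auto
    show "topspace ?Y \<subseteq> wedge_incl xb ` topspace ?S"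
    proof
      fix p assume "p \<in> topspace ?Y"
      then have p: "\<And>j. p j \<in> topspace (Xs j)" "\<And>j. j \<notin> {..i} \<Longrightarrow> p j = xb j" "\<And>j k. j \<noteq> k \<Longrightarrow> p j = xb j \<or> p k = xb k"
        unfolding topspace_coord_wedge by blast+
      obtain k where k: "k \<le> i" "\<And>j. j \<noteq> k \<Longrightarrow> p j = xb j"
      proof (cases "\<exists>k. p k \<noteq> xb k")
        case True
        then obtain k where k: "p k \<noteq> xb k" by blast
        have "k \<le> i" using p(2)[of k] k by auto
        moreover have "p j = xb j" if "j \<noteq> k" for j using p(3)[OF that] k by simp
        ultimately show thesis by (rule that)
      next
        case False
        \<comment> \<open>The wedge point belongs to every summand; index 0 is one that always
          satisfies \<open>k \<le> i\<close>.\<close>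
        show thesis by (rule that[of 0]) (use False in auto)
      qed
      have "p = wedge_incl xb (k, p k)" using k(2) by (auto simp: wedge_incl_def fun_eq_iff)
      moreover have "(k, p k) \<in> topspace ?S" using k(1) p(1) by simp
      ultimately show "p \<in> wedge_incl xb ` topspace ?S" by (rule image_eqI)
    qed
  qed
  have "quotient_map ?S ?Y (wedge_incl xb)"
    by (rule continuous_imp_quotient_map[OF cont comp' Hausdorff_coord_wedge surj])
  then have q: "\<And>U. U \<subseteq> topspace ?Y \<Longrightarrow> openin ?S {z \<in> topspace ?S. wedge_incl xb z \<in> U} = openin ?Y U"
    by (simp add: quotient_map_def)
  show ?thesis
  proof (rule topology_eq[THEN iffD2], rule allI)
    fix U show "openin (wedge Xs xb i) U = openin ?Y U"
      unfolding wedge_def openin_quotient_top wedge_set_eq using q[of U] openin_subset[of ?Y U] by blast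
  qed
qed

end

section \<open>Hawaiian like spaces\<close>

text \<open>Each point of \<open>C\<close> has a basic box inside \<open>U\<close> that restricts
  finitely many factors. Compactness leaves finitely many boxes and hence one bound \<open>i\<close>
  on the restricted factors.\<close>

lemma compactin_open_generated_coordinates:
  assumes C: "compactin (subtopology (product_topology Y UNIV) S) C" and U: "openin (subtopology (product_topology Y UNIV) S) U" "C \<subseteq> U"
  shows "\<exists>i::nat. \<forall>x\<in>C. \<forall>p\<in>topspace (subtopology (product_topology Y UNIV) S). (\<forall>j\<le>i. p j = x j) \<longrightarrow> p \<in> U"
proof -
  let ?H = "subtopology (product_topology Y UNIV) S"
  have "\<exists>W i. openin ?H W \<and> x \<in> W \<and> (\<forall>y\<in>W. \<forall>p\<in>topspace ?H. (\<forall>j\<le>i. p j = y j) \<longrightarrow> p \<in> U)" if x: "x \<in> C" for x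
  proof -
    obtain U' where U': "openin (product_topology Y UNIV) U'" "U = U' \<inter> S" using U(1) unfolding openin_subtopology by blast
    have xU: "x \<in> U'" "x \<in> S" using x U(2) U'(2) by auto
    obtain O' where O': "finite {j. O' j \<noteq> topspace (Y j)}" "\<And>j. openin (Y j) (O' j)" "x \<in> PiE UNIV O'" "PiE UNIV O' \<subseteq> U'"
      using U'(1) xU(1) unfolding openin_product_topology_alt by (metis (no_types, lifting) Collect_cong UNIV_I)
    obtain i where i: "\<And>j. O' j \<noteq> topspace (Y j) \<Longrightarrow> j \<le> i"
      using O'(1) by (metis (mono_tags, lifting) finite_nat_set_iff_bounded_le mem_Collect_eq)
    have "openin (product_topology Y UNIV) (PiE UNIV O')" using O'(1,2) by (simp add: openin_PiE_gen)
    then have "openin ?H (PiE UNIV O' \<inter> S)" by (rule openin_subtopology_Int)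
    moreover have "p \<in> U" if y: "y \<in> PiE UNIV O' \<inter> S" and p: "p \<in> topspace ?H" "\<forall>j\<le>i. p j = y j" for y p
    proof -
      have "p j \<in> O' j" for j
      proof (cases "j \<le> i")
        case True then show ?thesis using p(2) y by (auto simp: PiE_UNIV_domain)
      next
        case False
        then have "O' j = topspace (Y j)" using i by blast
        then show ?thesis using p(1) by (auto simp: PiE_UNIV_domain)
      qed
      then have "p \<in> PiE UNIV O'" by (simp add: PiE_UNIV_domain)
      then show ?thesis using O'(4) U'(2) p(1) by auto
    qed
    ultimately show ?thesis using O'(3) xU(2) by (intro exI[of _ "PiE UNIV O' \<inter> S"] exI[of _ i]) blast
  qed
  then obtain W i where Wi: "\<And>x. x \<in> C \<Longrightarrow> openin ?H (W x) \<and> x \<in> W x \<and> (\<forall>y\<in>W x. \<forall>p\<in>topspace ?H. (\<forall>j\<le>i x. p j = y j) \<longrightarrow> p \<in> U)"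
    by metis
  have "\<forall>V\<in>W ` C. openin ?H V" "C \<subseteq> \<Union>(W ` C)" using Wi by blast+
  then obtain \<F> where \<F>: "finite \<F>" "\<F> \<subseteq> W ` C" "C \<subseteq> \<Union>\<F>" using C unfolding compactin_def by meson
  obtain F where F: "finite F" "F \<subseteq> C" "\<F> = W ` F" using finite_subset_image[OF \<F>(1,2)] by blast
  have "p \<in> U" if y: "y \<in> C" and p: "p \<in> topspace ?H" "\<forall>j\<le>Max (insert 0 (i ` F)). p j = y j" for y p
  proof -
    obtain x where x: "x \<in> F" "y \<in> W x" using \<F>(3) F(3) y by blast
    have "i x \<le> Max (insert 0 (i ` F))" using F(1) x(1) by (intro Max_ge) auto
    then have "\<forall>j\<le>i x. p j = y j" using p(2) by simp
    then show ?thesis using Wi x F(2) p(1) by blast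
  qed
  then show ?thesis by (intro exI[of _ "Max (insert 0 (i ` F))"]) blast
qed

text \<open>A neighbourhood of \<open>f\<close> does not see coordinates beyond some index that may
  depend on \<open>f\<close>. The proof follows the generation of the topology from its subbasis; a
  subbasic set is treated by the preceding lemma, applied to the compact image of \<open>K\<close>
  under \<open>f\<close>.\<close>

lemma compact_open_coordinates:
  assumes O: "openin (subtopology (compact_open (cube n) (subtopology (product_topology Y UNIV) S)) \<Omega>) O'" and f: "f \<in> O'"
  shows "\<exists>i::nat. \<forall>g\<in>\<Omega>. g \<in> extensional (topspace (cube n)) \<and> continuous_map (cube n) (subtopology (product_topology Y UNIV) S) g \<and>
    (\<forall>t\<in>topspace (cube n). \<forall>j\<le>i. g t j = f t j) \<longrightarrow> g \<in> O'"
proof -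
  let ?H = "subtopology (product_topology Y UNIV) S"
  let ?E = "{f. f \<in> extensional (topspace (cube n)) \<and> continuous_map (cube n) ?H f}"
  let ?\<S> = "{{f. f \<in> extensional (topspace (cube n)) \<and> continuous_map (cube n) ?H f \<and> f ` K \<subseteq> U} | K U. compactin (cube n) K \<and> openin ?H U}"
  obtain O2 where O2: "openin (compact_open (cube n) ?H) O2" "O' = O2 \<inter> \<Omega>" using O unfolding openin_subtopology by blast
  obtain O1 where O1: "openin (topology_generated_by ?\<S>) O1" "O2 = O1 \<inter> ?E" using O2(1) unfolding compact_open_def openin_subtopology by blast
  have all: "\<forall>f\<in>O1. \<exists>i::nat. \<forall>g\<in>?E. (\<forall>t\<in>topspace (cube n). \<forall>j\<le>i. g t j = f t j) \<longrightarrow> g \<in> O1"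
    using openin_topology_generated_by[OF O1(1)]
  proof induction
    case Empty show ?case by blast
  next
    case (Int a b)
    show ?case
    proof
      fix f assume f: "f \<in> a \<inter> b"
      obtain i where i: "\<forall>g\<in>?E. (\<forall>t\<in>topspace (cube n). \<forall>j\<le>i. g t j = f t j) \<longrightarrow> g \<in> a" using bspec[OF Int.IH(1) IntD1[OF f]] by (rule exE)
      obtain k where k: "\<forall>g\<in>?E. (\<forall>t\<in>topspace (cube n). \<forall>j\<le>k. g t j = f t j) \<longrightarrow> g \<in> b" using bspec[OF Int.IH(2) IntD2[OF f]] by (rule exE)
      have "g \<in> a \<inter> b" if g: "g \<in> ?E" "\<forall>t\<in>topspace (cube n). \<forall>j\<le>max i k. g t j = f t j" for g
        using bspec[OF i g(1)] bspec[OF k g(1)] g(2) by simp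
      then show "\<exists>i. \<forall>g\<in>?E. (\<forall>t\<in>topspace (cube n). \<forall>j\<le>i. g t j = f t j) \<longrightarrow> g \<in> a \<inter> b" by (intro exI[of _ "max i k"] ballI impI)
    qed
  next
    case (UN K)
    show ?case
    proof
      fix f assume "f \<in> \<Union>K"
      then obtain k where k: "k \<in> K" "f \<in> k" by blast
      obtain i where i: "\<forall>g\<in>?E. (\<forall>t\<in>topspace (cube n). \<forall>j\<le>i. g t j = f t j) \<longrightarrow> g \<in> k" using bspec[OF UN.IH[OF k(1)] k(2)] by (rule exE)
      have "g \<in> \<Union>K" if g: "g \<in> ?E" "\<forall>t\<in>topspace (cube n). \<forall>j\<le>i. g t j = f t j" for g
        using mp[OF bspec[OF i g(1)] g(2)] k(1) by (rule UnionI[rotated])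
      then show "\<exists>i. \<forall>g\<in>?E. (\<forall>t\<in>topspace (cube n). \<forall>j\<le>i. g t j = f t j) \<longrightarrow> g \<in> \<Union>K" by (intro exI[of _ i] ballI impI)
    qed
  next
    case (Basis s)
    then obtain K U where s: "s = {f. f \<in> extensional (topspace (cube n)) \<and> continuous_map (cube n) ?H f \<and> f ` K \<subseteq> U}"
      and KU: "compactin (cube n) K" "openin ?H U" by (auto simp only: mem_Collect_eq)
    show ?case
    proof
      fix f assume "f \<in> s"
      then have f: "continuous_map (cube n) ?H f" "f ` K \<subseteq> U" unfolding s by auto
      obtain i where i: "\<forall>x\<in>f ` K. \<forall>p\<in>topspace ?H. (\<forall>j\<le>i. p j = x j) \<longrightarrow> p \<in> U"
        using compactin_open_generated_coordinates[OF image_compactin[OF KU(1) f(1)] KU(2) f(2)] by (rule exE)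
      have "g \<in> s" if g: "g \<in> ?E" "\<forall>t\<in>topspace (cube n). \<forall>j\<le>i. g t j = f t j" for g
      proof -
        have "g t \<in> U" if t: "t \<in> K" for t
        proof -
          have tt: "t \<in> topspace (cube n)" using compactin_subset_topspace[OF KU(1)] t by blast
          have "g t \<in> topspace ?H" using continuous_map_in_topspace[OF _ tt] g(1) by blast
          from bspec[OF bspec[OF i imageI[OF t]] this] show ?thesis using g(2) tt by blast
        qed
        then show ?thesis using g(1) unfolding s by blast
      qed
      then show "\<exists>i. \<forall>g\<in>?E. (\<forall>t\<in>topspace (cube n). \<forall>j\<le>i. g t j = f t j) \<longrightarrow> g \<in> s" by (intro exI[of _ i] ballI impI)
    qed
  qed
  have fO: "f \<in> O1" using f O2(2) O1(2) by blast
  obtain i where "\<forall>g\<in>?E. (\<forall>t\<in>topspace (cube n). \<forall>j\<le>i. g t j = f t j) \<longrightarrow> g \<in> O1" using bspec[OF all fO] by (rule exE)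
  then show ?thesis unfolding O2(2) O1(2) by (intro exI[of _ i]) blast
qed

text \<open>Affine from 0 to 1 on the interval from \<open>1 - 2^(-j)\<close> to
  \<open>1 - 2^(-j-1)\<close> and constant on either side.\<close>

definition slab :: "nat \<Rightarrow> real \<Rightarrow> real" where
  "slab j r = max 0 (min 1 (2 - 2 ^ Suc j * (1 - r)))"

text \<open>These intervals meet at most in endpoints: for \<open>j < l\<close> the earlier slab is
  finished or the later one has not begun. So at any time all but one of the concatenated maps are
  evaluated on a face of the cube.\<close>

lemma slab_disjoint:
  assumes "j \<noteq> l" "r \<le> 1" shows "slab j r \<in> {0,1} \<or> slab l r \<in> {0,1}"
proof -
  have *: "slab j r = 1 \<or> slab l r = 0" if "j < l" for j l
  proof (cases "2 ^ Suc j * (1 - r) \<le> 1")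
    case True then show ?thesis by (simp add: slab_def)
  next
    case False
    have "2 * 2 ^ Suc j \<le> (2::real) ^ Suc l" using that by (simp add: power_increasing flip: power_Suc)
    then have "2 * 2 ^ Suc j * (1 - r) \<le> 2 ^ Suc l * (1 - r)" using assms(2) by (intro mult_right_mono) auto
    then have "2 \<le> 2 ^ Suc l * (1 - r)" using False unfolding mult.assoc by linarith
    then show ?thesis by (simp add: slab_def del: power_Suc)
  qed
  show ?thesis using *[of j l] *[of l j] assms(1) by (cases "j < l") auto
qed

lemma slab_bounds: "0 \<le> slab j r" "slab j r \<le> 1" by (auto simp: slab_def)

lemma continuous_on_slab: "continuous_on UNIV (slab j)"
  unfolding slab_def[abs_def] by (intro continuous_intros)

lemma slab_0: "slab j 0 = 0" and slab_1: "slab j 1 = 1"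
proof -
  have "(2::real) \<le> 2 ^ Suc j" using power_increasing[of 1 "Suc j" "2::real"] by simp
  then show "slab j 0 = 0" by (simp add: slab_def del: power_Suc)
qed (simp add: slab_def)

text \<open>Well pointedness occurs twice: at the base points for splitting wedges, and at all
  points (\<open>wpz\<close>) for the homotopy of nearby maps.\<close>

locale hawaiian_like = pointed_family Xs xb for Xs :: "nat \<Rightarrow> 'a topology" and xb :: "nat \<Rightarrow> 'a" +
  fixes n :: nat
  assumes n: "1 < n" and comp: "\<And>j. compact_space (Xs j)" and conn: "\<And>j m. m < n \<Longrightarrow> null_at (Xs j) (xb j) m"
    and wpz: "\<And>j z. z \<in> topspace (Xs j) \<Longrightarrow> well_pointed (Xs j) z"
begin

abbreviation "H \<equiv> hawaiian Xs xb"
abbreviation "hb \<equiv> hbase xb"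
abbreviation "W i \<equiv> wedge Xs xb i"
abbreviation "L \<equiv> invlim_pi Xs xb n"
abbreviation "\<beta> \<equiv> beta Xs xb n"

lemma n0: "0 < n" using n by simp

lemmas W_eq = wedge_eq_coord_wedge[OF comp]

lemma hawaiian_wedge: "continuous_map H (W i) (\<lambda>g. g i)"
  unfolding hawaiian_def by (intro continuous_map_from_subtopology continuous_map_product_projection) simp

lemma hawaiian_coordinate: "continuous_map H (Xs j) (\<lambda>g. g i j)"
proof -
  have "continuous_map (W i) (Xs j) (\<lambda>p. p j)" unfolding W_eq by (rule continuous_map_coord_wedge_coordinate)
  from continuous_map_compose[OF hawaiian_wedge this] show ?thesis by (simp add: o_def)
qed

lemma hawaiian_collapse: "g \<in> topspace H \<Longrightarrow> k \<le> i \<Longrightarrow> collapse xb k (g i) = g k"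
  by (simp add: hawaiian_def)

text \<open>A compatible sequence is determined by its diagonal. This identifies the inverse limit
  with the infinite wedge over \<open>UNIV\<close> inside the product.\<close>

lemma hawaiian_diag:
  assumes "g \<in> topspace H" shows "g i j = (if j \<le> i then g j j else xb j)"
proof (cases "j \<le> i")
  case True
  have "g j j = collapse xb j (g i) j" using hawaiian_collapse[OF assms True] by simp
  then show ?thesis using True by (simp add: collapse_def)
next
  case False
  have "g i \<in> topspace (coord_wedge Xs xb {..i})" using continuous_map_in_topspace[OF hawaiian_wedge assms] unfolding W_eq .
  then show ?thesis using False unfolding topspace_coord_wedge by simp
qed

lemma hawaiian_to_coord_wedge: "continuous_map H (coord_wedge Xs xb UNIV) (\<lambda>g j. g j j)"
proof (rule continuous_map_coord_wedgeI[OF hawaiian_coordinate])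
  fix g assume g: "g \<in> topspace H"
  have gW: "g i \<in> topspace (coord_wedge Xs xb {..i})" for i using continuous_map_in_topspace[OF hawaiian_wedge g] unfolding W_eq .
  have "g j j \<in> topspace (Xs j)" for j by (rule continuous_map_in_topspace[OF hawaiian_coordinate g])
  moreover have "g j j = xb j \<or> g k k = xb k" if "j \<noteq> k" for j k
  proof -
    have "g (max j k) j = xb j \<or> g (max j k) k = xb k" using gW[of "max j k"] that unfolding topspace_coord_wedge by blast
    then show ?thesis using hawaiian_diag[OF g, of "max j k" j] hawaiian_diag[OF g, of "max j k" k] by simp
  qed
  ultimately show "(\<lambda>j. g j j) \<in> topspace (coord_wedge Xs xb UNIV)" unfolding topspace_coord_wedge by blast
qed

lemma coord_wedge_to_hawaiian: "continuous_map (coord_wedge Xs xb UNIV) H (\<lambda>p i. collapse xb i p)"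
proof -
  have c: "continuous_map (coord_wedge Xs xb UNIV) (W i) (collapse xb i)" for i
    unfolding W_eq
  proof (rule continuous_map_coord_wedgeI)
    show "continuous_map (coord_wedge Xs xb UNIV) (Xs j) (\<lambda>p. collapse xb i p j)" for j
      using continuous_map_coord_wedge_coordinate[of Xs xb UNIV j] base by (cases "j \<le> i") (simp_all add: collapse_def)
    fix p assume "p \<in> topspace (coord_wedge Xs xb UNIV)"
    then show "collapse xb i p \<in> topspace (coord_wedge Xs xb {..i})"
      unfolding topspace_coord_wedge collapse_def using base by auto
  qed
  have "collapse xb k (collapse xb i p) = collapse xb k p" if "k \<le> i" for k i p using that by (auto simp: collapse_def fun_eq_iff)
  then show ?thesis using c
    unfolding hawaiian_def continuous_map_in_subtopology by (simp add: continuous_map_componentwise_UNIV image_subset_iff Pi_iff)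
qed

lemma collapse_diag: "g \<in> topspace H \<Longrightarrow> (\<lambda>i. collapse xb i (\<lambda>j. g j j)) = g"
  using hawaiian_diag by (auto simp: fun_eq_iff collapse_def)

lemma hbase_topspace: "hb \<in> topspace H"
proof -
  have "xb \<in> topspace (coord_wedge Xs xb UNIV)" unfolding topspace_coord_wedge using base by simp
  from continuous_map_in_topspace[OF coord_wedge_to_hawaiian this] show ?thesis
    by (simp add: hbase_def collapse_def)
qed

lemma coord_wedge_iff:
  assumes "based_map (coord_wedge Xs xb J) xb n f" "based_map (coord_wedge Xs xb J) xb n g"
  shows "rel_htpc (coord_wedge Xs xb J) xb n f g \<longleftrightarrow> (\<forall>j. rel_htpc (Xs j) (xb j) n (\<lambda>t. f t j) (\<lambda>t. g t j))"
  by (rule rel_htpc_coord_wedge_iff[OF n _ assms], erule conn)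

theorem rel_htpc_hawaiian_iff:
  assumes f: "based_map H hb n f" and g: "based_map H hb n g"
  shows "rel_htpc H hb n f g \<longleftrightarrow> (\<forall>j. rel_htpc (Xs j) (xb j) n (\<lambda>t. f t j j) (\<lambda>t. g t j j))"
proof
  assume r: "rel_htpc H hb n f g"
  show "\<forall>j. rel_htpc (Xs j) (xb j) n (\<lambda>t. f t j j) (\<lambda>t. g t j j)"
  proof
    fix j show "rel_htpc (Xs j) (xb j) n (\<lambda>t. f t j j) (\<lambda>t. g t j j)"
      using rel_htpc_compose_left[OF r hawaiian_coordinate[of j j], of "xb j"] by (simp add: o_def hbase_def)
  qed
next
  assume c: "\<forall>j. rel_htpc (Xs j) (xb j) n (\<lambda>t. f t j j) (\<lambda>t. g t j j)"
  have b: "based_map (coord_wedge Xs xb UNIV) xb n (\<lambda>t j. k t j j)" if "based_map H hb n k" for k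
    using based_map_compose_left[OF that hawaiian_to_coord_wedge, of xb] by (simp add: o_def hbase_def)
  have "rel_htpc (coord_wedge Xs xb UNIV) xb n (\<lambda>t j. f t j j) (\<lambda>t j. g t j j)"
    using coord_wedge_iff[OF b[OF f] b[OF g]] c by simp
  from rel_htpc_compose_left[OF this coord_wedge_to_hawaiian, of hb]
  have "rel_htpc H hb n (\<lambda>t i. collapse xb i (\<lambda>j. f t j j)) (\<lambda>t i. collapse xb i (\<lambda>j. g t j j))"
    by (simp add: o_def hbase_def collapse_def)
  then show "rel_htpc H hb n f g"
    by (rule rel_htpc_cong) (simp_all add: collapse_diag based_map_in_topspace[OF f] based_map_in_topspace[OF g])
qed

lemma based_map_hawaiian_wedge:
  assumes "based_map H hb n f" shows "based_map (W i) xb n (\<lambda>t. f t i)"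
  using based_map_compose_left[OF assms hawaiian_wedge[of i], of xb] by (simp add: o_def hbase_def)

lemma beta_hclass:
  assumes "based_map H hb n f" shows "\<beta> (hclass H hb n f) i = hclass (W i) xb n (\<lambda>t. f t i)"
  unfolding beta_def using induced_hclass[OF assms hawaiian_wedge, of i xb] by (simp add: o_def hbase_def)

lemma rel_htpc_wedge_iff:
  assumes "based_map (W i) xb n f" "based_map (W i) xb n g"
  shows "rel_htpc (W i) xb n f g \<longleftrightarrow> (\<forall>j\<le>i. rel_htpc (Xs j) (xb j) n (\<lambda>t. f t j) (\<lambda>t. g t j))"
proof -
  note b = assms[unfolded W_eq]
  have "rel_htpc (Xs j) (xb j) n (\<lambda>t. f t j) (\<lambda>t. g t j)" if "\<not> j \<le> i" for j
  proof (rule rel_htpc_equal[OF based_map_coord_wedge_coordinate[OF b(1)]])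
    fix t assume "t \<in> topspace (cube n)"
    then show "f t j = g t j"
      using based_map_in_topspace[OF b(1)] based_map_in_topspace[OF b(2)] that unfolding topspace_coord_wedge by simp
  qed
  then show ?thesis unfolding W_eq coord_wedge_iff[OF b] by blast
qed

lemma beta_hclass_eq_iff:
  assumes f: "based_map H hb n f" and g: "based_map H hb n g"
  shows "\<beta> (hclass H hb n f) i = \<beta> (hclass H hb n g) i \<longleftrightarrow> (\<forall>j\<le>i. rel_htpc (Xs j) (xb j) n (\<lambda>t. f t j j) (\<lambda>t. g t j j))"
proof -
  note b = based_map_hawaiian_wedge[OF f, of i] based_map_hawaiian_wedge[OF g, of i]
  have "rel_htpc (Xs j) (xb j) n (\<lambda>t. f t i j) (\<lambda>t. g t i j) \<longleftrightarrow> rel_htpc (Xs j) (xb j) n (\<lambda>t. f t j j) (\<lambda>t. g t j j)" if "j \<le> i" for j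
  proof -
    have e: "f t i j = f t j j" "g t i j = g t j j" if "t \<in> topspace (cube n)" for t
      using hawaiian_diag[OF based_map_in_topspace[OF f that], of i j] hawaiian_diag[OF based_map_in_topspace[OF g that], of i j] \<open>j \<le> i\<close> by auto
    show ?thesis by (rule iffI; erule rel_htpc_cong; simp add: e)
  qed
  then show ?thesis unfolding beta_hclass[OF f] beta_hclass[OF g] hclass_eq_iff[OF b] rel_htpc_wedge_iff[OF b] by blast
qed

section \<open>The comparison map to the inverse limit of homotopy groups\<close>

lemma topspace_invlim: "topspace L = {a. (\<forall>i. a i \<in> pi_set (W i) xb n) \<and> (\<forall>k i. k \<le> i \<longrightarrow> induced (W k) xb n (collapse xb k) (a i) = a k)}"
  by (auto simp: invlim_pi_def PiE_UNIV_domain)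

lemma continuous_map_collapse: "k \<le> i \<Longrightarrow> continuous_map (W i) (W k) (collapse xb k)"
  unfolding W_eq
proof (rule continuous_map_coord_wedgeI)
  show "continuous_map (coord_wedge Xs xb {..i}) (Xs j) (\<lambda>p. collapse xb k p j)" for j
    using continuous_map_coord_wedge_coordinate[of Xs xb "{..i}" j] base by (cases "j \<le> k") (simp_all add: collapse_def)
  fix p assume "p \<in> topspace (coord_wedge Xs xb {..i})"
  then show "collapse xb k p \<in> topspace (coord_wedge Xs xb {..k})"
    unfolding topspace_coord_wedge collapse_def using base by auto
qed

lemma collapse_base: "collapse xb k xb = xb"
  by (simp add: collapse_def)

lemma based_map_collapse: "based_map (W i) xb n f \<Longrightarrow> k \<le> i \<Longrightarrow> based_map (W k) xb n (collapse xb k \<circ> f)"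
  by (rule based_map_compose_left[where h = "collapse xb k", OF _ continuous_map_collapse collapse_base])

lemma induced_collapse:
  "based_map (W i) xb n f \<Longrightarrow> k \<le> i \<Longrightarrow>
     induced (W k) xb n (collapse xb k) (hclass (W i) xb n f) = hclass (W k) xb n (collapse xb k \<circ> f)"
  by (rule induced_hclass[where h = "collapse xb k", OF _ continuous_map_collapse collapse_base])

lemma beta_in_invlim:
  assumes "a \<in> pi_set H hb n" shows "\<beta> a \<in> topspace L"
proof -
  obtain f where "f \<in> Omega H hb n" and a: "a = hclass H hb n f" using assms by (rule pi_setE)
  then have f: "based_map H hb n f" by (simp add: Omega_based_map)
  have "induced (W k) xb n (collapse xb k) (\<beta> a i) = \<beta> a k" if "k \<le> i" for k i
  proof -
    have "rel_htpc (W k) xb n (\<lambda>t. f t k) (collapse xb k \<circ> (\<lambda>t. f t i))"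
      by (rule rel_htpc_equal[OF based_map_hawaiian_wedge[OF f]])
         (simp add: hawaiian_collapse[OF based_map_in_topspace[OF f] that])
    then show ?thesis
      unfolding a beta_hclass[OF f] induced_collapse[OF based_map_hawaiian_wedge[OF f] that]
      by (rule hclass_cong[symmetric])
  qed
  moreover have "\<beta> a i \<in> pi_set (W i) xb n" for i
    unfolding a beta_hclass[OF f] by (rule hclass_in_pi_set[OF based_map_hawaiian_wedge[OF f]])
  ultimately show ?thesis unfolding topspace_invlim by blast
qed

lemma inj_beta: "inj_on \<beta> (pi_set H hb n)"
proof (rule inj_onI)
  fix a b assume ab: "a \<in> pi_set H hb n" "b \<in> pi_set H hb n" "\<beta> a = \<beta> b"
  obtain f where "f \<in> Omega H hb n" and a: "a = hclass H hb n f" using ab(1) by (rule pi_setE)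
  then have f: "based_map H hb n f" by (simp add: Omega_based_map)
  obtain g where "g \<in> Omega H hb n" and b: "b = hclass H hb n g" using ab(2) by (rule pi_setE)
  then have g: "based_map H hb n g" by (simp add: Omega_based_map)
  have "rel_htpc (Xs j) (xb j) n (\<lambda>t. f t j j) (\<lambda>t. g t j j)" for j
  proof -
    have "\<beta> (hclass H hb n f) j = \<beta> (hclass H hb n g) j" using ab(3) a b by simp
    then show ?thesis unfolding beta_hclass_eq_iff[OF f g] by blast
  qed
  then have "rel_htpc H hb n f g" unfolding rel_htpc_hawaiian_iff[OF f g] by blast
  then show "a = b" unfolding a b by (rule hclass_cong)
qed

text \<open>The infinite concatenation of maps \<open>\<phi> j\<close> into \<open>Xs j\<close>: the map \<open>\<phi> j\<close> is placed on the slab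
  \<open>1 - 2\<^sup>-\<^sup>j \<le> t 0 \<le> 1 - 2\<^sup>-\<^sup>j\<^sup>-\<^sup>1\<close>.\<close>

definition infconcat :: "(nat \<Rightarrow> (nat \<Rightarrow> real) \<Rightarrow> 'a) \<Rightarrow> (nat \<Rightarrow> real) \<Rightarrow> nat \<Rightarrow> nat \<Rightarrow> 'a" where
  "infconcat \<phi> t = (\<lambda>i. collapse xb i (\<lambda>j. \<phi> j (t(0 := slab j (t 0)))))"

lemma infconcat_diag: "infconcat \<phi> t j j = \<phi> j (t(0 := slab j (t 0)))"
  by (simp add: infconcat_def collapse_def)

lemma infconcat:
  assumes \<phi>: "\<And>j. based_map (Xs j) (xb j) n (\<phi> j)"
  shows "based_map H hb n (infconcat \<phi>)" "rel_htpc (Xs j) (xb j) n (\<lambda>t. infconcat \<phi> t j j) (\<phi> j)"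
proof -
  have r: "rel_htpc (Xs j) (xb j) n (\<lambda>t. \<phi> j (t(0 := slab j (t 0)))) (\<lambda>t. \<phi> j (t(0 := id (t 0))))" for j
    by (rule rel_htpc_reparam_coordinate[OF \<phi> n0]) (simp_all add: continuous_on_slab slab_bounds slab_0 slab_1 continuous_on_id)
  then show "rel_htpc (Xs j) (xb j) n (\<lambda>t. infconcat \<phi> t j j) (\<phi> j)" unfolding infconcat_diag by simp
  have "based_map (coord_wedge Xs xb UNIV) xb n (\<lambda>t j. \<phi> j (t(0 := slab j (t 0))))"
  proof (rule based_map_coord_wedgeI[OF rel_htpc_imp_based_map(1)[OF r]])
    fix t assume t: "t \<in> topspace (cube n)"
    have u: "t(0 := slab j (t 0)) \<in> topspace (cube n)" for j by (rule cube_update[OF t slab_bounds n0])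
    have "\<phi> j (t(0 := slab j (t 0))) = xb j" if "slab j (t 0) \<in> {0,1}" for j
      by (rule based_map_bdry[OF \<phi> cube_face[OF t n0]]) (use that in auto)
    then have "\<phi> j (t(0 := slab j (t 0))) = xb j \<or> \<phi> l (t(0 := slab l (t 0))) = xb l" if "j \<noteq> l" for j l
      using slab_disjoint[OF that, of "t 0"] cube_coordD[OF t n0] by blast
    then show "(\<lambda>j. \<phi> j (t(0 := slab j (t 0)))) \<in> topspace (coord_wedge Xs xb UNIV)"
      unfolding topspace_coord_wedge using based_map_in_topspace[OF \<phi> u] by blast
  qed
  from based_map_compose_left[OF this coord_wedge_to_hawaiian, of hb]
  show "based_map H hb n (infconcat \<phi>)" by (simp add: o_def hbase_def collapse_base infconcat_def[abs_def])
qed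

text \<open>Coordinate \<open>j\<close> is taken from the chosen representative of
  \<open>b j\<close> and so depends on \<open>b j\<close> alone: threads that agree up to
  \<open>i\<close> yield identical, not merely homotopic, coordinates up to \<open>i\<close>. The
  openness of \<open>\<beta>\<close> rests on this.\<close>

definition coordinates :: "(nat \<Rightarrow> ((nat \<Rightarrow> real) \<Rightarrow> nat \<Rightarrow> 'a) set) \<Rightarrow> nat \<Rightarrow> (nat \<Rightarrow> real) \<Rightarrow> 'a" where
  "coordinates b j t = (SOME f. f \<in> b j) t j"

lemma based_map_coordinates:
  assumes "b \<in> topspace L" shows "based_map (Xs j) (xb j) n (coordinates b j)"
proof -
  have "b j \<in> pi_set (W j) xb n" using assms unfolding topspace_invlim by blast
  from representative(1)[OF this] have "based_map (coord_wedge Xs xb {..j}) xb n (SOME f. f \<in> b j)" unfolding W_eq .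
  from based_map_coord_wedge_coordinate[OF this, of j] show ?thesis by (simp add: coordinates_def[abs_def])
qed

lemma beta_infconcat:
  assumes b: "b \<in> topspace L" shows "\<beta> (hclass H hb n (infconcat (coordinates b))) = b"
proof
  fix i
  let ?r = "\<lambda>i. SOME f. f \<in> b i"
  have bp: "b i \<in> pi_set (W i) xb n" for i using b unfolding topspace_invlim by blast
  note r = representative[OF bp]
  note ic = infconcat[of "coordinates b", OF based_map_coordinates[OF b]]
  have "rel_htpc (Xs j) (xb j) n (\<lambda>t. infconcat (coordinates b) t i j) (\<lambda>t. ?r i t j)" if ji: "j \<le> i" for j
  proof -
    \<comment> \<open>Compatibility of the thread: the representative chosen at level
      \<open>i\<close>, collapsed to level \<open>j\<close>, is homotopic to the one chosen at level
      \<open>j\<close>.\<close>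
    have "hclass (W j) xb n (collapse xb j \<circ> ?r i) = induced (W j) xb n (collapse xb j) (hclass (W i) xb n (?r i))"
      by (rule induced_collapse[OF r(1) ji, symmetric])
    also have "\<dots> = b j" using b ji unfolding r(2) topspace_invlim by blast
    also have "\<dots> = hclass (W j) xb n (?r j)" by (rule r(2)[symmetric])
    finally have "rel_htpc (W j) xb n (collapse xb j \<circ> ?r i) (?r j)"
      using hclass_eq_iff[OF based_map_collapse[OF r(1) ji] r(1)] by blast
    then have "rel_htpc (Xs j) (xb j) n (\<lambda>t. (collapse xb j \<circ> ?r i) t j) (\<lambda>t. ?r j t j)"
      unfolding W_eq by (rule rel_htpc_coord_wedge_coordinate)
    then have "rel_htpc (Xs j) (xb j) n (coordinates b j) (\<lambda>t. ?r i t j)"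
      by (simp add: collapse_def coordinates_def[abs_def] rel_htpc_sym)
    from rel_htpc_trans[OF ic(2) this] show ?thesis
      by (rule rel_htpc_cong) (simp_all add: infconcat_def collapse_def ji)
  qed
  then have "rel_htpc (W i) xb n (\<lambda>t. infconcat (coordinates b) t i) (?r i)"
    unfolding rel_htpc_wedge_iff[OF based_map_hawaiian_wedge[OF ic(1)] r(1)] by blast
  then show "\<beta> (hclass H hb n (infconcat (coordinates b))) i = b i"
    unfolding beta_hclass[OF ic(1)] using hclass_cong r(2) by metis
qed

lemma bij_beta: "\<beta> ` pi_set H hb n = topspace L"
proof (rule antisym)
  show "\<beta> ` pi_set H hb n \<subseteq> topspace L" using beta_in_invlim by blast
  show "topspace L \<subseteq> \<beta> ` pi_set H hb n"
  proof
    fix b assume b: "b \<in> topspace L"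
    show "b \<in> \<beta> ` pi_set H hb n"
      using imageI[OF hclass_in_pi_set[OF infconcat(1)[OF based_map_coordinates[OF b]]], of \<beta>] beta_infconcat[OF b] by simp
  qed
qed

text \<open>Level \<open>i\<close> of \<open>\<beta>\<close> depends on the homotopy classes of the
  coordinates up to \<open>i\<close>, and by \<open>rel_htpc_if_close\<close> each of these classes
  is kept by finitely many subbasic conditions.\<close>

lemma openin_Omega_beta: "openin (subtopology (compact_open (cube n) H) (Omega H hb n)) {f \<in> Omega H hb n. \<beta> (hclass H hb n f) i \<in> S}"
  (is "openin ?\<Omega> ?B")
proof (subst openin_subopen, intro ballI)
  fix f assume f: "f \<in> ?B"
  then have f\<Omega>: "f \<in> Omega H hb n" and fb: "based_map H hb n f" by (auto simp: Omega_based_map)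
  have fj: "based_map (Xs j) (xb j) n (\<lambda>t. f t j j)" for j
    using based_map_compose_left[OF fb hawaiian_coordinate[of j j], of "xb j"] by (simp add: o_def hbase_def)
  have "\<forall>j. \<exists>N V. (\<forall>a\<in>PiE {..<n} (\<lambda>_. {..<N}). openin (Xs j) (V a) \<and> (\<lambda>t. f t j j) ` gcube n N a \<subseteq> V a) \<and>
    (\<forall>g. based_map (Xs j) (xb j) n g \<and> (\<forall>a\<in>PiE {..<n} (\<lambda>_. {..<N}). g ` gcube n N a \<subseteq> V a) \<longrightarrow> rel_htpc (Xs j) (xb j) n (\<lambda>t. f t j j) g)"
    using rel_htpc_if_close[OF comp haus wpz fj] by (intro allI)
  from choice[OF this] obtain N where "\<forall>j. \<exists>V. (\<forall>a\<in>PiE {..<n} (\<lambda>_. {..<N j}). openin (Xs j) (V a) \<and> (\<lambda>t. f t j j) ` gcube n (N j) a \<subseteq> V a) \<and>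
    (\<forall>g. based_map (Xs j) (xb j) n g \<and> (\<forall>a\<in>PiE {..<n} (\<lambda>_. {..<N j}). g ` gcube n (N j) a \<subseteq> V a) \<longrightarrow> rel_htpc (Xs j) (xb j) n (\<lambda>t. f t j j) g)"
    by (rule exE) (rule that)
  from choice[OF this] obtain V where NV: "\<forall>j. (\<forall>a\<in>PiE {..<n} (\<lambda>_. {..<N j}). openin (Xs j) (V j a) \<and> (\<lambda>t. f t j j) ` gcube n (N j) a \<subseteq> V j a) \<and>
    (\<forall>g. based_map (Xs j) (xb j) n g \<and> (\<forall>a\<in>PiE {..<n} (\<lambda>_. {..<N j}). g ` gcube n (N j) a \<subseteq> V j a) \<longrightarrow> rel_htpc (Xs j) (xb j) n (\<lambda>t. f t j j) g)"
    by (rule exE) (rule that)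
  let ?I = "SIGMA j:{..i}. PiE {..<n} (\<lambda>_. {..<N j})"
  let ?U = "\<lambda>(j,a). {p \<in> topspace H. p j j \<in> V j a}"
  define \<Omega>n where "\<Omega>n = Omega H hb n"
  let ?O = "\<Omega>n \<inter> (\<Inter>c\<in>?I. {g \<in> \<Omega>n. g ` gcube n (N (fst c)) (snd c) \<subseteq> ?U c})"
  have "openin ?\<Omega> {g \<in> \<Omega>n. g ` gcube n (N (fst c)) (snd c) \<subseteq> ?U c}" if c: "c \<in> ?I" for c
    unfolding \<Omega>n_def
  proof (rule openin_Omega_subbasis)
    show "compactin (cube n) (gcube n (N (fst c)) (snd c))" by (rule closedin_compact_space[OF compact_cube closedin_cell])
    have "openin (Xs (fst c)) (V (fst c) (snd c))" using NV c by auto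
    from openin_continuous_map_preimage[OF hawaiian_coordinate this] show "openin H (?U c)" by (simp add: case_prod_unfold)
  qed
  moreover have "finite ?I" by (intro finite_SigmaI finite_PiE) auto
  moreover have "openin ?\<Omega> \<Omega>n" using openin_topspace[of ?\<Omega>] unfolding topspace_Omega \<Omega>n_def .
  ultimately have "openin ?\<Omega> ?O" by (cases "?I = {}") (simp, intro openin_Int openin_INT2, auto)
  moreover have "f \<in> ?O"
  proof -
    have "f ` gcube n (N j) a \<subseteq> {p \<in> topspace H. p j j \<in> V j a}" if "a \<in> PiE {..<n} (\<lambda>_. {..<N j})" for j a
    proof -
      have "(\<lambda>t. f t j j) ` gcube n (N j) a \<subseteq> V j a" using spec[OF NV, of j] that by blast
      then show ?thesis using based_map_in_topspace[OF fb] by (auto simp: cell_def)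
    qed
    then show ?thesis using f\<Omega> unfolding \<Omega>n_def by auto
  qed
  moreover have "?O \<subseteq> ?B"
  proof
    fix g assume g: "g \<in> ?O"
    then have g\<Omega>: "g \<in> Omega H hb n" and gb: "based_map H hb n g" by (auto simp: \<Omega>n_def Omega_based_map)
    have "rel_htpc (Xs j) (xb j) n (\<lambda>t. f t j j) (\<lambda>t. g t j j)" if j: "j \<le> i" for j
    proof -
      have "(\<lambda>t. g t j j) ` gcube n (N j) a \<subseteq> V j a" if a: "a \<in> PiE {..<n} (\<lambda>_. {..<N j})" for a
      proof -
        have "(j,a) \<in> ?I" using a j by simp
        then have "g \<in> {g \<in> \<Omega>n. g ` gcube n (N (fst (j,a))) (snd (j,a)) \<subseteq> ?U (j,a)}" using g by blast
        then show ?thesis by auto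
      qed
      moreover have "based_map (Xs j) (xb j) n (\<lambda>t. g t j j)"
        using based_map_compose_left[OF gb hawaiian_coordinate[of j j], of "xb j"] by (simp add: o_def hbase_def)
      ultimately show ?thesis using spec[OF NV, of j] by blast
    qed
    then have "\<beta> (hclass H hb n f) i = \<beta> (hclass H hb n g) i" unfolding beta_hclass_eq_iff[OF fb gb] by blast
    then show "g \<in> ?B" using f g\<Omega> by simp
  qed
  ultimately show "\<exists>T. openin ?\<Omega> T \<and> f \<in> T \<and> T \<subseteq> ?B" by (intro exI[of _ ?O]) blast
qed

lemma continuous_beta_coordinate:
  "continuous_map (pi_top H hb n) (discrete_topology (pi_set (W i) xb n)) (\<lambda>a. \<beta> a i)"
  unfolding continuous_map_def
proof (intro conjI allI impI)
  show "(\<lambda>a. \<beta> a i) \<in> topspace (pi_top H hb n) \<rightarrow> topspace (discrete_topology (pi_set (W i) xb n))"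
    unfolding topspace_pi_top using beta_in_invlim unfolding topspace_invlim by auto
  fix S
  have "{f \<in> Omega H hb n. hclass H hb n f \<in> {a \<in> topspace (pi_top H hb n). \<beta> a i \<in> S}} = {f \<in> Omega H hb n. \<beta> (hclass H hb n f) i \<in> S}"
    by (auto simp: topspace_pi_top intro: hclass_in_pi_set Omega_based_map)
  then show "openin (pi_top H hb n) {a \<in> topspace (pi_top H hb n). \<beta> a i \<in> S}"
    unfolding openin_pi_top using openin_Omega_beta by (auto simp: topspace_pi_top)
qed

lemma continuous_beta: "continuous_map (pi_top H hb n) L \<beta>"
proof -
  have "continuous_map (pi_top H hb n) (product_topology (\<lambda>i. discrete_topology (pi_set (W i) xb n)) UNIV) \<beta>"
    unfolding continuous_map_componentwise_UNIV using continuous_beta_coordinate by blast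
  moreover have "\<beta> a \<in> {a. \<forall>k i. k \<le> i \<longrightarrow> induced (W k) xb n (collapse xb k) (a i) = a k}" if "a \<in> topspace (pi_top H hb n)" for a
    using beta_in_invlim[of a] that unfolding topspace_invlim topspace_pi_top by blast
  ultimately show ?thesis unfolding invlim_pi_def continuous_map_in_subtopology by blast
qed

text \<open>Infinite concatenation gives a section \<open>?rep\<close> of \<open>\<beta>\<close> on
  the level of maps. If \<open>c\<close> agrees with \<open>b\<close> up to \<open>i\<close>, then
  \<open>?rep c\<close> and \<open>?rep b\<close> have the same coordinates up to \<open>i\<close>,
  so \<open>?rep c\<close> lies in the open set of maps with class in \<open>U\<close>.\<close>

lemma open_beta: "open_map (pi_top H hb n) L \<beta>"
  unfolding open_map_def
proof (intro allI impI)
  fix U assume U: "openin (pi_top H hb n) U"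
  have Upi: "U \<subseteq> pi_set H hb n" and O: "openin (subtopology (compact_open (cube n) H) (Omega H hb n)) {f \<in> Omega H hb n. hclass H hb n f \<in> U}"
    using U unfolding openin_pi_top by auto
  show "openin L (\<beta> ` U)"
  proof (subst openin_subopen, intro ballI)
    fix b assume "b \<in> \<beta> ` U"
    then obtain a where a: "a \<in> U" "b = \<beta> a" by blast
    have bL: "b \<in> topspace L" using beta_in_invlim a Upi by blast
    let ?rep = "\<lambda>c. restrict (infconcat (coordinates c)) (topspace (cube n))"
    have rep: "?rep c \<in> Omega H hb n" "hclass H hb n (?rep c) \<in> pi_set H hb n" "\<beta> (hclass H hb n (?rep c)) = c" if c: "c \<in> topspace L" for c
    proof -
      have i: "based_map H hb n (infconcat (coordinates c))" by (rule infconcat(1)[OF based_map_coordinates[OF c]])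
      show o: "?rep c \<in> Omega H hb n" by (rule restrict_Omega[OF i])
      show "hclass H hb n (?rep c) \<in> pi_set H hb n" by (rule hclass_in_pi_set[OF Omega_based_map[OF o]])
      show "\<beta> (hclass H hb n (?rep c)) = c"
        using beta_infconcat[OF c] hclass_cong[OF rel_htpc_restrict[OF i]] by simp
    qed
    \<comment> \<open>By injectivity of \<open>\<beta>\<close> the standard map for \<open>b\<close>
      represents the given class \<open>a\<close>, so the neighbourhood can be taken around that
      map.\<close>
    have "hclass H hb n (?rep b) = a"
      by (rule inj_onD[OF inj_beta _ rep(2)[OF bL]]) (use rep(3)[OF bL] a Upi in auto)
    then have "?rep b \<in> {f \<in> Omega H hb n. hclass H hb n f \<in> U}" using rep(1)[OF bL] a by simp
    from compact_open_coordinates[OF O[unfolded hawaiian_def] this[unfolded hawaiian_def]]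
    obtain i where i: "\<And>g. \<lbrakk>g \<in> Omega H hb n; g \<in> extensional (topspace (cube n)); continuous_map (cube n) H g;
       \<forall>t\<in>topspace (cube n). \<forall>j\<le>i. g t j = ?rep b t j\<rbrakk> \<Longrightarrow> hclass H hb n g \<in> U"
      unfolding hawaiian_def[symmetric] by (elim exE) (rule that, blast)
    let ?V = "{c \<in> topspace L. \<forall>j<Suc i. c j \<in> {b j}}"
    have "continuous_map L (discrete_topology (pi_set (W j) xb n)) (\<lambda>c. c j)" for j
      unfolding invlim_pi_def by (intro continuous_map_from_subtopology continuous_map_product_projection) simp
    moreover have "openin (discrete_topology (pi_set (W j) xb n)) {b j}" for j using bL unfolding topspace_invlim by simp
    ultimately have "openin L {c \<in> topspace L. c j \<in> {b j}}" for j by (rule openin_continuous_map_preimage)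
    then have "openin L ?V" by (rule openin_all_less)
    moreover have "b \<in> ?V" using bL by simp
    moreover have "?V \<subseteq> \<beta> ` U"
    proof
      fix c assume c: "c \<in> ?V"
      then have cL: "c \<in> topspace L" and cb: "\<And>j. j \<le> i \<Longrightarrow> c j = b j" by auto
      have "hclass H hb n (?rep c) \<in> U"
      proof (rule i[OF rep(1)[OF cL]])
        show "?rep c \<in> extensional (topspace (cube n))" "continuous_map (cube n) H (?rep c)" using rep(1)[OF cL] by (simp_all add: Omega_def)
        show "\<forall>t\<in>topspace (cube n). \<forall>j\<le>i. ?rep c t j = ?rep b t j"
          using cb by (auto simp: infconcat_def collapse_def coordinates_def fun_eq_iff)
      qed
      from imageI[OF this, of \<beta>] show "c \<in> \<beta> ` U" unfolding rep(3)[OF cL] .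
    qed
    ultimately show "\<exists>T. openin L T \<and> b \<in> T \<and> T \<subseteq> \<beta> ` U" by blast
  qed
qed

theorem homeomorphic_map_beta: "homeomorphic_map (pi_top H hb n) L \<beta>"
  by (rule bijective_open_imp_homeomorphic_map[OF continuous_beta open_beta])
     (use bij_beta inj_beta in \<open>simp_all add: topspace_pi_top\<close>)

lemma metrizable_pi_top: "metrizable_space (pi_top H hb n)"
proof -
  have "metrizable_space L" unfolding invlim_pi_def
    by (intro metrizable_space_subtopology) (simp add: metrizable_space_product_topology)
  then show ?thesis
    using homeomorphic_metrizable_space homeomorphic_map_imp_homeomorphic_space[OF homeomorphic_map_beta] by blast
qed

text \<open>The homeomorphism \<open>\<beta>\<close> lets continuity be tested level by level in
  discrete groups, where the group operations are continuous for free.\<close>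

lemma continuous_into_pi_top:
  assumes k: "\<And>z. z \<in> topspace Z \<Longrightarrow> k z \<in> pi_set H hb n"
    and c: "\<And>i. continuous_map Z (discrete_topology (pi_set (W i) xb n)) (\<lambda>z. \<beta> (k z) i)"
  shows "continuous_map Z (pi_top H hb n) k"
proof -
  obtain \<gamma> where \<gamma>: "homeomorphic_maps (pi_top H hb n) L \<beta> \<gamma>"
    using homeomorphic_map_maps homeomorphic_map_beta by blast
  have "continuous_map Z (product_topology (\<lambda>i. discrete_topology (pi_set (W i) xb n)) UNIV) (\<lambda>z. \<beta> (k z))"
    unfolding continuous_map_componentwise_UNIV using c by blast
  moreover have "\<beta> (k z) \<in> {a. \<forall>k i. k \<le> i \<longrightarrow> induced (W k) xb n (collapse xb k) (a i) = a k}" if "z \<in> topspace Z" for z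
    using beta_in_invlim[OF k[OF that]] unfolding topspace_invlim by blast
  ultimately have "continuous_map Z L (\<lambda>z. \<beta> (k z))" unfolding invlim_pi_def continuous_map_in_subtopology by blast
  moreover have "continuous_map L (pi_top H hb n) \<gamma>" using \<gamma> by (simp add: homeomorphic_maps_def)
  ultimately have "continuous_map Z (pi_top H hb n) (\<gamma> \<circ> (\<lambda>z. \<beta> (k z)))" by (rule continuous_map_compose)
  then show ?thesis by (rule continuous_map_eq) (use \<gamma> k in \<open>simp add: homeomorphic_maps_def topspace_pi_top\<close>)
qed

theorem topological_group_pi_top: "topological_group (pi_top H hb n) (pi_mult H hb n) (pi_inv H hb n) (pi_one H hb n)"
proof -
  note grp = pi_set_group[OF n0 hbase_topspace]
  have hw: "hb i = xb" for i by (simp add: hbase_def)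
  let ?G = "pi_top H hb n" and ?D = "\<lambda>i. discrete_topology (pi_set (W i) xb n)"
  have xW: "xb \<in> topspace (W i)" for i using continuous_map_in_topspace[OF hawaiian_wedge hbase_topspace] by (simp add: hw)
  note wgrp = pi_set_group[OF n0 xW]
  have "continuous_map (prod_topology ?G ?G) ?G (\<lambda>p. pi_mult H hb n (fst p) (snd p))"
  proof (rule continuous_into_pi_top)
    show "pi_mult H hb n (fst p) (snd p) \<in> pi_set H hb n" if "p \<in> topspace (prod_topology ?G ?G)" for p
      using that grp(2) by (auto simp: topspace_pi_top)
    fix i
    have "continuous_map (prod_topology ?G ?G) (prod_topology (?D i) (?D i)) (\<lambda>p. (\<beta> (fst p) i, \<beta> (snd p) i))"
      using continuous_map_compose[OF continuous_map_fst[of ?G ?G] continuous_beta_coordinate[of i]]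
        continuous_map_compose[OF continuous_map_snd[of ?G ?G] continuous_beta_coordinate[of i]]
      by (simp add: continuous_map_pairwise o_def)
    moreover have "continuous_map (prod_topology (?D i) (?D i)) (?D i) (\<lambda>p. pi_mult (W i) xb n (fst p) (snd p))"
      unfolding prod_topology_discrete_topology[symmetric] continuous_map_from_discrete_topology using wgrp(2) by auto
    ultimately have "continuous_map (prod_topology ?G ?G) (?D i) ((\<lambda>p. pi_mult (W i) xb n (fst p) (snd p)) \<circ> (\<lambda>p. (\<beta> (fst p) i, \<beta> (snd p) i)))"
      by (rule continuous_map_compose)
    then show "continuous_map (prod_topology ?G ?G) (?D i) (\<lambda>p. \<beta> (pi_mult H hb n (fst p) (snd p)) i)"
      by (rule continuous_map_eq)
         (auto simp: beta_def topspace_pi_top induced_pi_mult[where T = H and x = hb and y = xb and h = "\<lambda>g. g i", OF _ _ n0 hawaiian_wedge hw])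
  qed
  moreover have "continuous_map ?G ?G (pi_inv H hb n)"
  proof (rule continuous_into_pi_top)
    show "pi_inv H hb n a \<in> pi_set H hb n" if "a \<in> topspace ?G" for a using that grp(3) by (simp add: topspace_pi_top)
    fix i
    have "continuous_map (?D i) (?D i) (pi_inv (W i) xb n)"
      unfolding continuous_map_from_discrete_topology using wgrp(3) by auto
    from continuous_map_compose[OF continuous_beta_coordinate this]
    show "continuous_map ?G (?D i) (\<lambda>a. \<beta> (pi_inv H hb n a) i)"
      by (rule continuous_map_eq) (simp add: beta_def topspace_pi_top induced_pi_inv[where T = H and x = hb and y = xb and h = "\<lambda>g. g i", OF _ n0 hawaiian_wedge hw])
  qed
  ultimately show ?thesis
    unfolding topological_group_def topspace_pi_top by (intro conjI ballI) (simp_all add: grp)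
qed

end

theorem theorem1p2:
  fixes Xs :: "nat \<Rightarrow> 'a topology" and xb :: "nat \<Rightarrow> 'a" and n :: nat
  assumes n2: "n \<ge> 2"
    and base: "\<And>j. xb j \<in> topspace (Xs j)"
    and CW: "\<And>j. compact_CW_space (Xs j)"
    and conn: "\<And>j. k_connected (n - 1) (Xs j)"
    and lconn: "\<And>j. locally_k_connected (n - 1) (Xs j)"
    and slsc: "\<And>j. n_slsc n (Xs j)"
  shows "topological_group (pi_top (hawaiian Xs xb) (hbase xb) n)
            (pi_mult (hawaiian Xs xb) (hbase xb) n) (pi_inv (hawaiian Xs xb) (hbase xb) n)
            (pi_one (hawaiian Xs xb) (hbase xb) n)
       \<and> metrizable_space (pi_top (hawaiian Xs xb) (hbase xb) n)
       \<and> homeomorphic_map (pi_top (hawaiian Xs xb) (hbase xb) n) (invlim_pi Xs xb n) (beta Xs xb n)"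
proof -
  interpret hawaiian_like Xs xb n
  proof
    show "Hausdorff_space (Xs j)" "compact_space (Xs j)" for j using CW[of j] by (simp_all add: compact_CW_space_def)
    show "well_pointed (Xs j) (xb j)" for j by (rule CW_well_pointed[OF CW base])
    show "1 < n" using n2 by simp
    show "null_at (Xs j) (xb j) m" if "m < n" for j m
      by (rule k_connected_null_at[OF conn _ base]) (use that in simp)
    show "well_pointed (Xs j) z" if "z \<in> topspace (Xs j)" for j z by (rule CW_well_pointed[OF CW that])
  qed
  show ?thesis using topological_group_pi_top metrizable_pi_top homeomorphic_map_beta by blast
qed

end
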